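(* Suppose $L>0$ and $L\notin E$, and let $u^j=u^j(L)\in X$ be a steady state of the problem with $\beta=0$, i.e. $\mathcal F(u^j,0)=0$. Then the linearized operator at $u^j$ has trivial kernel, and there exist $\beta_0>0$ and a $C^1$ function $(-\beta_0,\beta_0)\ni\beta\mapsto u^j_\beta\in H^4(0,L)$ (with values in $X$) with $u^j_0=u^j$ and $\mathcal F(u^j_\beta,\beta)=0$. Moreover, there exists $C>0$, depending only on $\mathcal F$ and $u^j_\beta$, such that $$\|u^j_\beta-u^j\|_{H^4(0,L)}\le C|\beta|.$$
   Context: $c_0\in\mathbb R$ is a fixed constant and $\zeta$ is a fixed (independent of $L$) real-analytic function with values in $(-1,0)$ on an open interval containing $[0,\infty)$. Set $\mu(u)=-u_{xx}+(u+c_0)^3-(u+c_0)+\zeta$, $$X=\{u\in H^4(0,L): u(0)=0,\ u_x(L)=0,\ \mu(u)(0)=\mu(u)_x(L)=0\},$$ and $\mathcal F:X\times(-1,1)\to L^2(0,L)$, $\mathcal F(u,\beta)=\big(-u_{xx}+(u+c_0)^3-(u+c_0)+\zeta\big)_{xx}-\beta u_x$. The linearized operator at a steady state $u$ for $\beta=0$ is $h\mapsto\big(-h_{xx}+(3(u+c_0)^2-1)h\big)_{xx}$, acting on $h\in H^4(0,L)$ satisfying the linearized boundary conditions $h(0)=h_x(L)=0$ and $m(0)=m_x(L)=0$ with $m=-h_{xx}+(3(u+c_0)^2-1)h$. Definition of $E$: for $L>0$ and $\tilde z\in\mathbb R$, let $\tilde v(\cdot;L,\tilde z)$ be the solution on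 $[0,1]$ of $-\tilde v_{yy}+L^2(\tilde v^3-\tilde v+\zeta(Ly))=0$, $\tilde v(0)=c_0$, $\tilde v_y(0)=\tilde z$, and $f(L,\tilde z):=\tilde v_y(1;L,\tilde z)$ (where the solution exists on all of $[0,1]$). Then $E=\{L>0:\exists\,\tilde z,\ f(L,\tilde z)=0=\partial_{\tilde z}f(L,\tilde z)\}$. *)

theory Defs
  imports "HOL-Analysis.Analysis"
begin

text \<open>Elements of \<open>L\<^sup>2(0,L)\<close> and of the Sobolev spaces are represented by functions
  \<^typ>\<open>real \<Rightarrow> real\<close>; only their a.e. class on the interval \<open>(0,L)\<close> matters.\<close>

definition L2 :: "real \<Rightarrow> (real \<Rightarrow> real) set" where
  "L2 L = {u. u \<in> borel_measurable (lebesgue_on {0<..<L}) \<and>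
              integrable (lebesgue_on {0<..<L}) (\<lambda>x. (u x)\<^sup>2)}"

definition ae_eq :: "real \<Rightarrow> (real \<Rightarrow> real) \<Rightarrow> (real \<Rightarrow> real) \<Rightarrow> bool" where
  "ae_eq L u v \<longleftrightarrow> (AE x in lebesgue_on {0<..<L}. u x = v x)"

text \<open>Smooth functions with compact support in \<open>(0,L)\<close>.\<close>

definition test_fun :: "real \<Rightarrow> (real \<Rightarrow> real) set" where
  "test_fun L = {\<phi>. (\<forall>n. (deriv ^^ n) \<phi> differentiable_on UNIV) \<and>
                    (\<exists>a b. 0 < a \<and> b < L \<and> (\<forall>x. x \<notin> {a..b} \<longrightarrow> \<phi> x = 0))}"

definition weak_deriv :: "real \<Rightarrow> nat \<Rightarrow> (real \<Rightarrow> real) \<Rightarrow> (real \<Rightarrow> real) \<Rightarrow> bool" where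
  "weak_deriv L k u v \<longleftrightarrow> (\<forall>\<phi> \<in> test_fun L.
     (LINT x|lebesgue_on {0<..<L}. u x * (deriv ^^ k) \<phi> x) =
     (-1) ^ k * (LINT x|lebesgue_on {0<..<L}. v x * \<phi> x))"

definition sobolev :: "nat \<Rightarrow> real \<Rightarrow> (real \<Rightarrow> real) set" where
  "sobolev k L = {u \<in> L2 L. \<forall>j\<le>k. \<exists>v \<in> L2 L. weak_deriv L j u v}"

text \<open>A representative of the \<open>k\<close>-th weak derivative (unique a.e.).  It is only meaningful if a
  weak derivative exists in \<^term>\<open>L2 L\<close>, in particular for \<^term>\<open>u \<in> sobolev k L\<close>.\<close>

definition wderiv :: "real \<Rightarrow> nat \<Rightarrow> (real \<Rightarrow> real) \<Rightarrow> real \<Rightarrow> real" where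
  "wderiv L k u = (SOME v. v \<in> L2 L \<and> weak_deriv L k u v)"

definition sobolev_norm :: "nat \<Rightarrow> real \<Rightarrow> (real \<Rightarrow> real) \<Rightarrow> real" where
  "sobolev_norm k L u =
     sqrt (\<Sum>j\<le>k. LINT x|lebesgue_on {0<..<L}. (wderiv L j u x)\<^sup>2)"

text \<open>Pointwise (boundary) values of a one-dimensional Sobolev function are those of its
  continuous representative on \<open>[0,L]\<close>.\<close>

definition trace_at :: "real \<Rightarrow> (real \<Rightarrow> real) \<Rightarrow> real \<Rightarrow> real" where
  "trace_at L u a = (THE c. \<exists>w. continuous_on {0..L} w \<and> ae_eq L w u \<and> w a = c)"

text \<open>\<open>C\<^sup>1\<close> maps from \<open>(-b,b)\<close> into the normed space \<open>H\<^sup>4(0,L)\<close>; \<open>U'\<close> is the derivative.\<close>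

definition C1_into_H4 :: "real \<Rightarrow> real \<Rightarrow> (real \<Rightarrow> real \<Rightarrow> real) \<Rightarrow> bool" where
  "C1_into_H4 L b U \<longleftrightarrow> (\<exists>U'. \<forall>\<beta>\<in>{-b<..<b}.
     U \<beta> \<in> sobolev 4 L \<and> U' \<beta> \<in> sobolev 4 L \<and>
     ((\<lambda>s. sobolev_norm 4 L (\<lambda>x. (U s x - U \<beta> x) / (s - \<beta>) - U' \<beta> x)) \<longlongrightarrow> 0) (at \<beta>) \<and>
     ((\<lambda>s. sobolev_norm 4 L (\<lambda>x. U' s x - U' \<beta> x)) \<longlongrightarrow> 0) (at \<beta>))"

definition real_analytic_on :: "(real \<Rightarrow> real) \<Rightarrow> real set \<Rightarrow> bool" where
  "real_analytic_on g I \<longleftrightarrow> (\<forall>p\<in>I. \<exists>r>0. \<exists>a :: nat \<Rightarrow> real.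
     \<forall>x. \<bar>x - p\<bar> < r \<longrightarrow> (\<lambda>n. a n * (x - p) ^ n) sums g x)"

definition mu :: "real \<Rightarrow> (real \<Rightarrow> real) \<Rightarrow> real \<Rightarrow> (real \<Rightarrow> real) \<Rightarrow> real \<Rightarrow> real" where
  "mu c0 \<zeta> L u = (\<lambda>x. - wderiv L 2 u x + (u x + c0) ^ 3 - (u x + c0) + \<zeta> x)"

definition X_space :: "real \<Rightarrow> (real \<Rightarrow> real) \<Rightarrow> real \<Rightarrow> (real \<Rightarrow> real) set" where
  "X_space c0 \<zeta> L = {u \<in> sobolev 4 L.
     trace_at L u 0 = 0 \<and> trace_at L (wderiv L 1 u) L = 0 \<and>
     trace_at L (mu c0 \<zeta> L u) 0 = 0 \<and> trace_at L (wderiv L 1 (mu c0 \<zeta> L u)) L = 0}"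

definition F_op :: "real \<Rightarrow> (real \<Rightarrow> real) \<Rightarrow> real \<Rightarrow> (real \<Rightarrow> real) \<Rightarrow> real \<Rightarrow> real \<Rightarrow> real" where
  "F_op c0 \<zeta> L u \<beta> = (\<lambda>x. wderiv L 2 (mu c0 \<zeta> L u) x - \<beta> * wderiv L 1 u x)"

definition lin_mu :: "real \<Rightarrow> real \<Rightarrow> (real \<Rightarrow> real) \<Rightarrow> (real \<Rightarrow> real) \<Rightarrow> real \<Rightarrow> real" where
  "lin_mu c0 L u h = (\<lambda>x. - wderiv L 2 h x + (3 * (u x + c0)\<^sup>2 - 1) * h x)"

definition lin_dom :: "real \<Rightarrow> real \<Rightarrow> (real \<Rightarrow> real) \<Rightarrow> (real \<Rightarrow> real) set" where
  "lin_dom c0 L u = {h \<in> sobolev 4 L.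
     trace_at L h 0 = 0 \<and> trace_at L (wderiv L 1 h) L = 0 \<and>
     trace_at L (lin_mu c0 L u h) 0 = 0 \<and> trace_at L (wderiv L 1 (lin_mu c0 L u h)) L = 0}"

definition lin_op :: "real \<Rightarrow> real \<Rightarrow> (real \<Rightarrow> real) \<Rightarrow> (real \<Rightarrow> real) \<Rightarrow> real \<Rightarrow> real" where
  "lin_op c0 L u h = wderiv L 2 (lin_mu c0 L u h)"

text \<open>The shooting problem; \<open>w\<close> is the derivative of the solution \<open>v\<close>.\<close>

definition shoot_sol ::
  "real \<Rightarrow> (real \<Rightarrow> real) \<Rightarrow> real \<Rightarrow> real \<Rightarrow> (real \<Rightarrow> real) \<Rightarrow> (real \<Rightarrow> real) \<Rightarrow> bool" where
  "shoot_sol c0 \<zeta> L z v w \<longleftrightarrow> v 0 = c0 \<and> w 0 = z \<and>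
     (\<forall>y\<in>{0..1}. (v has_real_derivative w y) (at y within {0..1}) \<and>
        (\<exists>d. (w has_real_derivative d) (at y within {0..1}) \<and>
             - d + L\<^sup>2 * (v y ^ 3 - v y + \<zeta> (L * y)) = 0))"

definition shoot_dom :: "real \<Rightarrow> (real \<Rightarrow> real) \<Rightarrow> real \<Rightarrow> real set" where
  "shoot_dom c0 \<zeta> L = {z. \<exists>v w. shoot_sol c0 \<zeta> L z v w}"

definition shoot :: "real \<Rightarrow> (real \<Rightarrow> real) \<Rightarrow> real \<Rightarrow> real \<Rightarrow> real" where
  "shoot c0 \<zeta> L z = (THE p. \<exists>v w. shoot_sol c0 \<zeta> L z v w \<and> p = w 1)"

text \<open>\<^const>\<open>shoot\<close> is a partial function of \<open>z\<close>, so its derivative is taken within its domain;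
  that domain is open by continuous dependence on initial data, so this is the ordinary
  partial derivative.\<close>

definition E_set :: "real \<Rightarrow> (real \<Rightarrow> real) \<Rightarrow> real set" where
  "E_set c0 \<zeta> = {L. L > 0 \<and> (\<exists>z \<in> shoot_dom c0 \<zeta> L. shoot c0 \<zeta> L z = 0 \<and>
     (shoot c0 \<zeta> L has_real_derivative 0) (at z within shoot_dom c0 \<zeta> L))}"

end

theory Submission
  imports Defs "HOL-Computational_Algebra.Polynomial"
begin

text \<open>A steady state for \<open>\<beta> = 0\<close> has an affine chemical potential, and the boundary conditions force
  it to vanish, so \<open>u\<close> is a classical solution of a second order two-point problem, and a kernel
  element of the linearization solves the linearized two-point problem. After rescaling to \<open>[0,1]\<close>
  a nontrivial kernel element would make the shooting function stationary at the zero given by \<open>u\<close>;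
  this is excluded by \<open>L \<notin> E\<close>.

  For \<open>\<beta> \<noteq> 0\<close>, integrating \<open>\<mu>'' = \<beta> w'\<close> with the boundary conditions gives
  \<open>\<mu> x = \<beta> (\<integral>\<^sub>0\<^sup>x w - x w L)\<close>. With the Green operator \<open>G\<close> of \<open>- h'' + (3 (u + c0)\<^sup>2 - 1) h\<close>,
  the perturbation \<open>h = w - u\<close> is a fixed point in \<open>C[0,L]\<close> of
  \<open>h \<mapsto> G (\<beta> T (u + h) - 3 (u + c0) h\<^sup>2 - h\<^sup>3)\<close>, a contraction near \<open>0\<close> that is \<open>C\<^sup>1\<close> in \<open>\<beta>\<close>.
  The equation expresses the first four derivatives of \<open>h\<close> as polynomials in \<open>C\<^sup>1\<close> curves in
  \<open>C[0,L]\<close>, which lifts the branch to \<open>H\<^sup>4\<close>.\<close>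

section \<open>Smooth test functions\<close>

text \<open>H^4 is available only as a predicate on functions modulo null sets, not as a Banach
  space type. Hence all calculus is done in the supremum norm, and Sobolev notions enter only at the
  two ends: a classical representative is extracted from \<open>u\<close>, and sup-norm statements
  about five curves (the perturbation and its first four derivatives) are turned back into H^4
  statements. The fourth derivative of the steady state involves the second derivative of \<zeta>,
  which analyticity supplies.

  For the exclusion by E the flow is not differentiated in the initial slope. The difference of two
  shooting solutions is paired with the rescaled kernel element; the pairing changes only by a
  quadratic remainder, which yields the derivative 0 directly. The obstacle is that the cubic is
  only locally Lipschitz, so a continuation argument must show that nearby shooting solutions stay
  close on all of [0,1].

  Triviality of the second order boundary value problem is used twice: for the first claim, and as
  invertibility behind the Green operator. The reduction to second order places both conditions on
  the chemical potential inside the right-hand side.\<close>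

primrec ndiff :: "nat \<Rightarrow> (real \<Rightarrow> real) \<Rightarrow> bool" where
  "ndiff 0 f \<longleftrightarrow> True"
| "ndiff (Suc n) f \<longleftrightarrow> (\<exists>g. (\<forall>x. (f has_real_derivative g x) (at x)) \<and> ndiff n g)"

lemma ndiff_Suc_deriv:
  "ndiff (Suc n) f \<longleftrightarrow> (\<forall>x. f differentiable at x) \<and> ndiff n (deriv f)"
proof
  assume "ndiff (Suc n) f"
  then obtain g where g: "\<And>x. (f has_real_derivative g x) (at x)" "ndiff n g" by auto
  then have "deriv f = g" by (simp add: DERIV_imp_deriv ext)
  with g show "(\<forall>x. f differentiable at x) \<and> ndiff n (deriv f)"
    using real_differentiable_def by blast
next
  assume "(\<forall>x. f differentiable at x) \<and> ndiff n (deriv f)"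
  then show "ndiff (Suc n) f"
    using DERIV_deriv_iff_real_differentiable by auto
qed

lemma ndiff_SucD: "ndiff (Suc n) f \<Longrightarrow> ndiff n f"
  by (induction n arbitrary: f) auto

lemma ndiff_add: "ndiff n f \<Longrightarrow> ndiff n g \<Longrightarrow> ndiff n (\<lambda>x. f x + g x)"
proof (induction n arbitrary: f g)
  case (Suc n)
  then obtain f' g' where "\<And>x. (f has_real_derivative f' x) (at x)" "ndiff n f'"
    "\<And>x. (g has_real_derivative g' x) (at x)" "ndiff n g'" by auto
  with Suc.IH show ?case
    by (auto intro!: exI[of _ "\<lambda>x. f' x + g' x"] derivative_eq_intros)
qed auto

lemma ndiff_cmult: "ndiff n f \<Longrightarrow> ndiff n (\<lambda>x. c * f x)" for c :: real
proof (induction n arbitrary: f)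
  case (Suc n)
  then obtain f' where "\<And>x. (f has_real_derivative f' x) (at x)" "ndiff n f'" by auto
  with Suc.IH show ?case
    by (auto intro!: exI[of _ "\<lambda>x. c * f' x"] derivative_eq_intros)
qed auto

lemma ndiff_mult: "ndiff n f \<Longrightarrow> ndiff n g \<Longrightarrow> ndiff n (\<lambda>x. f x * g x)"
proof (induction n arbitrary: f g)
  case (Suc n)
  then obtain f' g' where "\<And>x. (f has_real_derivative f' x) (at x)" "ndiff n f'"
    "\<And>x. (g has_real_derivative g' x) (at x)" "ndiff n g'" by auto
  moreover have "ndiff n f" "ndiff n g" using Suc.prems ndiff_SucD by auto
  ultimately show ?case
    using Suc.IH by (auto intro!: exI[of _ "\<lambda>x. f' x * g x + f x * g' x"] ndiff_add derivative_eq_intros)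
qed auto

lemma ndiff_affine: "ndiff n f \<Longrightarrow> ndiff n (\<lambda>x. f (c * x + d))"
proof (induction n arbitrary: f)
  case (Suc n)
  then obtain f' where f': "\<And>x. (f has_real_derivative f' x) (at x)" "ndiff n f'" by auto
  have "((\<lambda>x. f (c * x + d)) has_real_derivative c * f' (c * x + d)) (at x)" for x
    by (rule DERIV_cong[OF DERIV_chain2[OF f'(1)]]) (auto intro!: derivative_eq_intros)
  moreover have "ndiff n (\<lambda>x. c * f' (c * x + d))"
    using Suc.IH[OF f'(2)] by (rule ndiff_cmult)
  ultimately show ?case
    unfolding ndiff.simps by (intro exI[of _ "\<lambda>x. c * f' (c * x + d)"] conjI allI)
qed auto

text \<open>Bridge between two encodings of smoothness: the existential recursion
  \<open>ndiff\<close> is stable under sums, products and affine substitutions by plain induction,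
  while \<open>test_fun\<close> is phrased with iterates of \<open>deriv\<close>.\<close>

lemma all_ndiff_iff: "(\<forall>n. ndiff n f) \<longleftrightarrow> (\<forall>n. (deriv ^^ n) f differentiable_on UNIV)"
proof
  assume "\<forall>n. ndiff n f"
  then have "(deriv ^^ n) f differentiable_on UNIV \<and> (\<forall>m. ndiff m ((deriv ^^ n) f))" for n
  proof (induction n)
    case 0
    then show ?case using ndiff_Suc_deriv[of 0 f] by (auto simp: differentiable_on_def)
  next
    case (Suc n)
    then have *: "ndiff m ((deriv ^^ Suc n) f)" for m
      using ndiff_Suc_deriv[of m "(deriv ^^ n) f"] by (metis comp_apply funpow.simps(2))
    then show ?case using ndiff_Suc_deriv[of 0 "(deriv ^^ Suc n) f"]
      by (auto simp: differentiable_on_def)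
  qed
  then show "\<forall>n. (deriv ^^ n) f differentiable_on UNIV" by auto
next
  assume *: "\<forall>n. (deriv ^^ n) f differentiable_on UNIV"
  have "ndiff n ((deriv ^^ m) f)" for n m
  proof (induction n arbitrary: m)
    case (Suc n)
    from Suc[of "Suc m"] * show ?case
      unfolding ndiff_Suc_deriv by (auto simp: differentiable_on_def)
  qed auto
  from this[of _ 0] show "\<forall>n. ndiff n f" by simp
qed

section \<open>The flat exponential and smooth bump functions\<close>

definition exp_flat :: "real poly \<Rightarrow> real \<Rightarrow> real" where
  "exp_flat p x = (if 0 < x then poly p (1 / x) * exp (- 1 / x) else 0)"

lemma tendsto_poly_times_exp_minus:
  "((\<lambda>t. poly p t * exp (- t)) \<longlongrightarrow> 0) at_top" for p :: "real poly"
proof -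
  have "((\<lambda>t. \<Sum>i\<le>degree p. coeff p i * (t ^ i / exp t)) \<longlongrightarrow> (\<Sum>i\<le>degree p. coeff p i * 0)) at_top"
    by (intro tendsto_intros tendsto_power_div_exp_0)
  moreover have "(\<lambda>t. \<Sum>i\<le>degree p. coeff p i * (t ^ i / exp t)) = (\<lambda>t. poly p t * exp (- t))"
    by (auto simp: poly_altdef sum_distrib_right exp_minus divide_inverse mult.assoc)
  ultimately show ?thesis by simp
qed

lemma tendsto_exp_flat_0: "(exp_flat p \<longlongrightarrow> 0) (at 0)"
proof -
  have "((\<lambda>x. poly p (inverse x) * exp (- inverse x)) \<longlongrightarrow> 0) (at_right 0)"
    using filterlim_compose[OF tendsto_poly_times_exp_minus filterlim_inverse_at_top_right] .
  then have "(exp_flat p \<longlongrightarrow> 0) (at_right 0)"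
    by (rule Lim_transform_eventually)
      (auto simp: exp_flat_def eventually_at_filter divide_inverse)
  moreover have "(exp_flat p \<longlongrightarrow> 0) (at_left 0)"
    by (rule tendsto_eventually) (auto simp: exp_flat_def eventually_at_filter)
  ultimately show ?thesis
    by (simp add: filterlim_split_at)
qed

text \<open>Differentiating p(1/x) exp(-1/x) gives x^(-2) (p - p')(1/x) exp(-1/x). The family
  indexed by polynomials is thus closed under differentiation, which makes smoothness a one-line
  induction.\<close>

lemma DERIV_exp_flat:
  "(exp_flat p has_real_derivative exp_flat ([:0, 0, 1:] * (p - pderiv p)) x) (at x)"
proof -
  consider "x > 0" | "x < 0" | "x = 0" by linarith
  then show ?thesis
  proof cases
    case 1
    have "((\<lambda>x. poly p (1 / x) * exp (- 1 / x)) has_real_derivative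
        exp_flat ([:0, 0, 1:] * (p - pderiv p)) x) (at x)"
      using 1 by (auto intro!: derivative_eq_intros DERIV_chain2[OF poly_DERIV]
          simp: exp_flat_def field_simps power2_eq_square)
    moreover have "\<forall>\<^sub>F y in nhds x. poly p (1 / y) * exp (- 1 / y) = exp_flat p y"
      using eventually_nhds_in_open[of "{0<..}" x] 1
      by (auto elim!: eventually_mono simp: exp_flat_def)
    ultimately show ?thesis using DERIV_cong_ev by fastforce
  next
    case 2
    have "\<forall>\<^sub>F y in nhds x. exp_flat p y = 0"
      using eventually_nhds_in_open[of "{..<0}" x] 2
      by (auto elim!: eventually_mono simp: exp_flat_def)
    then show ?thesis
      using DERIV_cong_ev[of x x "exp_flat p" "\<lambda>_. 0" 0 0] 2 by (simp add: exp_flat_def)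
  next
    case 3
    \<comment> \<open>The difference quotient at 0 is again a member of the family, with polynomial
      X p, so its limit is already known.\<close>
    have "((\<lambda>h. (exp_flat p (0 + h) - exp_flat p 0) / h) \<longlongrightarrow> 0) (at 0)"
      by (rule Lim_transform_eventually[OF tendsto_exp_flat_0[of "[:0, 1:] * p"]])
        (auto simp: exp_flat_def eventually_at_filter)
    then show ?thesis using 3 unfolding DERIV_def by (simp add: exp_flat_def)
  qed
qed

lemma ndiff_exp_flat: "ndiff n (exp_flat p)"
  by (induction n arbitrary: p) (auto intro: DERIV_exp_flat)

lemma test_fun_iff:
  "\<phi> \<in> test_fun L \<longleftrightarrow> (\<forall>n. ndiff n \<phi>) \<and> (\<exists>a b. 0 < a \<and> b < L \<and> (\<forall>x. x \<notin> {a..b} \<longrightarrow> \<phi> x = 0))"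
  unfolding test_fun_def all_ndiff_iff by simp

lemma test_fun_DERIV:
  assumes "\<phi> \<in> test_fun L"
  shows "(\<phi> has_real_derivative deriv \<phi> x) (at x)"
  using assms ndiff_Suc_deriv[of 0 \<phi>] DERIV_deriv_iff_real_differentiable
  unfolding test_fun_iff by blast

lemma test_fun_continuous: "\<phi> \<in> test_fun L \<Longrightarrow> continuous_on S \<phi>"
  by (meson DERIV_continuous_on test_fun_DERIV has_field_derivative_at_within)

lemma test_fun_outside:
  assumes "\<phi> \<in> test_fun L" "x \<le> 0 \<or> L \<le> x"
  shows "\<phi> x = 0"
  using assms unfolding test_fun_iff by (meson atLeastAtMost_iff le_less_trans less_le_trans not_le)

lemma deriv_test_fun:
  assumes "\<phi> \<in> test_fun L"
  shows "deriv \<phi> \<in> test_fun L"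
proof -
  obtain a b where ab: "0 < a" "b < L" "\<And>x. x \<notin> {a..b} \<Longrightarrow> \<phi> x = 0"
    using assms unfolding test_fun_iff by auto
  have "deriv \<phi> x = 0" if "x \<notin> {a..b}" for x
  proof -
    have "\<forall>\<^sub>F y in nhds x. \<phi> y = 0"
      using eventually_nhds_in_open[of "- {a..b}" x] that ab(3)
      by (metis (mono_tags, lifting) Compl_iff closed_atLeastAtMost eventually_mono open_Compl)
    then have "(\<phi> has_real_derivative 0) (at x)"
      using DERIV_cong_ev[of x x \<phi> "\<lambda>_. 0" 0 0] by simp
    then show ?thesis by (rule DERIV_imp_deriv)
  qed
  moreover have "ndiff n (deriv \<phi>)" for n
    using assms ndiff_Suc_deriv unfolding test_fun_iff by blast
  ultimately show ?thesis using ab unfolding test_fun_iff by blast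
qed

lemma test_fun_add:
  assumes "\<phi> \<in> test_fun L" "\<psi> \<in> test_fun L"
  shows "(\<lambda>x. \<phi> x + \<psi> x) \<in> test_fun L"
proof -
  obtain a b where ab: "0 < a" "b < L" "\<And>x. x \<notin> {a..b} \<Longrightarrow> \<phi> x = 0"
    using assms unfolding test_fun_iff by auto
  obtain c d where cd: "0 < c" "d < L" "\<And>x. x \<notin> {c..d} \<Longrightarrow> \<psi> x = 0"
    using assms unfolding test_fun_iff by auto
  have "\<phi> x + \<psi> x = 0" if "x \<notin> {min a c..max b d}" for x
  proof -
    have "x \<notin> {a..b}" "x \<notin> {c..d}" using that by (auto simp: min_le_iff_disj le_max_iff_disj)
    then show ?thesis by (simp add: ab(3) cd(3))
  qed
  moreover have "0 < min a c" "max b d < L" using ab(1,2) cd(1,2) by auto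
  ultimately show ?thesis using assms ndiff_add unfolding test_fun_iff by blast
qed

lemma test_fun_cmult: "\<phi> \<in> test_fun L \<Longrightarrow> (\<lambda>x. c * \<phi> x) \<in> test_fun L"
  unfolding test_fun_iff by (metis ndiff_cmult mult_zero_right)

text \<open>The product of exp(-1/(k(x-a))) and exp(-1/(k(b-x))) vanishes outside (a,b), and both
  exponents tend to 0 inside as k grows. Strict positivity inside is recorded because a bump of
  nonzero mean is needed for the constancy theorem.\<close>

lemma test_fun_approx_indicator:
  assumes "0 < a" "a < b" "b < L"
  obtains \<phi> where "\<And>k. \<phi> k \<in> test_fun L" "\<And>k x. 0 \<le> \<phi> k x" "\<And>k x. \<phi> k x \<le> 1"
    "\<And>x. (\<lambda>k. \<phi> k x) \<longlonglongrightarrow> indicator {a<..<b} x" "\<And>k x. x \<in> {a<..<b} \<Longrightarrow> 0 < \<phi> k x"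
proof
  define B where "B = exp_flat 1"
  \<comment> \<open>The arguments have the shape \<open>c * x + d\<close> required by
    \<open>ndiff_affine\<close>; \<open>phi_eq\<close> restores the readable form.
    \<open>Suc k\<close> keeps the scale positive.\<close>
  define \<phi> where "\<phi> k x = B (real (Suc k) * x + (- real (Suc k) * a)) * B (- real (Suc k) * x + real (Suc k) * b)" for k x
  have phi_eq: "\<phi> k x = B (real (Suc k) * (x - a)) * B (real (Suc k) * (b - x))" for k x
    by (simp add: \<phi>_def algebra_simps)
  have out: "\<phi> k x = 0" if "x \<notin> {a<..<b}" for k x
    using that unfolding phi_eq
    by (auto simp: B_def exp_flat_def zero_less_mult_iff simp del: of_nat_Suc)
  have nd: "ndiff n (\<phi> k)" for n k
    unfolding \<phi>_def B_def by (intro ndiff_mult ndiff_affine ndiff_exp_flat)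
  show "\<phi> k \<in> test_fun L" for k
    unfolding test_fun_iff using nd out assms
    by (intro conjI allI exI[of _ a] exI[of _ b]) auto
  have B01: "0 \<le> B x" "B x \<le> 1" for x by (auto simp: B_def exp_flat_def)
  show "0 \<le> \<phi> k x" "\<phi> k x \<le> 1" for k x
    using B01 by (auto simp: \<phi>_def intro: mult_le_one)
  have B_eq: "\<phi> k x = exp (- 1 / (real (Suc k) * (x - a))) * exp (- 1 / (real (Suc k) * (b - x)))"
    if "x \<in> {a<..<b}" for k x
    using that unfolding phi_eq
    by (auto simp: B_def exp_flat_def zero_less_mult_iff simp del: of_nat_Suc)
  show "0 < \<phi> k x" if "x \<in> {a<..<b}" for k x
    unfolding B_eq[OF that] by simp
  show "(\<lambda>k. \<phi> k x) \<longlonglongrightarrow> indicator {a<..<b} x" for x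
  proof (cases "x \<in> {a<..<b}")
    case True
    have *: "(\<lambda>k. exp (- 1 / (real (Suc k) * c))) \<longlonglongrightarrow> 1" if "c > 0" for c :: real
    proof -
      have "(\<lambda>k. exp (- 1 / c * (1 / real (Suc k)))) \<longlonglongrightarrow> exp (- 1 / c * 0)"
        using LIMSEQ_inverse_real_of_nat by (intro tendsto_intros) (simp add: divide_inverse)
      then show ?thesis by (simp add: field_simps)
    qed
    have "(\<lambda>k. \<phi> k x) \<longlonglongrightarrow> 1 * 1"
      unfolding B_eq[OF True] using True by (intro tendsto_mult *) auto
    with True show ?thesis by simp
  qed (auto simp: out)
qed

lemma integrable_open_interval_iff:
  "integrable (lebesgue_on {0<..<L}) f \<longleftrightarrow> f absolutely_integrable_on {0<..<L}"
  for f :: "real \<Rightarrow> real"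
  by (simp add: integrable_restrict_space set_integrable_def)

lemma continuous_integrable_open:
  "continuous_on {0..L} f \<Longrightarrow> integrable (lebesgue_on {0<..<L}) f" for f :: "real \<Rightarrow> real"
  unfolding integrable_open_interval_iff absolutely_integrable_on_Icc_iff_Ioo[symmetric]
  by (rule absolutely_integrable_continuous_real)

text \<open>A primitive vanishing at 0 is constant on either side of the support of \<phi>. The zero
  mean forces the constant on the right to be 0 too, so the primitive has compact support.\<close>

lemma test_fun_antideriv:
  assumes L: "0 < L" and "\<phi> \<in> test_fun L" and int0: "(LINT x|lebesgue_on {0<..<L}. \<phi> x) = 0"
  obtains \<psi> where "\<psi> \<in> test_fun L" "deriv \<psi> = \<phi>"
proof -
  obtain a b where ab: "0 < a" "b < L" "\<And>x. x \<notin> {a..b} \<Longrightarrow> \<phi> x = 0"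
    using assms unfolding test_fun_iff by auto
  have "\<exists>F. \<forall>x :: real. - \<infinity> < ereal x \<longrightarrow> ereal x < \<infinity> \<longrightarrow> (F has_vector_derivative \<phi> x) (at x)"
    using test_fun_continuous[OF assms(2), of UNIV]
    by (intro einterval_antiderivative) (auto simp: continuous_on_eq_continuous_at)
  then obtain F where F: "\<And>x. (F has_real_derivative \<phi> x) (at x)"
    by (auto simp: has_real_derivative_iff_has_vector_derivative)
  define \<psi> where "\<psi> x = F x - F 0" for x
  have D: "(\<psi> has_real_derivative \<phi> x) (at x)" for x
    unfolding \<psi>_def by (auto intro!: derivative_eq_intros F)
  have "integrable (lebesgue_on {0<..<L}) \<phi>"
    using continuous_integrable_open test_fun_continuous[OF assms(2)] .
  then have "integral {0<..<L} \<phi> = 0"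
    using int0 by (simp add: lebesgue_integral_eq_integral)
  then have "integral {0..L} \<phi> = 0" by (simp add: integral_open_interval_real)
  moreover have "(\<phi> has_integral (\<psi> L - \<psi> 0)) {0..L}"
    using L D by (intro fundamental_theorem_of_calculus)
      (auto simp: has_real_derivative_iff_has_vector_derivative[symmetric] intro: has_field_derivative_at_within)
  ultimately have psiL: "\<psi> L = \<psi> 0" by (simp add: integral_unique)
  have left: "\<psi> x = 0" if "x < a" for x
  proof -
    have "\<forall>y\<in>{..<a}. (\<psi> has_real_derivative 0) (at y within {..<a})"
      using D ab(3) by (metis atLeastAtMost_iff has_field_derivative_at_within lessThan_iff not_le)
    then have "\<psi> x = \<psi> 0"
      using has_field_derivative_zero_constant[of "{..<a}" \<psi>] that ab(1) by (metis convex_real_interval(4) lessThan_iff)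
    then show ?thesis by (simp add: \<psi>_def)
  qed
  have right: "\<psi> x = 0" if "b < x" for x
  proof -
    have "\<forall>y\<in>{b<..}. (\<psi> has_real_derivative 0) (at y within {b<..})"
      using D ab(3) by (metis atLeastAtMost_iff has_field_derivative_at_within greaterThan_iff not_le)
    then have "\<psi> x = \<psi> L"
      using has_field_derivative_zero_constant[of "{b<..}" \<psi>] that ab(2) by (metis convex_real_interval(3) greaterThan_iff)
    then show ?thesis using psiL by (simp add: \<psi>_def)
  qed
  have "ndiff n \<psi>" for n
    using D assms(2) ndiff_SucD unfolding test_fun_iff by (meson ndiff.simps(2))
  then have "\<psi> \<in> test_fun L"
    unfolding test_fun_iff using ab left right
    by (intro conjI allI exI[of _ a] exI[of _ b]) (auto simp: not_le)
  moreover have "deriv \<psi> = \<phi>" using D DERIV_imp_deriv by blast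
  ultimately show thesis by (rule that)
qed

section \<open>The fundamental lemma and primitives of integrable functions\<close>

text \<open>Fubini and the Dynkin argument below run on \<open>lborel\<close>, whereas L^2 functions
  are measurable only for the completed measure. Passing to a Borel function that vanishes off (0,L)
  moves all pairings with continuous functions to \<open>lborel\<close>.\<close>

lemma borel_representative:
  fixes f :: "real \<Rightarrow> real"
  assumes "integrable (lebesgue_on {0<..<L}) f"
  obtains g where "integrable lborel g" "\<And>x. x \<notin> {0<..<L} \<Longrightarrow> g x = 0"
    "AE x in lebesgue_on {0<..<L}. f x = g x"
    "\<And>\<phi>. continuous_on UNIV \<phi> \<Longrightarrow>
      (LINT x|lebesgue_on {0<..<L}. f x * \<phi> x) = (LINT x|lborel. g x * \<phi> x)"
proof -
  let ?f = "\<lambda>x. indicator {0<..<L} x *\<^sub>R f x"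
  have fi: "integrable lebesgue ?f"
    using assms by (simp add: integrable_restrict_space)
  then obtain g' where g': "g' \<in> borel_measurable lborel" "AE x in lborel. ?f x = g' x"
    using completion_ex_borel_measurable_real by blast
  define g where "g x = indicator {0<..<L} x * g' x" for x
  have gm [measurable]: "g \<in> borel_measurable lborel" using g'(1) unfolding g_def by measurable
  have ae: "AE x in lebesgue. ?f x = g x"
    using AE_completion[OF g'(2)]
  proof eventually_elim
    case (elim x)
    then show ?case by (cases "x \<in> {0<..<L}") (simp_all add: g_def)
  qed
  have "integrable lebesgue g"
    using ae gm by (intro integrable_cong_AE_imp[OF fi]) (auto intro: measurable_completion)
  then have gi: "integrable lborel g"
    using gm by (simp add: integrable_completion)
  have "AE x in lebesgue_on {0<..<L}. f x = g x"
    using ae by (auto simp: AE_restrict_space_iff elim!: eventually_mono)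
  moreover have "(LINT x|lebesgue_on {0<..<L}. f x * \<phi> x) = (LINT x|lborel. g x * \<phi> x)"
    if "continuous_on UNIV \<phi>" for \<phi> :: "real \<Rightarrow> real"
  proof -
    have [measurable]: "\<phi> \<in> borel_measurable borel"
      using that by (rule borel_measurable_continuous_onI)
    have pl: "\<phi> \<in> borel_measurable lebesgue" by (rule measurable_completion) simp
    have "(LINT x|lebesgue_on {0<..<L}. f x * \<phi> x) = (LINT x|lebesgue. ?f x * \<phi> x)"
      by (simp add: integral_restrict_space mult.assoc)
    also have "\<dots> = (LINT x|lebesgue. g x * \<phi> x)"
      using ae fi pl gm
      by (intro integral_cong_AE borel_measurable_times) (auto intro: measurable_completion)
    also have "\<dots> = (LINT x|lborel. g x * \<phi> x)"
      by (rule integral_completion) measurable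
    finally show ?thesis .
  qed
  ultimately show thesis using gi that[of g] by (auto simp: g_def)
qed

text \<open>Dynkin's theorem: open intervals form an intersection-stable generator of the Borel
  sets, and the sets over which \<open>g\<close> integrates to 0 are closed under complements (by
  the zero total integral) and countable disjoint unions.\<close>

lemma AE_zero_if_interval_integrals_zero:
  fixes g :: "real \<Rightarrow> real"
  assumes gi: "integrable lborel g" and tot: "(LINT x|lborel. g x) = 0"
    and ivl: "\<And>a b. (LINT x:{a<..<b}|lborel. g x) = 0"
  shows "AE x in lborel. g x = 0"
proof (rule sigma_finite_measure.density_zero[OF lborel.sigma_finite_measure_axioms gi])
  fix A :: "real set" assume "A \<in> sets lborel"
  define G where "G = range (\<lambda>(a, b). {a<..<b::real})"
  have borel_G: "borel = sigma UNIV G"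
    using borel_eq_box[where 'a=real] by (simp add: G_def)
  have "A \<in> sigma_sets UNIV G"
    using \<open>A \<in> sets lborel\<close> by (simp add: borel_G)
  have setsI: "B \<in> sets lborel" if "B \<in> sigma_sets UNIV G" for B
    using that by (simp add: borel_G)
  have si: "set_integrable lborel B g" if "B \<in> sets lborel" for B
    using integrable_mult_indicator[OF that gi] by (simp add: set_integrable_def)
  have "Int_stable G"
  proof (rule Int_stableI)
    fix A B assume "A \<in> G" "B \<in> G"
    then obtain a b c d where "A = {a<..<b}" "B = {c<..<d}" by (auto simp: G_def)
    then have "A \<inter> B = {max a c<..<min b d}" by auto
    then show "A \<inter> B \<in> G" by (auto simp: G_def)
  qed
  moreover have "G \<subseteq> Pow UNIV" by simp
  ultimately show "(LINT x:A|lborel. g x) = 0" using \<open>A \<in> sigma_sets UNIV G\<close>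
  proof (induction rule: sigma_sets_induct_disjoint)
    case (basic A)
    then show ?case using ivl by (auto simp: G_def)
  next
    case empty
    then show ?case by (simp add: set_lebesgue_integral_def)
  next
    case (compl A)
    have "(LINT x:(A \<union> (UNIV - A))|lborel. g x) = (LINT x:A|lborel. g x) + (LINT x:(UNIV - A)|lborel. g x)"
      using setsI[OF compl(1)] by (intro set_integral_Un si) auto
    then show ?case using compl tot by (simp add: set_lebesgue_integral_def)
  next
    case (union A)
    have "A i \<in> sets lborel" for i using union(2) setsI by blast
    moreover from this have "(\<Union>i. A i) \<in> sets lborel" by blast
    ultimately have "(LINT x:(\<Union>i. A i)|lborel. g x) = (\<Sum>i. (LINT x:(A i)|lborel. g x))"
      using union(1)
      by (intro lebesgue_integral_countable_add si) (auto simp: disjoint_family_on_def)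
    then show ?case using union by simp
  qed
qed

text \<open>Bumps converge to indicators of intervals, and dominated convergence with majorant |g|
  turns orthogonality to test functions into vanishing integrals over intervals.\<close>

lemma fundamental_lemma:
  assumes fi: "integrable (lebesgue_on {0<..<L}) f"
    and orth: "\<And>\<phi>. \<phi> \<in> test_fun L \<Longrightarrow> (LINT x|lebesgue_on {0<..<L}. f x * \<phi> x) = 0"
  shows "AE x in lebesgue_on {0<..<L}. f x = 0"
proof -
  obtain g where g: "integrable lborel g" "\<And>x. x \<notin> {0<..<L} \<Longrightarrow> g x = 0"
    "AE x in lebesgue_on {0<..<L}. f x = g x"
    "\<And>\<phi>. continuous_on UNIV \<phi> \<Longrightarrow>
      (LINT x|lebesgue_on {0<..<L}. f x * \<phi> x) = (LINT x|lborel. g x * \<phi> x)"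
    using borel_representative[OF fi] by metis
  note [measurable] = borel_measurable_integrable[OF g(1)]
  have inner: "(LINT x|lborel. g x * indicator {a<..<b} x) = 0" if ab: "0 < a" "b < L" for a b
  proof (cases "a < b")
    case True
    obtain \<phi> where \<phi>: "\<And>k. \<phi> k \<in> test_fun L" "\<And>k x. 0 \<le> \<phi> k x" "\<And>k x. \<phi> k x \<le> 1"
      "\<And>x. (\<lambda>k. \<phi> k x) \<longlonglongrightarrow> indicator {a<..<b} x"
      "\<And>k x. x \<in> {a<..<b} \<Longrightarrow> 0 < \<phi> k x"
      by (rule test_fun_approx_indicator[OF ab(1) True ab(2)]) (rule that)
    have c: "continuous_on UNIV (\<phi> k)" for k using test_fun_continuous[OF \<phi>(1)] .
    have [measurable]: "\<phi> k \<in> borel_measurable borel" for k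
      using c by (rule borel_measurable_continuous_onI)
    have "(\<lambda>k. LINT x|lborel. g x * \<phi> k x) \<longlonglongrightarrow> (LINT x|lborel. g x * indicator {a<..<b} x)"
    proof (rule integral_dominated_convergence[where w="\<lambda>x. \<bar>g x\<bar>"])
      show "AE x in lborel. (\<lambda>k. g x * \<phi> k x) \<longlonglongrightarrow> g x * indicator {a<..<b} x"
        by (intro AE_I2 tendsto_intros \<phi>(4))
      show "AE x in lborel. norm (g x * \<phi> k x) \<le> \<bar>g x\<bar>" for k
        using \<phi>(2,3)[of k] by (intro AE_I2) (auto simp: abs_mult mult_left_le)
    qed (use g(1) in auto)
    moreover have "(LINT x|lborel. g x * \<phi> k x) = 0" for k
      using g(4)[OF c] orth[OF \<phi>(1)] by simp
    ultimately show ?thesis by (simp add: LIMSEQ_const_iff)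
  qed simp
  \<comment> \<open>Intervals reaching the boundary of (0,L) are exhausted by compactly contained
    ones, to which \<open>inner\<close> applies.\<close>
  have outer: "(LINT x|lborel. g x * indicator {a<..<b} x) = 0" if ab: "0 \<le> a" "b \<le> L" for a b
  proof -
    let ?I = "\<lambda>k. indicator {a + 1 / real (Suc k)<..<b - 1 / real (Suc k)} :: real \<Rightarrow> real"
    have "(\<lambda>k. LINT x|lborel. g x * ?I k x) \<longlonglongrightarrow> (LINT x|lborel. g x * indicator {a<..<b} x)"
    proof (rule integral_dominated_convergence[where w="\<lambda>x. \<bar>g x\<bar>"])
      have "(\<lambda>k. ?I k x) \<longlonglongrightarrow> indicator {a<..<b} x" for x
      proof (cases "x \<in> {a<..<b}")
        case True
        have "(\<lambda>k. a + 1 / real (Suc k)) \<longlonglongrightarrow> a + 0" "(\<lambda>k. b - 1 / real (Suc k)) \<longlonglongrightarrow> b - 0"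
          by (intro tendsto_intros lim_1_over_n[THEN LIMSEQ_Suc])+
        then have "\<forall>\<^sub>F k in sequentially. a + 1 / real (Suc k) < x" "\<forall>\<^sub>F k in sequentially. x < b - 1 / real (Suc k)"
          using True by (auto dest: order_tendstoD)
        then have "\<forall>\<^sub>F k in sequentially. ?I k x = indicator {a<..<b} x"
          by eventually_elim (use True in auto)
        then show ?thesis by (rule tendsto_eventually)
      next
        case False
        have "0 \<le> 1 / real (Suc k)" for k by simp
        then have "?I k x = 0" for k
          using False by (smt (verit) greaterThanLessThan_iff indicator_simps(2))
        with False show ?thesis by simp
      qed
      then show "AE x in lborel. (\<lambda>k. g x * ?I k x) \<longlonglongrightarrow> g x * indicator {a<..<b} x"
        by (intro AE_I2 tendsto_intros)
    qed (use g(1) in \<open>auto simp: indicator_def\<close>)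
    moreover have "(LINT x|lborel. g x * ?I k x) = 0" for k
      by (rule inner) (use ab in \<open>auto simp: add_nonneg_pos less_le_trans[of _ b]\<close>)
    ultimately show ?thesis by (simp add: LIMSEQ_const_iff)
  qed
  have "AE x in lborel. g x = 0"
  proof (rule AE_zero_if_interval_integrals_zero[OF g(1)])
    \<comment> \<open>Since \<open>g\<close> vanishes off (0,L), an arbitrary interval may be
      clipped to it.\<close>
    have eq: "g x * indicator {max a 0<..<min b L} x = indicator {a<..<b} x *\<^sub>R g x" for a b x
      using g(2)[of x] by (auto simp: indicator_def)
    show "(LINT x:{a<..<b}|lborel. g x) = 0" for a b
      using outer[of "max a 0" "min b L"] unfolding eq by (simp add: set_lebesgue_integral_def)
    have "(\<lambda>x. g x * indicator {0<..<L} x) = g"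
    proof
      show "g x * indicator {0<..<L} x = g x" for x
        using g(2)[of x] by (cases "x \<in> {0<..<L}") simp_all
    qed
    then show "(LINT x|lborel. g x) = 0" using outer[of 0 L] by simp
  qed
  then have "AE x in lebesgue_on {0<..<L}. g x = 0"
    by (auto simp: AE_restrict_space_iff dest!: AE_completion elim!: eventually_mono)
  with g(3) show ?thesis by eventually_elim simp
qed

text \<open>Integration by parts through Fubini: in the double integral of g(y) \<phi>'(x) over y
  \<le> x, integrating first in x leaves -\<phi>(y), because \<phi> vanishes at L.\<close>

lemma weak_deriv_indefinite_lborel:
  fixes g :: "real \<Rightarrow> real"
  assumes gi: "integrable lborel g" and g0: "\<And>x. x \<notin> {0<..<L} \<Longrightarrow> g x = 0" and \<phi>: "\<phi> \<in> test_fun L"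
  shows "(LINT x|lborel. (LINT y|lborel. g y * indicator {y..} x) * deriv \<phi> x)
       = - (LINT x|lborel. g x * \<phi> x)"
proof (cases "0 < L")
  case True
  note [measurable] = borel_measurable_integrable[OF gi]
  have c: "continuous_on S (deriv \<phi>)" for S using test_fun_continuous[OF deriv_test_fun[OF \<phi>]] .
  then have [measurable]: "deriv \<phi> \<in> borel_measurable borel"
    by (rule borel_measurable_continuous_onI)
  have d0: "deriv \<phi> x = 0" if "x \<notin> {0..L}" for x
    using test_fun_outside[OF deriv_test_fun[OF \<phi>], of x] that by auto
  have di: "integrable lborel (deriv \<phi>)"
  proof -
    have "integrable lborel (\<lambda>x. indicator {0..L} x *\<^sub>R deriv \<phi> x)"
      using borel_integrable_compact[OF compact_Icc c] by (simp add: mult.commute)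
    moreover have "(\<lambda>x. indicator {0..L} x *\<^sub>R deriv \<phi> x) = deriv \<phi>"
    proof
      show "indicator {0..L} x *\<^sub>R deriv \<phi> x = deriv \<phi> x" for x
        using d0[of x] by (cases "x \<in> {0..L}") simp_all
    qed
    ultimately show ?thesis by simp
  qed
  define K where "K = (\<lambda>(y, x). g y * (indicator {y..} x * deriv \<phi> x))"
  have [measurable]: "K \<in> borel_measurable (lborel \<Otimes>\<^sub>M lborel)"
  proof -
    have "K = (\<lambda>p. g (fst p) * (indicator {q. fst q \<le> snd q} p * deriv \<phi> (snd p)))"
      by (auto simp: K_def indicator_def)
    also have "\<dots> \<in> borel_measurable (lborel \<Otimes>\<^sub>M lborel)" by measurable
    finally show ?thesis .
  qed
  \<comment> \<open>The kernel is dominated by the tensor product of \<open>g\<close> and \<phi>',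
    both integrable.\<close>
  have Ki: "integrable (lborel \<Otimes>\<^sub>M lborel) K"
  proof (rule Bochner_Integration.integrable_bound[where f="\<lambda>(y, x). g y * deriv \<phi> x"])
    show "integrable (lborel \<Otimes>\<^sub>M lborel) (\<lambda>(y, x). g y * deriv \<phi> x)"
    proof (rule lborel_pair.Fubini_integrable)
      show "integrable lborel (\<lambda>y. LINT x|lborel. norm (case (y, x) of (y, x) \<Rightarrow> g y * deriv \<phi> x))"
        using gi by (simp add: abs_mult)
      show "AE y in lborel. integrable lborel (\<lambda>x. case (y, x) of (y, x) \<Rightarrow> g y * deriv \<phi> x)"
        using di by simp
    qed measurable
    show "AE p in lborel \<Otimes>\<^sub>M lborel. norm (K p) \<le> norm (case p of (y, x) \<Rightarrow> g y * deriv \<phi> x)"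
      by (intro AE_I2) (auto simp: K_def indicator_def)
  qed simp
  have "(LINT x|lborel. (LINT y|lborel. g y * indicator {y..} x) * deriv \<phi> x)
      = (LINT x|lborel. LINT y|lborel. K (y, x))"
    by (simp add: K_def mult.assoc[symmetric])
  also have "\<dots> = (LINT y|lborel. LINT x|lborel. K (y, x))"
    using lborel_pair.Fubini_integral[of "\<lambda>y x. K (y, x)"] Ki by simp
  also have "\<dots> = (LINT y|lborel. g y * (- \<phi> y))"
  proof (rule Bochner_Integration.integral_cong)
    fix y
    show "(LINT x|lborel. K (y, x)) = g y * - \<phi> y"
    proof (cases "y \<in> {0<..<L}")
      case True
      have eq: "indicator {y..} x * deriv \<phi> x = indicator {y..L} x * deriv \<phi> x" for x
        using d0[of x] by (auto simp: indicator_def)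
      have "(LINT x|lborel. deriv \<phi> x * indicator {y..L} x) = \<phi> L - \<phi> y"
        using True test_fun_DERIV[OF \<phi>] c[of UNIV]
        by (intro integral_FTC_Icc_real) (auto simp: continuous_on_eq_continuous_at)
      then have "(LINT x|lborel. indicator {y..} x * deriv \<phi> x) = - \<phi> y"
        unfolding eq using test_fun_outside[OF \<phi>, of L] by (simp add: mult.commute)
      then show ?thesis unfolding K_def by simp
    qed (auto simp: K_def g0)
  qed simp
  finally show ?thesis by simp
next
  case False
  then have "g x = 0" for x using g0[of x] by auto
  then show ?thesis by simp
qed

section \<open>Weak derivatives on an interval\<close>

abbreviation (input) ivl :: "real \<Rightarrow> real measure" where
  "ivl L \<equiv> lebesgue_on {0<..<L}"

section \<open>Square-integrable functions and rules for weak derivatives\<close>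

lemma finite_measure_ivl: "finite_measure (ivl L)"
  by (rule finite_measure_lebesgue_on) simp

lemma continuous_measurable_ivl:
  fixes f :: "real \<Rightarrow> real"
  shows "continuous_on {0..L} f \<Longrightarrow> f \<in> borel_measurable (ivl L)"
  using continuous_integrable_open by blast

lemma test_fun_measurable: "\<phi> \<in> test_fun L \<Longrightarrow> \<phi> \<in> borel_measurable (ivl L)"
  by (rule continuous_measurable_ivl[OF test_fun_continuous])

lemma funpow_deriv_test_fun: "\<phi> \<in> test_fun L \<Longrightarrow> (deriv ^^ k) \<phi> \<in> test_fun L"
  by (induction k) (auto intro: deriv_test_fun)

lemma L2_measurable: "u \<in> L2 L \<Longrightarrow> u \<in> borel_measurable (ivl L)"
  by (simp add: L2_def)

lemma L2_integrable:
  assumes "u \<in> L2 L"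
  shows "integrable (ivl L) u"
proof (rule Bochner_Integration.integrable_bound[where f="\<lambda>x. 1 + (u x)\<^sup>2"])
  interpret finite_measure "ivl L" by (rule finite_measure_ivl)
  show "integrable (ivl L) (\<lambda>x. 1 + (u x)\<^sup>2)"
    using assms by (auto simp: L2_def)
  have "\<bar>t\<bar> \<le> 1 + t\<^sup>2" for t :: real
    using zero_le_power2[of "\<bar>t\<bar> - 1"] zero_le_power2[of t] by (simp add: power2_diff)
  then show "AE x in ivl L. norm (u x) \<le> norm (1 + (u x)\<^sup>2)"
    by (intro AE_I2) (simp add: abs_of_nonneg add_nonneg_nonneg)
qed (use assms in \<open>simp add: L2_def\<close>)

lemma integrable_mult_continuous:
  fixes u \<phi> :: "real \<Rightarrow> real"
  assumes "integrable (ivl L) u" "continuous_on {0..L} \<phi>"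
  shows "integrable (ivl L) (\<lambda>x. u x * \<phi> x)"
proof -
  have "compact (\<phi> ` {0..L})" using assms(2) by (intro compact_continuous_image) auto
  then obtain B where B: "\<And>x. x \<in> {0..L} \<Longrightarrow> \<bar>\<phi> x\<bar> \<le> B"
    by (metis (no_types, lifting) bounded_iff compact_imp_bounded image_eqI real_norm_def)
  show ?thesis
  proof (rule Bochner_Integration.integrable_bound[where f="\<lambda>x. B * u x"])
    show "AE x in ivl L. norm (u x * \<phi> x) \<le> norm (B * u x)"
    proof (intro AE_I2)
      fix x assume "x \<in> space (ivl L)"
      then have "\<bar>\<phi> x\<bar> \<le> \<bar>B\<bar>" using B[of x] by force
      then show "norm (u x * \<phi> x) \<le> norm (B * u x)"
        by (simp add: abs_mult mult.commute mult_right_mono)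
    qed
    show "(\<lambda>x. u x * \<phi> x) \<in> borel_measurable (ivl L)"
      using assms continuous_measurable_ivl by (intro borel_measurable_times) auto
  qed (use assms in auto)
qed

lemma integrable_mult_test_fun:
  "integrable (ivl L) u \<Longrightarrow> \<phi> \<in> test_fun L \<Longrightarrow> integrable (ivl L) (\<lambda>x. u x * \<phi> x)"
  by (intro integrable_mult_continuous test_fun_continuous)

lemma continuous_L2:
  fixes f :: "real \<Rightarrow> real"
  assumes "continuous_on {0..L} f"
  shows "f \<in> L2 L"
  using assms unfolding L2_def
  by (auto intro: continuous_measurable_ivl continuous_integrable_open continuous_intros)

lemma L2_add:
  assumes "u \<in> L2 L" "v \<in> L2 L"
  shows "(\<lambda>x. u x + v x) \<in> L2 L"
proof -
  have [measurable]: "u \<in> borel_measurable (ivl L)" "v \<in> borel_measurable (ivl L)"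
    using assms by (auto simp: L2_def)
  have "integrable (ivl L) (\<lambda>x. (u x + v x)\<^sup>2)"
  proof (rule Bochner_Integration.integrable_bound[where f="\<lambda>x. 2 * (u x)\<^sup>2 + 2 * (v x)\<^sup>2"])
    show "integrable (ivl L) (\<lambda>x. 2 * (u x)\<^sup>2 + 2 * (v x)\<^sup>2)"
      using assms by (auto simp: L2_def)
    have "(s + t)\<^sup>2 \<le> 2 * s\<^sup>2 + 2 * t\<^sup>2" for s t :: real
      using zero_le_power2[of "s - t"] by (simp add: power2_eq_square algebra_simps)
    then show "AE x in ivl L. norm ((u x + v x)\<^sup>2) \<le> norm (2 * (u x)\<^sup>2 + 2 * (v x)\<^sup>2)"
      by (intro AE_I2) simp
  qed measurable
  then show ?thesis by (simp add: L2_def)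
qed

lemma L2_cmult: "u \<in> L2 L \<Longrightarrow> (\<lambda>x. c * u x) \<in> L2 L"
  by (auto simp: L2_def power_mult_distrib)

lemma weak_deriv_cong:
  assumes "u \<in> borel_measurable (ivl L)" "u' \<in> borel_measurable (ivl L)" "ae_eq L u u'"
    and "v \<in> borel_measurable (ivl L)" "v' \<in> borel_measurable (ivl L)" "ae_eq L v v'"
    and "weak_deriv L k u v"
  shows "weak_deriv L k u' v'"
  unfolding weak_deriv_def
proof
  fix \<phi> assume \<phi>: "\<phi> \<in> test_fun L"
  note [measurable] = assms(1,2,4,5) test_fun_measurable[OF \<phi>]
    test_fun_measurable[OF funpow_deriv_test_fun[OF \<phi>]]
  have "(LINT x|ivl L. u x * (deriv ^^ k) \<phi> x) = (LINT x|ivl L. u' x * (deriv ^^ k) \<phi> x)"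
    using assms(3) by (intro integral_cong_AE) (auto simp: ae_eq_def)
  moreover have "(LINT x|ivl L. v x * \<phi> x) = (LINT x|ivl L. v' x * \<phi> x)"
    using assms(6) by (intro integral_cong_AE) (auto simp: ae_eq_def)
  ultimately show "(LINT x|ivl L. u' x * (deriv ^^ k) \<phi> x) = (- 1) ^ k * (LINT x|ivl L. v' x * \<phi> x)"
    using assms(7) \<phi> unfolding weak_deriv_def by simp
qed

lemma ae_eq_refl [simp]: "ae_eq L u u"
  by (simp add: ae_eq_def)

lemma ae_eq_sym: "ae_eq L u v \<Longrightarrow> ae_eq L v u"
  unfolding ae_eq_def by (auto elim: eventually_mono)

lemma ae_eq_trans [trans]: "ae_eq L u v \<Longrightarrow> ae_eq L v w \<Longrightarrow> ae_eq L u w"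
  unfolding ae_eq_def by (rule AE_mp) (auto elim: eventually_mono)

lemma ae_eqI: "(\<And>x. 0 < x \<Longrightarrow> x < L \<Longrightarrow> u x = v x) \<Longrightarrow> ae_eq L u v"
  unfolding ae_eq_def by (intro AE_I2) auto

lemma weak_deriv_lincomb:
  assumes "integrable (ivl L) u" "integrable (ivl L) u'" "integrable (ivl L) v" "integrable (ivl L) v'"
    and "weak_deriv L k u v" "weak_deriv L k u' v'"
  shows "weak_deriv L k (\<lambda>x. a * u x + b * u' x) (\<lambda>x. a * v x + b * v' x)"
  unfolding weak_deriv_def
proof
  fix \<phi> assume \<phi>: "\<phi> \<in> test_fun L"
  note i = integrable_mult_test_fun[OF _ \<phi>] integrable_mult_test_fun[OF _ funpow_deriv_test_fun[OF \<phi>]]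
  have "(LINT x|ivl L. (a * u x + b * u' x) * (deriv ^^ k) \<phi> x)
      = a * (LINT x|ivl L. u x * (deriv ^^ k) \<phi> x) + b * (LINT x|ivl L. u' x * (deriv ^^ k) \<phi> x)"
    using i assms(1,2) by (simp add: distrib_right mult.assoc)
  moreover have "(LINT x|ivl L. (a * v x + b * v' x) * \<phi> x)
      = a * (LINT x|ivl L. v x * \<phi> x) + b * (LINT x|ivl L. v' x * \<phi> x)"
    using i assms(3,4) by (simp add: distrib_right mult.assoc)
  ultimately show "(LINT x|ivl L. (a * u x + b * u' x) * (deriv ^^ k) \<phi> x)
      = (- 1) ^ k * (LINT x|ivl L. (a * v x + b * v' x) * \<phi> x)"
    using assms(5,6) \<phi> unfolding weak_deriv_def by (simp add: algebra_simps)
qed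

lemma weak_deriv_unique:
  assumes "integrable (ivl L) v" "integrable (ivl L) v'" "weak_deriv L k u v" "weak_deriv L k u v'"
  shows "ae_eq L v v'"
proof -
  have "AE x in ivl L. v x - v' x = 0"
  proof (rule fundamental_lemma)
    fix \<phi> assume \<phi>: "\<phi> \<in> test_fun L"
    have "(LINT x|ivl L. v x * \<phi> x) = (LINT x|ivl L. v' x * \<phi> x)"
      using assms(3,4) \<phi> unfolding weak_deriv_def by (auto simp: uminus_power_if split: if_splits)
    then show "(LINT x|ivl L. (v x - v' x) * \<phi> x) = 0"
      using integrable_mult_test_fun[OF _ \<phi>] assms(1,2) by (simp add: left_diff_distrib)
  qed (use assms in auto)
  then show ?thesis unfolding ae_eq_def by eventually_elim simp
qed

lemma weak_deriv_0 [simp]: "weak_deriv L 0 u u"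
  by (simp add: weak_deriv_def)

lemma weak_deriv_Suc:
  assumes "weak_deriv L k u v" "weak_deriv L 1 v w"
  shows "weak_deriv L (Suc k) u w"
  unfolding weak_deriv_def
proof
  fix \<phi> assume \<phi>: "\<phi> \<in> test_fun L"
  have "(LINT x|ivl L. u x * (deriv ^^ Suc k) \<phi> x) = (LINT x|ivl L. u x * (deriv ^^ k) (deriv \<phi>) x)"
    unfolding funpow_Suc_right by simp
  also have "\<dots> = (- 1) ^ k * (LINT x|ivl L. v x * deriv \<phi> x)"
    using assms(1) deriv_test_fun[OF \<phi>] unfolding weak_deriv_def by blast
  also have "\<dots> = (- 1) ^ Suc k * (LINT x|ivl L. w x * \<phi> x)"
    using assms(2) \<phi> unfolding weak_deriv_def by simp
  finally show "(LINT x|ivl L. u x * (deriv ^^ Suc k) \<phi> x) = (- 1) ^ Suc k * (LINT x|ivl L. w x * \<phi> x)" .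
qed

text \<open>\<open>sobolev\<close> relates each weak derivative to \<open>u\<close> alone. Testing
  with \<phi>' in place of \<phi> links consecutive ones by a first order relation, which can then
  be integrated.\<close>

lemma weak_deriv_step:
  assumes "weak_deriv L k u v" "weak_deriv L (Suc k) u w"
  shows "weak_deriv L 1 v w"
  unfolding weak_deriv_def
proof
  fix \<phi> assume \<phi>: "\<phi> \<in> test_fun L"
  have "(- 1) ^ k * (LINT x|ivl L. v x * deriv \<phi> x) = (LINT x|ivl L. u x * (deriv ^^ k) (deriv \<phi>) x)"
    using assms(1) deriv_test_fun[OF \<phi>] unfolding weak_deriv_def by simp
  also have "\<dots> = (LINT x|ivl L. u x * (deriv ^^ Suc k) \<phi> x)"
    unfolding funpow_Suc_right by simp
  also have "\<dots> = (- 1) ^ Suc k * (LINT x|ivl L. w x * \<phi> x)"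
    using assms(2) \<phi> unfolding weak_deriv_def by blast
  finally show "(LINT x|ivl L. v x * (deriv ^^ 1) \<phi> x) = (- 1) ^ 1 * (LINT x|ivl L. w x * \<phi> x)"
    by (auto simp: uminus_power_if split: if_splits)
qed

lemma weak_deriv_const: "weak_deriv L 1 (\<lambda>_. c) (\<lambda>_. 0)"
  unfolding weak_deriv_def
proof
  fix \<phi> assume \<phi>: "\<phi> \<in> test_fun L"
  have "(LINT x|ivl L. deriv \<phi> x) = 0"
  proof (cases "0 < L")
    case True
    have "(deriv \<phi> has_integral (\<phi> L - \<phi> 0)) {0..L}"
      using True test_fun_DERIV[OF \<phi>] by (intro fundamental_theorem_of_calculus)
        (auto simp: has_real_derivative_iff_has_vector_derivative[symmetric] intro: has_field_derivative_at_within)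
    then have "integral {0<..<L} (deriv \<phi>) = 0"
      using test_fun_outside[OF \<phi>, of 0] test_fun_outside[OF \<phi>, of L]
      by (simp add: integral_open_interval_real[symmetric] integral_unique)
    moreover have "integrable (ivl L) (deriv \<phi>)"
      by (intro continuous_integrable_open test_fun_continuous[OF deriv_test_fun[OF \<phi>]])
    ultimately show ?thesis by (simp add: lebesgue_integral_eq_integral)
  qed simp
  then show "(LINT x|ivl L. c * (deriv ^^ 1) \<phi> x) = (- 1) ^ 1 * (LINT x|ivl L. 0 * \<phi> x)" by simp
qed

text \<open>The du Bois-Reymond argument: subtracting a multiple of a fixed bump from a test
  function makes its mean zero, so it becomes the derivative of a test function and pairs to 0 with
  \<open>f\<close>. The constant is the mean of \<open>f\<close> weighted by that bump.\<close>

lemma weak_deriv_zero_imp_const: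
  assumes L: "0 < L" and fi: "integrable (ivl L) f" and "weak_deriv L 1 f (\<lambda>_. 0)"
  obtains c where "ae_eq L f (\<lambda>_. c)"
proof -
  have L3: "0 < L / 3" "L / 3 < 2 * L / 3" "2 * L / 3 < L" using L by auto
  obtain \<eta> where \<eta>: "\<And>k. \<eta> k \<in> test_fun L" "\<And>k x. 0 \<le> \<eta> k x" "\<And>k x. \<eta> k x \<le> 1"
    "\<And>x. (\<lambda>k. \<eta> k x) \<longlonglongrightarrow> indicator {L/3<..<2*L/3} x"
    "\<And>k x. x \<in> {L/3<..<2*L/3} \<Longrightarrow> 0 < \<eta> k x"
    by (rule test_fun_approx_indicator[OF L3]) (rule that)
  have \<eta>i: "integrable (ivl L) (\<eta> 0)"
    by (rule continuous_integrable_open[OF test_fun_continuous[OF \<eta>(1)]])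
  define s where "s = (LINT x|ivl L. \<eta> 0 x)"
  \<comment> \<open>A nonnegative continuous function with zero integral vanishes, but the bump is
    positive at L/2.\<close>
  have "s \<noteq> 0"
  proof
    assume "s = 0"
    then have "integral {0..L} (\<eta> 0) = 0"
      using \<eta>i unfolding s_def by (simp add: lebesgue_integral_eq_integral integral_open_interval_real)
    then have "\<forall>x\<in>{0..L}. \<eta> 0 x = 0"
      using integral_eq_0_iff[OF test_fun_continuous[OF \<eta>(1)]] L \<eta>(2) by blast
    then show False using \<eta>(5)[of "L/2" 0] L by auto
  qed
  define c where "c = (LINT x|ivl L. f x * \<eta> 0 x) / s"
  have "AE x in ivl L. f x - c = 0"
  proof (rule fundamental_lemma)
    interpret finite_measure "ivl L" by (rule finite_measure_ivl)
    show "integrable (ivl L) (\<lambda>x. f x - c)" using fi by simp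
    fix \<phi> assume \<phi>: "\<phi> \<in> test_fun L"
    have \<phi>i: "integrable (ivl L) \<phi>"
      by (rule continuous_integrable_open[OF test_fun_continuous[OF \<phi>]])
    define t where "t = (LINT x|ivl L. \<phi> x)"
    \<comment> \<open>The coefficient is chosen so that the mean of \<omega> is t - (t / s) s =
      0.\<close>
    define \<omega> where "\<omega> = (\<lambda>x. \<phi> x + (- t / s) * \<eta> 0 x)"
    have "\<omega> \<in> test_fun L" unfolding \<omega>_def by (intro test_fun_add test_fun_cmult \<phi> \<eta>(1))
    moreover have "(LINT x|ivl L. \<omega> x) = 0"
      unfolding \<omega>_def using \<phi>i \<eta>i \<open>s \<noteq> 0\<close> by (simp add: s_def[symmetric] t_def[symmetric])
    ultimately obtain \<psi> where \<psi>: "\<psi> \<in> test_fun L" "deriv \<psi> = \<omega>"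
      using test_fun_antideriv[OF L] by metis
    have "(LINT x|ivl L. f x * \<omega> x) = 0"
      using assms(3) \<psi> unfolding weak_deriv_def by auto
    moreover have "(LINT x|ivl L. f x * \<omega> x)
        = (LINT x|ivl L. f x * \<phi> x) - t * c"
    proof -
      have "f x * \<omega> x = f x * \<phi> x - t / s * (f x * \<eta> 0 x)" for x
        unfolding \<omega>_def by (simp add: algebra_simps)
      then show ?thesis
        using integrable_mult_test_fun[OF fi \<phi>] integrable_mult_test_fun[OF fi \<eta>(1)[of 0]]
        by (simp add: c_def)
    qed
    ultimately show "(LINT x|ivl L. (f x - c) * \<phi> x) = 0"
      using integrable_mult_test_fun[OF fi \<phi>] \<phi>i by (simp add: left_diff_distrib t_def)
  qed
  then have "ae_eq L f (\<lambda>_. c)" unfolding ae_eq_def by eventually_elim simp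
  then show thesis by (rule that)
qed

text \<open>On (0,L) the gauge-integral primitive equals the \<open>lborel\<close> primitive of a
  Borel representative, for which integration by parts is known.\<close>

lemma indefinite_integral_weak_deriv:
  assumes L: "0 < L" and vi: "integrable (ivl L) v"
  shows "continuous_on {0..L} (\<lambda>x. integral {0..x} v)"
    and "weak_deriv L 1 (\<lambda>x. integral {0..x} v) v"
proof -
  have ai: "v absolutely_integrable_on {0..L}"
    using vi unfolding integrable_open_interval_iff absolutely_integrable_on_Icc_iff_Ioo .
  then show c: "continuous_on {0..L} (\<lambda>x. integral {0..x} v)"
    by (intro indefinite_integral_continuous_1) (rule set_lebesgue_integral_eq_integral(1))
  obtain g where g: "integrable lborel g" "\<And>x. x \<notin> {0<..<L} \<Longrightarrow> g x = 0"
    "AE x in ivl L. v x = g x"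
    "\<And>\<phi>. continuous_on UNIV \<phi> \<Longrightarrow> (LINT x|ivl L. v x * \<phi> x) = (LINT x|lborel. g x * \<phi> x)"
    using borel_representative[OF vi] by metis
  note [measurable] = borel_measurable_integrable[OF g(1)]
  define W where "W x = (LINT y|lborel. g y * indicator {y..} x)" for x
  have Weq: "integral {0..x} v = W x" if x: "0 < x" "x < L" for x
  proof -
    have ax: "v absolutely_integrable_on {0<..<x}"
      using absolutely_integrable_on_subinterval[OF ai, of 0 x] x
      by (simp add: absolutely_integrable_on_Icc_iff_Ioo)
    have "integral {0..x} v = (LINT y:{0<..<x}|lebesgue. v y)"
      using set_lebesgue_integral_eq_integral(2)[OF ax] by (simp add: integral_open_interval_real)
    also have "\<dots> = (LINT y|lebesgue. indicator {0<..<x} y *\<^sub>R g y)"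
      unfolding set_lebesgue_integral_def
    proof (rule integral_cong_AE)
      show "AE y in lebesgue. indicator {0<..<x} y *\<^sub>R v y = indicator {0<..<x} y *\<^sub>R g y"
        using g(3) x by (auto simp: AE_restrict_space_iff indicator_def elim!: eventually_mono)
      show "(\<lambda>y. indicator {0<..<x} y *\<^sub>R v y) \<in> borel_measurable lebesgue"
        using ax by (simp add: set_integrable_def borel_measurable_integrable)
      show "(\<lambda>y. indicator {0<..<x} y *\<^sub>R g y) \<in> borel_measurable lebesgue"
        by (rule measurable_completion) measurable
    qed
    also have "\<dots> = (LINT y|lborel. indicator {0<..<x} y *\<^sub>R g y)"
      by (rule integral_completion) measurable
    also have "\<dots> = W x"
      unfolding W_def
    proof (rule integral_cong_AE)
      have "(\<lambda>y. g y * indicator {..x} y) \<in> borel_measurable lborel" by measurable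
      then show "(\<lambda>y. g y * indicator {y..} x) \<in> borel_measurable lborel"
        by (simp add: indicator_def)
      \<comment> \<open>The two indicators differ at the endpoint y = x, a null set, and below 0,
        where \<open>g\<close> vanishes.\<close>
      show "AE y in lborel. indicator {0<..<x} y *\<^sub>R g y = g y * indicator {y..} x"
        using AE_lborel_singleton[of x]
      proof eventually_elim
        case (elim y)
        then show ?case using g(2)[of y] x by (cases "0 < y"; cases "y < x") (auto simp: indicator_def)
      qed
    qed measurable
    finally show ?thesis .
  qed
  have [measurable]: "W \<in> borel_measurable borel"
  proof -
    have "(\<lambda>p. g (snd p) * indicator {q. snd q \<le> fst q} p) \<in> borel_measurable (borel \<Otimes>\<^sub>M lborel)"
      by measurable
    then have "(\<lambda>x. LINT y|lborel. g y * indicator {q. snd q \<le> fst q} (x, y)) \<in> borel_measurable borel"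
      by (intro lborel.borel_measurable_lebesgue_integral) (simp add: case_prod_beta)
    then show ?thesis unfolding W_def[abs_def] by (simp add: indicator_def)
  qed
  show "weak_deriv L 1 (\<lambda>x. integral {0..x} v) v"
    unfolding weak_deriv_def
  proof
    fix \<phi> assume \<phi>: "\<phi> \<in> test_fun L"
    have [measurable]: "deriv \<phi> \<in> borel_measurable borel"
      by (rule borel_measurable_continuous_onI[OF test_fun_continuous[OF deriv_test_fun[OF \<phi>]]])
    have "(LINT x|ivl L. integral {0..x} v * deriv \<phi> x) = (LINT x|ivl L. W x * deriv \<phi> x)"
      by (intro Bochner_Integration.integral_cong) (auto simp: Weq)
    also have "\<dots> = (LINT x|lebesgue. W x * deriv \<phi> x)"
    proof -
      have "(\<lambda>x. indicator {0<..<L} x *\<^sub>R (W x * deriv \<phi> x)) = (\<lambda>x. W x * deriv \<phi> x)"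
      proof
        show "indicator {0<..<L} x *\<^sub>R (W x * deriv \<phi> x) = W x * deriv \<phi> x" for x
          using test_fun_outside[OF deriv_test_fun[OF \<phi>], of x] by (cases "x \<in> {0<..<L}") auto
      qed
      then show ?thesis by (simp add: integral_restrict_space del: real_scaleR_def)
    qed
    also have "\<dots> = (LINT x|lborel. W x * deriv \<phi> x)"
      by (rule integral_completion) measurable
    also have "\<dots> = - (LINT x|lborel. g x * \<phi> x)"
      using weak_deriv_indefinite_lborel[OF g(1,2) \<phi>] unfolding W_def by simp
    also have "\<dots> = - (LINT x|ivl L. v x * \<phi> x)"
      using g(4)[OF test_fun_continuous[OF \<phi>]] by simp
    finally show "(LINT x|ivl L. integral {0..x} v * (deriv ^^ 1) \<phi> x) = (- 1) ^ 1 * (LINT x|ivl L. v x * \<phi> x)"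
      by simp
  qed
qed

lemma weak_deriv_C1:
  assumes L: "0 < L" and D: "\<And>x. x \<in> {0..L} \<Longrightarrow> (f has_real_derivative f' x) (at x within {0..L})"
    and c: "continuous_on {0..L} f'"
  shows "weak_deriv L 1 f f'"
proof -
  have i: "integrable (ivl L) f'" using c by (rule continuous_integrable_open)
  have cf: "continuous_on {0..L} f" using D by (rule DERIV_continuous_on)
  note I = indefinite_integral_weak_deriv[OF L i]
  \<comment> \<open>The factors 1 only match the shape of \<open>weak_deriv_lincomb\<close>; the
    function is the primitive of f' plus the constant f 0.\<close>
  have "weak_deriv L 1 (\<lambda>x. 1 * integral {0..x} f' + 1 * f 0) (\<lambda>x. 1 * f' x + 1 * 0)"
    using I i weak_deriv_const[of L "f 0"]
    by (intro weak_deriv_lincomb continuous_integrable_open[OF I(1)]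
        continuous_integrable_open[OF continuous_on_const])
  moreover have "integral {0..x} f' = f x - f 0" if "0 < x" "x < L" for x
    using that D by (intro integral_unique fundamental_theorem_of_calculus)
      (auto simp: has_real_derivative_iff_has_vector_derivative[symmetric] intro: DERIV_subset[of _ _ _ "{0..L}"])
  ultimately show ?thesis
    by (intro weak_deriv_cong[of "\<lambda>x. 1 * integral {0..x} f' + 1 * f 0" L f "\<lambda>x. 1 * f' x + 1 * 0" f' 1])
      (auto intro!: ae_eqI continuous_measurable_ivl continuous_intros I(1) c cf)
qed

lemma weak_deriv_continuous_rep:
  assumes L: "0 < L" and u: "integrable (ivl L) u" and v: "integrable (ivl L) v"
    and "weak_deriv L 1 u v"
  obtains c where "ae_eq L u (\<lambda>x. c + integral {0..x} v)"
proof -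
  note I = indefinite_integral_weak_deriv[OF L v]
  have "weak_deriv L 1 (\<lambda>x. 1 * u x + (-1) * integral {0..x} v) (\<lambda>x. 1 * v x + (-1) * v x)"
    using assms I by (intro weak_deriv_lincomb continuous_integrable_open[OF I(1)])
  then have w: "weak_deriv L 1 (\<lambda>x. u x - integral {0..x} v) (\<lambda>x. 0)" by simp
  obtain c where "ae_eq L (\<lambda>x. u x - integral {0..x} v) (\<lambda>_. c)"
    using weak_deriv_zero_imp_const[OF L _ w] u continuous_integrable_open[OF I(1)] by auto
  then have "ae_eq L u (\<lambda>x. c + integral {0..x} v)"
    unfolding ae_eq_def by eventually_elim simp
  then show thesis by (rule that)
qed

lemma weak_deriv_C1_rep:
  assumes L: "0 < L" and u: "integrable (ivl L) u" and v: "continuous_on {0..L} v"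
    and "weak_deriv L 1 u v"
  obtains g where "ae_eq L u g" "\<And>x. x \<in> {0..L} \<Longrightarrow> (g has_real_derivative v x) (at x within {0..L})"
proof -
  obtain c where c: "ae_eq L u (\<lambda>x. c + integral {0..x} v)"
    using weak_deriv_continuous_rep[OF L u continuous_integrable_open[OF v] assms(4)] .
  have "((\<lambda>x. c + integral {0..x} v) has_real_derivative v x) (at x within {0..L})"
    if "x \<in> {0..L}" for x
    using integral_has_real_derivative[OF v that] by (auto intro!: derivative_eq_intros)
  with c show thesis by (rule that)
qed

text \<open>The difference is continuous with zero integral of its modulus over the closed interval.
  Equality therefore reaches the endpoints, as boundary values require.\<close>

lemma continuous_ae_eq_imp_eq:
  assumes L: "0 < L" and "continuous_on {0..L} v" "continuous_on {0..L} w" "ae_eq L v w" "x \<in> {0..L}"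
  shows "v x = w x"
proof -
  let ?d = "\<lambda>x. \<bar>v x - w x\<bar>"
  have c: "continuous_on {0..L} ?d" using assms by (intro continuous_intros)
  have "(LINT x|ivl L. ?d x) = 0"
    using assms(4) unfolding ae_eq_def by (intro integral_eq_zero_AE) (auto elim: eventually_mono)
  then have "integral {0..L} ?d = 0"
    using continuous_integrable_open[OF c]
    by (simp add: lebesgue_integral_eq_integral integral_open_interval_real)
  then have "\<forall>x\<in>{0..L}. ?d x = 0" using integral_eq_0_iff[OF c] L by auto
  with assms(5) show ?thesis by auto
qed

text \<open>Uniqueness of the continuous representative up to the endpoints makes the definite
  description meaningful, so any representative at hand may be evaluated.\<close>

lemma trace_at_eq:
  assumes "0 < L" "continuous_on {0..L} w" "ae_eq L w u" "a \<in> {0..L}"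
  shows "trace_at L u a = w a"
  unfolding trace_at_def
proof (rule the_equality)
  fix c assume "\<exists>w. continuous_on {0..L} w \<and> ae_eq L w u \<and> w a = c"
  then obtain w' where w': "continuous_on {0..L} w'" "ae_eq L w' u" "w' a = c" by blast
  have "ae_eq L w' w" using w'(2) ae_eq_sym[OF assms(3)] by (rule ae_eq_trans)
  then show "c = w a"
    using continuous_ae_eq_imp_eq[OF assms(1) w'(1) assms(2) _ assms(4)] w'(3) by simp
qed (use assms in auto)

section \<open>Weak derivatives of classically differentiable functions\<close>

lemma wderiv_props:
  assumes "v \<in> L2 L" "weak_deriv L k u v"
  shows "wderiv L k u \<in> L2 L" "weak_deriv L k u (wderiv L k u)" "ae_eq L (wderiv L k u) v"
proof -
  have *: "wderiv L k u \<in> L2 L \<and> weak_deriv L k u (wderiv L k u)"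
    unfolding wderiv_def by (rule someI[of _ v]) (use assms in auto)
  then show "wderiv L k u \<in> L2 L" "weak_deriv L k u (wderiv L k u)" by auto
  show "ae_eq L (wderiv L k u) v"
    using * assms by (intro weak_deriv_unique[of L _ _ k u] L2_integrable) auto
qed

text \<open>Derivatives are carried as a family, not as iterates of \<open>deriv\<close>: at 0 and L
  they are one-sided, and the functions are controlled only on [0,L].\<close>

definition classical_derivs :: "nat \<Rightarrow> real \<Rightarrow> (nat \<Rightarrow> real \<Rightarrow> real) \<Rightarrow> bool" where
  "classical_derivs n L F \<longleftrightarrow>
     (\<forall>j<n. \<forall>x\<in>{0..L}. (F j has_real_derivative F (Suc j) x) (at x within {0..L})) \<and>
     continuous_on {0..L} (F n)"

lemma classical_derivs_continuous:
  assumes "classical_derivs n L F" "j \<le> n"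
  shows "continuous_on {0..L} (F j)"
proof (cases "j = n")
  case False
  with assms have "(F j has_real_derivative F (Suc j) x) (at x within {0..L})" if "x \<in> {0..L}" for x
    using that unfolding classical_derivs_def by auto
  then show ?thesis by (rule DERIV_continuous_on)
qed (use assms in \<open>simp add: classical_derivs_def\<close>)

lemma classical_derivs_weak:
  assumes L: "0 < L" and F: "classical_derivs n L F" and "j \<le> n"
  shows "weak_deriv L j (F 0) (F j)"
  using \<open>j \<le> n\<close>
proof (induction j)
  case (Suc j)
  have "weak_deriv L 1 (F j) (F (Suc j))"
    using F Suc.prems classical_derivs_continuous[OF F Suc.prems]
    by (intro weak_deriv_C1[OF L]) (auto simp: classical_derivs_def)
  with Suc show ?case by (intro weak_deriv_Suc[of L j "F 0" "F j"]) auto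
qed simp

lemma L2_cong_ae:
  assumes "u \<in> L2 L" "v \<in> borel_measurable (ivl L)" "ae_eq L u v"
  shows "v \<in> L2 L"
proof -
  have ae: "AE x in ivl L. (u x)\<^sup>2 = (v x)\<^sup>2"
    using assms(3) unfolding ae_eq_def by eventually_elim simp
  have i: "integrable (ivl L) (\<lambda>x. (u x)\<^sup>2)" using assms(1) by (simp add: L2_def)
  have "integrable (ivl L) (\<lambda>x. (v x)\<^sup>2)"
    by (rule integrable_cong_AE_imp[OF i borel_measurable_power[OF assms(2)] ae])
  then show ?thesis using assms(2) by (simp add: L2_def)
qed

text \<open>The function \<open>u\<close> need only agree almost everywhere with the classical
  \<open>F 0\<close>, because a steady state is given as an arbitrary measurable
  representative.\<close>

lemma classical_derivs_sobolev:
  assumes L: "0 < L" and F: "classical_derivs n L F"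
    and u: "u \<in> borel_measurable (ivl L)" "ae_eq L u (F 0)"
  shows "u \<in> sobolev n L"
    and "\<And>j. j \<le> n \<Longrightarrow> wderiv L j u \<in> L2 L"
    and "\<And>j. j \<le> n \<Longrightarrow> weak_deriv L j u (wderiv L j u)"
    and "\<And>j. j \<le> n \<Longrightarrow> ae_eq L (wderiv L j u) (F j)"
proof -
  have FL: "F j \<in> L2 L" if "j \<le> n" for j
    using classical_derivs_continuous[OF F that] by (rule continuous_L2)
  have w: "weak_deriv L j u (F j)" if "j \<le> n" for j
    using weak_deriv_cong[OF L2_measurable[OF FL] u(1) ae_eq_sym[OF u(2)] L2_measurable[OF FL]
        L2_measurable[OF FL] ae_eq_refl classical_derivs_weak[OF L F that]] that by simp
  have "u \<in> L2 L" using L2_cong_ae[OF FL u(1) ae_eq_sym[OF u(2)]] by simp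
  then show "u \<in> sobolev n L" using FL w unfolding sobolev_def by auto
  show "wderiv L j u \<in> L2 L" "weak_deriv L j u (wderiv L j u)" "ae_eq L (wderiv L j u) (F j)"
    if "j \<le> n" for j
    using wderiv_props[OF FL[OF that] w[OF that]] by auto
qed

text \<open>Embedding of C^n into H^n: an integral of squares over (0,L) costs a factor L, and the
  Euclidean norm of the bounds is at most their sum.\<close>

lemma sobolev_norm_le:
  assumes L: "0 < L" and F: "classical_derivs n L F"
    and N: "\<And>j x. j \<le> n \<Longrightarrow> x \<in> {0..L} \<Longrightarrow> \<bar>F j x\<bar> \<le> N j"
  shows "sobolev_norm n L (F 0) \<le> sqrt L * (\<Sum>j\<le>n. N j)"
proof -
  interpret finite_measure "ivl L" by (rule finite_measure_ivl)
  have N0: "0 \<le> N j" if "j \<le> n" for j using N[OF that, of 0] L by auto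
  note c0 = classical_derivs_continuous[OF F]
  note S = classical_derivs_sobolev[OF L F continuous_measurable_ivl[OF c0[of 0, simplified]] ae_eq_refl]
  have "(LINT x|ivl L. (wderiv L j (F 0) x)\<^sup>2) \<le> L * (N j)\<^sup>2" if j: "j \<le> n" for j
  proof -
    have "AE x in ivl L. (wderiv L j (F 0) x)\<^sup>2 = (F j x)\<^sup>2"
      using S(4)[OF j] unfolding ae_eq_def by eventually_elim simp
    then have "(LINT x|ivl L. (wderiv L j (F 0) x)\<^sup>2) = (LINT x|ivl L. (F j x)\<^sup>2)"
      using L2_measurable[OF S(2)[OF j]] continuous_measurable_ivl[OF c0[OF j]]
      by (intro integral_cong_AE borel_measurable_power)
    also have "\<dots> \<le> (LINT x|ivl L. (N j)\<^sup>2)"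
    proof (rule integral_mono)
      show "integrable (ivl L) (\<lambda>x. (F j x)\<^sup>2)"
        by (intro continuous_integrable_open continuous_intros c0 j)
      show "(F j x)\<^sup>2 \<le> (N j)\<^sup>2" if "x \<in> space (ivl L)" for x
        using N[OF j, of x] that by (intro power2_le_iff_abs_le[THEN iffD2]) (auto intro: N0[OF j])
    qed simp
    also have "\<dots> = L * (N j)\<^sup>2" using L by (simp add: measure_restrict_space)
    finally show ?thesis .
  qed
  then have "(\<Sum>j\<le>n. LINT x|ivl L. (wderiv L j (F 0) x)\<^sup>2) \<le> (\<Sum>j\<le>n. L * (N j)\<^sup>2)"
    by (intro sum_mono) auto
  then have "sobolev_norm n L (F 0) \<le> sqrt (L * (\<Sum>j\<le>n. (N j)\<^sup>2))"
    unfolding sobolev_norm_def by (simp add: sum_distrib_left)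
  also have "\<dots> = sqrt L * L2_set N {..n}" by (simp add: real_sqrt_mult L2_set_def)
  also have "\<dots> \<le> sqrt L * (\<Sum>j\<le>n. N j)"
    using L N0 by (intro mult_left_mono L2_set_le_sum) auto
  finally show ?thesis .
qed

text \<open>Descent from the top: the third weak derivative is a primitive of the fourth, hence
  continuous, and each lower one is then a primitive of a continuous function. Only the last
  relation, from \<open>g3\<close> to \<open>v4\<close>, stays weak.\<close>

lemma sobolev_4_rep:
  assumes L: "0 < L" and u: "u \<in> sobolev 4 L"
  obtains g0 g1 g2 g3 v4 where "ae_eq L u g0"
    "\<And>x. x \<in> {0..L} \<Longrightarrow> (g0 has_real_derivative g1 x) (at x within {0..L})"
    "\<And>x. x \<in> {0..L} \<Longrightarrow> (g1 has_real_derivative g2 x) (at x within {0..L})"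
    "\<And>x. x \<in> {0..L} \<Longrightarrow> (g2 has_real_derivative g3 x) (at x within {0..L})"
    "continuous_on {0..L} g3" "v4 \<in> L2 L" "weak_deriv L 1 g3 v4"
proof -
  from u have u0: "u \<in> L2 L" by (simp add: sobolev_def)
  obtain v where v: "\<And>j. j \<le> 4 \<Longrightarrow> v j \<in> L2 L" "\<And>j. j \<le> 4 \<Longrightarrow> weak_deriv L j u (v j)"
  proof -
    have "\<forall>j. \<exists>v. j \<le> 4 \<longrightarrow> v \<in> L2 L \<and> weak_deriv L j u v"
      using u by (auto simp: sobolev_def)
    from choice[OF this] show thesis using that by blast
  qed
  note i = L2_integrable[OF v(1)] and m = L2_measurable[OF v(1)]
  have s: "weak_deriv L 1 (v j) (v (Suc j))" if "j < 4" for j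
    using weak_deriv_step[OF v(2) v(2)] that by simp
  note Lc = continuous_L2 note Lm = L2_measurable[OF continuous_L2]
  obtain c where c: "ae_eq L (v 3) (\<lambda>x. c + integral {0..x} (v 4))"
    using weak_deriv_continuous_rep[OF L i i s[of 3]] by auto
  define g3 where "g3 = (\<lambda>x. c + integral {0..x} (v 4))"
  have g3: "continuous_on {0..L} g3"
    unfolding g3_def by (intro continuous_intros indefinite_integral_weak_deriv[OF L i]) simp
  have w3: "weak_deriv L 1 g3 (v 4)"
    using weak_deriv_cong[OF m Lm[OF g3] _ m m ae_eq_refl s[of 3]] c by (simp add: g3_def)
  have "weak_deriv L 1 (v 2) g3"
    using weak_deriv_cong[OF m m ae_eq_refl m Lm[OF g3] _ s[of 2]] c by (simp add: g3_def)
  note w2 = this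
  have i2: "integrable (ivl L) (v 2)" by (rule i) simp
  obtain g2 where g2: "ae_eq L (v 2) g2"
    "\<And>x. x \<in> {0..L} \<Longrightarrow> (g2 has_real_derivative g3 x) (at x within {0..L})"
    by (rule weak_deriv_C1_rep[OF L i2 g3 w2]) (rule that)
  have c2: "continuous_on {0..L} g2" using g2(2) by (rule DERIV_continuous_on)
  have "weak_deriv L 1 (v 1) g2"
    using weak_deriv_cong[OF m m ae_eq_refl m Lm[OF c2] _ s[of 1]] g2(1) by (simp add: numeral_2_eq_2)
  note w1 = this
  have i1: "integrable (ivl L) (v 1)" by (rule i) simp
  obtain g1 where g1: "ae_eq L (v 1) g1"
    "\<And>x. x \<in> {0..L} \<Longrightarrow> (g1 has_real_derivative g2 x) (at x within {0..L})"
    by (rule weak_deriv_C1_rep[OF L i1 c2 w1]) (rule that)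
  have c1: "continuous_on {0..L} g1" using g1(2) by (rule DERIV_continuous_on)
  have "weak_deriv L 1 u (v 1)" using v(2)[of 1] by simp
  then have w0: "weak_deriv L 1 u g1"
    by (rule weak_deriv_cong[OF L2_measurable[OF u0] L2_measurable[OF u0] ae_eq_refl m Lm[OF c1] g1(1), rotated]) simp
  obtain g0 where g0: "ae_eq L u g0"
    "\<And>x. x \<in> {0..L} \<Longrightarrow> (g0 has_real_derivative g1 x) (at x within {0..L})"
    by (rule weak_deriv_C1_rep[OF L L2_integrable[OF u0] c1 w0]) (rule that)
  show thesis
    by (rule that[OF g0(1) _ _ _ g3 v(1)[of 4] w3]) (use g0(2) g1(2) g2(2) in auto)
qed

text \<open>Shared by the nonlinear and the linearized equation, with \<open>p\<close> the reaction
  term and \<open>M\<close> the potential. Vanishing M'' makes M' constant; the condition at L makes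
  that constant 0; then M is constant, and the condition at 0 gives M = 0, the second order
  equation.\<close>

lemma weak_second_deriv_zero:
  assumes L: "0 < L" and M: "M \<in> borel_measurable (ivl L)" "ae_eq L M (\<lambda>x. p x - g2 x)"
    and g2: "\<And>x. x \<in> {0..L} \<Longrightarrow> (g2 has_real_derivative g3 x) (at x within {0..L})"
    and g3: "continuous_on {0..L} g3" "v4 \<in> L2 L" "weak_deriv L 1 g3 v4"
    and p: "\<And>x. x \<in> {0..L} \<Longrightarrow> (p has_real_derivative p1 x) (at x within {0..L})"
      "\<And>x. x \<in> {0..L} \<Longrightarrow> (p1 has_real_derivative p2 x) (at x within {0..L})"
      "continuous_on {0..L} p2"
    and bc: "trace_at L M 0 = 0" "trace_at L (wderiv L 1 M) L = 0"
    and eq: "ae_eq L (wderiv L 2 M) (\<lambda>x. 0)"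
  shows "\<And>x. x \<in> {0..L} \<Longrightarrow> g2 x = p x"
proof -
  let ?m = "\<lambda>x. p x - g2 x" and ?m1 = "\<lambda>x. p1 x - g3 x" and ?m2 = "\<lambda>x. 1 * p2 x + (-1) * v4 x"
  have c: "continuous_on {0..L} p1" using p(2) by (rule DERIV_continuous_on)
  have c1: "continuous_on {0..L} ?m1" by (intro continuous_intros c g3)
  have D: "(?m has_real_derivative ?m1 x) (at x within {0..L})" if "x \<in> {0..L}" for x
    using that by (auto intro!: derivative_eq_intros p g2)
  have c0: "continuous_on {0..L} ?m" using D by (rule DERIV_continuous_on)
  have m2: "?m2 \<in> L2 L" by (intro L2_add L2_cmult continuous_L2 p g3)
  have w1: "weak_deriv L 1 ?m ?m1" by (rule weak_deriv_C1[OF L D c1])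
  have "weak_deriv L 1 (\<lambda>x. 1 * p1 x + (-1) * g3 x) ?m2"
    by (rule weak_deriv_lincomb)
      (auto intro: L2_integrable g3 p continuous_integrable_open c simp del: One_nat_def intro!: weak_deriv_C1[OF L p(2) p(3)])
  then have w12: "weak_deriv L 1 ?m1 ?m2" by simp
  have w2: "weak_deriv L 2 ?m ?m2" using weak_deriv_Suc[OF w1 w12] by (simp add: numeral_2_eq_2)
  note cm = continuous_measurable_ivl
  have W1: "weak_deriv L 1 M ?m1"
    by (rule weak_deriv_cong[OF cm[OF c0] M(1) ae_eq_sym[OF M(2)] cm[OF c1] cm[OF c1] ae_eq_refl w1])
  have W2: "weak_deriv L 2 M ?m2"
    by (rule weak_deriv_cong[OF cm[OF c0] M(1) ae_eq_sym[OF M(2)] L2_measurable[OF m2] L2_measurable[OF m2] ae_eq_refl w2])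
  note P1 = wderiv_props[OF continuous_L2[OF c1] W1] and P2 = wderiv_props[OF m2 W2]
  have "weak_deriv L 1 ?m1 (\<lambda>x. 0)"
    using weak_deriv_cong[OF cm[OF c1] cm[OF c1] ae_eq_refl L2_measurable[OF m2] _ _ w12, of "\<lambda>x. 0"]
      ae_eq_trans[OF ae_eq_sym[OF P2(3)] eq] by simp
  then obtain d where d: "ae_eq L ?m1 (\<lambda>_. d)"
    using weak_deriv_zero_imp_const[OF L continuous_integrable_open[OF c1]] by blast
  have d': "?m1 x = d" if "x \<in> {0..L}" for x
    using continuous_ae_eq_imp_eq[OF L c1 continuous_on_const d that] .
  have "trace_at L (wderiv L 1 M) L = ?m1 L"
    using L by (intro trace_at_eq[OF L c1 ae_eq_sym[OF P1(3)]]) auto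
  then have "d = 0" using bc(2) d'[of L] L by simp
  then have D0: "(?m has_real_derivative 0) (at x within {0..L})" if "x \<in> {0..L}" for x
    using D[OF that] d'[OF that] by simp
  have "?m 0 = 0" using trace_at_eq[OF L c0 ae_eq_sym[OF M(2)], of 0] bc(1) L by simp
  moreover have "?m x = ?m 0" if "x \<in> {0..L}" for x
  proof -
    obtain k where "\<forall>x\<in>{0..L}. ?m x = k"
      using has_field_derivative_zero_constant[of "{0..L}" ?m] D0 by auto
    with that L show ?thesis by simp
  qed
  ultimately show "g2 x = p x" if "x \<in> {0..L}" for x using that by force
qed

section \<open>The shooting problem\<close>

text \<open>Gronwall for E = d^2 + e^2, whose derivative is at most (1 + M) E in modulus. The
  forward bound gives uniqueness and dependence on the slope; the backward bound transports
  vanishing data from the right end.\<close>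

lemma energy_estimate:
  fixes d e e' :: "real \<Rightarrow> real"
  assumes ab: "a \<le> b" and M: "0 \<le> M"
    and d: "\<And>x. x \<in> {a..b} \<Longrightarrow> (d has_real_derivative e x) (at x within {a..b})"
    and e: "\<And>x. x \<in> {a..b} \<Longrightarrow> (e has_real_derivative e' x) (at x within {a..b})"
    and bound: "\<And>x. x \<in> {a..b} \<Longrightarrow> \<bar>e' x\<bar> \<le> M * \<bar>d x\<bar>"
  shows "(d b)\<^sup>2 + (e b)\<^sup>2 \<le> ((d a)\<^sup>2 + (e a)\<^sup>2) * exp ((1 + M) * (b - a))"
    and "(d a)\<^sup>2 + (e a)\<^sup>2 \<le> ((d b)\<^sup>2 + (e b)\<^sup>2) * exp ((1 + M) * (b - a))"
proof -
  define E where "E x = (d x)\<^sup>2 + (e x)\<^sup>2" for x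
  define E' where "E' x = 2 * d x * e x + 2 * e x * e' x" for x
  have DE: "(E has_real_derivative E' x) (at x within {a..b})" if "x \<in> {a..b}" for x
    unfolding E_def[abs_def] E'_def by (auto intro!: derivative_eq_intros d e that)
  have E': "\<bar>E' x\<bar> \<le> (1 + M) * E x" if x: "x \<in> {a..b}" for x
  proof -
    have s: "2 * \<bar>d x\<bar> * \<bar>e x\<bar> \<le> E x"
      using sum_squares_bound[of "\<bar>d x\<bar>" "\<bar>e x\<bar>"] by (simp add: E_def)
    have "\<bar>E' x\<bar> \<le> \<bar>2 * d x * e x\<bar> + \<bar>2 * e x * e' x\<bar>" unfolding E'_def by (rule abs_triangle_ineq)
    also have "\<dots> = 2 * \<bar>d x\<bar> * \<bar>e x\<bar> + 2 * \<bar>e x\<bar> * \<bar>e' x\<bar>" by (simp add: abs_mult)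
    also have "\<dots> \<le> 2 * \<bar>d x\<bar> * \<bar>e x\<bar> + 2 * \<bar>e x\<bar> * (M * \<bar>d x\<bar>)"
      using bound[OF x] by (intro add_left_mono mult_left_mono) auto
    also have "\<dots> = (1 + M) * (2 * \<bar>d x\<bar> * \<bar>e x\<bar>)" by (simp add: algebra_simps)
    also have "\<dots> \<le> (1 + M) * E x" using s M by (intro mult_left_mono) auto
    finally show ?thesis .
  qed
  \<comment> \<open>One formula with free exponent \<open>c\<close> serves both signs: for c at
    least 1 + M the weighted energy increases, for c at most -(1 + M) it decreases.\<close>
  have *: "\<exists>y. ((\<lambda>x. E x * exp (c * x)) has_real_derivative y) (at x within {a..b})
      \<and> y = (E' x + c * E x) * exp (c * x)" if "x \<in> {a..b}" for x c
    by (auto intro!: derivative_eq_intros DE that simp: algebra_simps)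
  have mono: "E a * exp (c * a) \<le> E b * exp (c * b)" if c: "1 + M \<le> c" for c
  proof (rule DERIV_nonneg_imp_increasing_open[OF ab])
    show "continuous_on {a..b} (\<lambda>x. E x * exp (c * x))"
      using DERIV_continuous_on[OF DE] by (intro continuous_intros)
    fix x assume x: "a < x" "x < b"
    have "0 \<le> E x" by (simp add: E_def)
    then have "(1 + M) * E x \<le> c * E x" using c by (intro mult_right_mono)
    then have "0 \<le> (E' x + c * E x) * exp (c * x)"
      using E'[of x] x by (intro mult_nonneg_nonneg) auto
    moreover have "((\<lambda>x. E x * exp (c * x)) has_real_derivative (E' x + c * E x) * exp (c * x)) (at x)"
      using *[of x c] x by (auto simp: at_within_Icc_at)
    ultimately show "\<exists>y. ((\<lambda>x. E x * exp (c * x)) has_real_derivative y) (at x) \<and> 0 \<le> y" by blast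
  qed
  have anti: "E b * exp (c * b) \<le> E a * exp (c * a)" if c: "c \<le> - (1 + M)" for c
  proof (rule DERIV_nonpos_imp_decreasing_open[OF ab])
    show "continuous_on {a..b} (\<lambda>x. E x * exp (c * x))"
      using DERIV_continuous_on[OF DE] by (intro continuous_intros)
    fix x assume x: "a < x" "x < b"
    have "0 \<le> E x" by (simp add: E_def)
    then have "c * E x \<le> - ((1 + M) * E x)"
      using mult_right_mono[OF c] by (simp only: mult_minus_left)
    then have "(E' x + c * E x) * exp (c * x) \<le> 0"
      using E'[of x] x by (intro mult_nonpos_nonneg) auto
    moreover have "((\<lambda>x. E x * exp (c * x)) has_real_derivative (E' x + c * E x) * exp (c * x)) (at x)"
      using *[of x c] x by (auto simp: at_within_Icc_at)
    ultimately show "\<exists>y. ((\<lambda>x. E x * exp (c * x)) has_real_derivative y) (at x) \<and> y \<le> 0" by blast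
  qed
  have "E b * exp (- (1 + M) * b) \<le> E a * exp (- (1 + M) * a)" by (rule anti) simp
  then have "E b * exp (- (1 + M) * b) * exp ((1 + M) * b) \<le> E a * exp (- (1 + M) * a) * exp ((1 + M) * b)"
    by (rule mult_right_mono) simp
  then show "(d b)\<^sup>2 + (e b)\<^sup>2 \<le> ((d a)\<^sup>2 + (e a)\<^sup>2) * exp ((1 + M) * (b - a))"
    unfolding E_def mult.assoc exp_add[symmetric] by (simp add: algebra_simps)
  have "E a * exp ((1 + M) * a) \<le> E b * exp ((1 + M) * b)" by (rule mono) simp
  then have "E a * exp ((1 + M) * a) * exp (- (1 + M) * a) \<le> E b * exp ((1 + M) * b) * exp (- (1 + M) * a)"
    by (rule mult_right_mono) simp
  then show "(d a)\<^sup>2 + (e a)\<^sup>2 \<le> ((d b)\<^sup>2 + (e b)\<^sup>2) * exp ((1 + M) * (b - a))"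
    unfolding E_def mult.assoc exp_add[symmetric] by (simp add: algebra_simps)
qed

lemma shoot_solD:
  assumes "shoot_sol c0 \<zeta> L z v w"
  shows "v 0 = c0" "w 0 = z"
    and "\<And>y. y \<in> {0..1} \<Longrightarrow> (v has_real_derivative w y) (at y within {0..1})"
    and "\<And>y. y \<in> {0..1} \<Longrightarrow>
      (w has_real_derivative L\<^sup>2 * (v y ^ 3 - v y + \<zeta> (L * y))) (at y within {0..1})"
proof -
  show "v 0 = c0" "w 0 = z" "\<And>y. y \<in> {0..1} \<Longrightarrow> (v has_real_derivative w y) (at y within {0..1})"
    using assms by (auto simp: shoot_sol_def)
  fix y :: real assume "y \<in> {0..1}"
  then obtain d where "(w has_real_derivative d) (at y within {0..1})"
    "- d + L\<^sup>2 * (v y ^ 3 - v y + \<zeta> (L * y)) = 0"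
    using assms unfolding shoot_sol_def by blast
  then show "(w has_real_derivative L\<^sup>2 * (v y ^ 3 - v y + \<zeta> (L * y))) (at y within {0..1})"
    by simp
qed

lemma continuous_abs_bound:
  fixes f :: "real \<Rightarrow> real"
  assumes "continuous_on {a..b} f"
  obtains B where "0 \<le> B" "\<And>x. x \<in> {a..b} \<Longrightarrow> \<bar>f x\<bar> \<le> B"
proof -
  have "bounded (f ` {a..b})"
    using assms by (intro compact_imp_bounded compact_continuous_image) auto
  then obtain B where "\<forall>x\<in>{a..b}. \<bar>f x\<bar> \<le> B" unfolding bounded_iff by auto
  then show thesis by (intro that[of "\<bar>B\<bar>"]) force+
qed

text \<open>Factoring v1^3 - v^3 makes the difference solve a linear equation with a coefficient
  depending on both solutions, the form needed by \<open>energy_estimate\<close>.\<close>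

lemma shoot_sol_diff:
  assumes s: "shoot_sol c0 \<zeta> L z v w" and s1: "shoot_sol c0 \<zeta> L z1 v1 w1" and y: "y \<in> {0..1}"
  shows "((\<lambda>y. v1 y - v y) has_real_derivative w1 y - w y) (at y within {0..1})"
    and "((\<lambda>y. w1 y - w y) has_real_derivative
      L\<^sup>2 * ((v1 y)\<^sup>2 + v1 y * v y + (v y)\<^sup>2 - 1) * (v1 y - v y)) (at y within {0..1})"
proof -
  show "((\<lambda>y. v1 y - v y) has_real_derivative w1 y - w y) (at y within {0..1})"
    using shoot_solD(3)[OF s y] shoot_solD(3)[OF s1 y] by (auto intro!: derivative_eq_intros)
  show "((\<lambda>y. w1 y - w y) has_real_derivative
      L\<^sup>2 * ((v1 y)\<^sup>2 + v1 y * v y + (v y)\<^sup>2 - 1) * (v1 y - v y)) (at y within {0..1})"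
    by (rule DERIV_cong[OF DERIV_diff[OF shoot_solD(4)[OF s1 y] shoot_solD(4)[OF s y]]])
      (simp add: algebra_simps power2_eq_square power3_eq_cube)
qed

lemma shoot_sol_unique:
  assumes s: "shoot_sol c0 \<zeta> L z v w" and s1: "shoot_sol c0 \<zeta> L z v1 w1"
  shows "w1 1 = w 1"
proof -
  define a where "a y = L\<^sup>2 * ((v1 y)\<^sup>2 + v1 y * v y + (v y)\<^sup>2 - 1)" for y
  have "continuous_on {0..1} v" using shoot_solD(3)[OF s] by (rule DERIV_continuous_on)
  moreover have "continuous_on {0..1} v1" using shoot_solD(3)[OF s1] by (rule DERIV_continuous_on)
  ultimately have "continuous_on {0..1} a" unfolding a_def[abs_def] by (intro continuous_intros)
  then obtain M where M: "0 \<le> M" "\<And>y. y \<in> {0..1} \<Longrightarrow> \<bar>a y\<bar> \<le> M"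
    by (rule continuous_abs_bound) (rule that)
  have "(v1 1 - v 1)\<^sup>2 + (w1 1 - w 1)\<^sup>2
      \<le> ((v1 0 - v 0)\<^sup>2 + (w1 0 - w 0)\<^sup>2) * exp ((1 + M) * (1 - 0))"
  proof (rule energy_estimate(1)[where e'="\<lambda>y. a y * (v1 y - v y)"])
    show "\<bar>a y * (v1 y - v y)\<bar> \<le> M * \<bar>v1 y - v y\<bar>" if "y \<in> {0..1}" for y
      using M(2)[OF that] by (simp add: abs_mult mult_right_mono)
  qed (use M shoot_sol_diff[OF s s1] in \<open>auto simp: a_def\<close>)
  also have "\<dots> = 0" using shoot_solD(1,2)[OF s] shoot_solD(1,2)[OF s1] by simp
  finally show ?thesis using zero_le_power2[of "v1 1 - v 1"] by (smt (verit) zero_less_power2)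
qed

lemma shoot_eq:
  assumes "shoot_sol c0 \<zeta> L z v w"
  shows "shoot c0 \<zeta> L z = w 1"
  unfolding shoot_def using assms shoot_sol_unique by (intro the_equality) blast+

text \<open>The coefficient of the difference equation is bounded only while v1 stays near v. The
  bound is therefore proved under |v1 - v| \<le> 1, and a first-exit argument removes this condition
  for small |z1 - z|.\<close>

lemma shoot_sol_close:
  assumes s: "shoot_sol c0 \<zeta> L z v w"
  obtains K \<delta> where "0 \<le> K" "0 < \<delta>" "\<And>z1 v1 w1 y. shoot_sol c0 \<zeta> L z1 v1 w1 \<Longrightarrow> \<bar>z1 - z\<bar> < \<delta> \<Longrightarrow> y \<in> {0..1}
    \<Longrightarrow> \<bar>v1 y - v y\<bar> \<le> K * \<bar>z1 - z\<bar>"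
proof -
  have cv: "continuous_on {0..1} v" using shoot_solD(3)[OF s] by (rule DERIV_continuous_on)
  obtain B where B: "0 \<le> B" "\<And>y. y \<in> {0..1} \<Longrightarrow> \<bar>v y\<bar> \<le> B" 
    by (rule continuous_abs_bound[OF cv]) (rule that)
  \<comment> \<open>Bounds the coefficient when |v| \<le> B and |v1| \<le> B + 1.\<close>
  define M where "M = L\<^sup>2 * ((B + 1)\<^sup>2 + (B + 1) * B + B\<^sup>2 + 1)"
  have M: "0 \<le> M" using B by (simp add: M_def)
  \<comment> \<open>The square root of the energy growth factor over [0,1], since the energy is
    quadratic in the difference.\<close>
  define K where "K = exp ((1 + M) / 2)"
  have K: "0 < K" "K\<^sup>2 = exp (1 + M)" by (auto simp: K_def power2_eq_square exp_add[symmetric])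
  have est: "\<bar>v1 t - v t\<bar> \<le> K * \<bar>z1 - z\<bar>"
    if s1: "shoot_sol c0 \<zeta> L z1 v1 w1" and t: "t \<in> {0..1}"
      and small: "\<And>y. y \<in> {0..t} \<Longrightarrow> \<bar>v1 y - v y\<bar> \<le> 1" for z1 v1 w1 t
  proof -
    have ab: "\<bar>L\<^sup>2 * ((v1 y)\<^sup>2 + v1 y * v y + (v y)\<^sup>2 - 1)\<bar> \<le> M" if y: "y \<in> {0..t}" for y
    proof -
      have 1: "\<bar>v y\<bar> \<le> B" using B(2)[of y] y t by auto
      then have 2: "\<bar>v1 y\<bar> \<le> B + 1" using small[OF y] by linarith
      have "(v1 y)\<^sup>2 \<le> (B + 1)\<^sup>2" "(v y)\<^sup>2 \<le> B\<^sup>2"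
        using power_mono[OF 1, of 2] power_mono[OF 2, of 2] by auto
      moreover have "\<bar>v1 y * v y\<bar> \<le> (B + 1) * B"
        unfolding abs_mult using 1 2 B by (intro mult_mono) auto
      ultimately have "\<bar>(v1 y)\<^sup>2 + v1 y * v y + (v y)\<^sup>2 - 1\<bar> \<le> (B + 1)\<^sup>2 + (B + 1) * B + B\<^sup>2 + 1"
        using zero_le_power2[of "v1 y"] zero_le_power2[of "v y"] by linarith
      then show ?thesis unfolding M_def abs_mult by (simp add: mult_left_mono)
    qed
    have "(v1 t - v t)\<^sup>2 \<le> (v1 t - v t)\<^sup>2 + (w1 t - w t)\<^sup>2" by simp
    also have "(v1 t - v t)\<^sup>2 + (w1 t - w t)\<^sup>2
      \<le> ((v1 0 - v 0)\<^sup>2 + (w1 0 - w 0)\<^sup>2) * exp ((1 + M) * (t - 0))"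
    proof (rule energy_estimate(1)[where e'="\<lambda>y. L\<^sup>2 * ((v1 y)\<^sup>2 + v1 y * v y + (v y)\<^sup>2 - 1) * (v1 y - v y)"])
      show "\<bar>L\<^sup>2 * ((v1 y)\<^sup>2 + v1 y * v y + (v y)\<^sup>2 - 1) * (v1 y - v y)\<bar> \<le> M * \<bar>v1 y - v y\<bar>" if "y \<in> {0..t}" for y
        using ab[OF that] by (subst abs_mult) (intro mult_right_mono abs_ge_zero)
      show "((\<lambda>y. v1 y - v y) has_real_derivative w1 y - w y) (at y within {0..t})" 
        "((\<lambda>y. w1 y - w y) has_real_derivative
         L\<^sup>2 * ((v1 y)\<^sup>2 + v1 y * v y + (v y)\<^sup>2 - 1) * (v1 y - v y)) (at y within {0..t})"
        if "y \<in> {0..t}" for y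
        using that t by (auto intro!: DERIV_subset[OF shoot_sol_diff(1)[OF s s1]] DERIV_subset[OF shoot_sol_diff(2)[OF s s1]])
    qed (use M t in auto)
    also have "\<dots> = (z1 - z)\<^sup>2 * exp ((1 + M) * t)"
      using shoot_solD(1,2)[OF s] shoot_solD(1,2)[OF s1] by simp
    also have "\<dots> \<le> (z1 - z)\<^sup>2 * K\<^sup>2"
      unfolding K(2) using M t mult_left_mono[of t 1 "1 + M"] by (intro mult_left_mono) auto
    finally have "(v1 t - v t)\<^sup>2 \<le> (K * \<bar>z1 - z\<bar>)\<^sup>2"
      by (simp add: power_mult_distrib mult.commute)
    then show ?thesis using K by (metis abs_ge_zero abs_le_square_iff abs_of_nonneg less_imp_le mult_nonneg_nonneg)
  qed
  show thesis
  \<comment> \<open>With this radius K |z1 - z| < 1, strictly below the exit threshold.\<close>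
  proof (rule that[of K "1 / K"])
    fix z1 v1 w1 y assume s1: "shoot_sol c0 \<zeta> L z1 v1 w1" and dz: "\<bar>z1 - z\<bar> < 1 / K" and y: "y \<in> {0..(1::real)}"
    have K1: "K * \<bar>z1 - z\<bar> < 1" using dz K by (simp add: field_simps)
    have cd: "continuous_on {0..1} (\<lambda>y. \<bar>v1 y - v y\<bar>)"
      using DERIV_continuous_on[OF shoot_sol_diff(1)[OF s s1]] by (intro continuous_on_rabs) auto
    have lt: "\<bar>v1 x - v x\<bar> < 1" if "x \<in> {0..1}" for x
    proof (rule ccontr)
      assume "\<not> \<bar>v1 x - v x\<bar> < 1"
      define S where "S = {0..1} \<inter> (\<lambda>y. \<bar>v1 y - v y\<bar>) -` {1..}"
      have "closed S"
        unfolding S_def by (rule continuous_closed_preimage[OF cd]) auto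
      moreover have "S \<noteq> {}" "bdd_below S"
        using \<open>x \<in> {0..1}\<close> \<open>\<not> \<bar>v1 x - v x\<bar> < 1\<close> by (auto simp: S_def intro: bdd_belowI[of _ 0])
      ultimately have S: "closed S" "S \<noteq> {}" "bdd_below S" by auto
      \<comment> \<open>First time at which the gap reaches 1. Up to \<open>t\<close> the gap is at
        most 1 by continuity, so \<open>est\<close> applies at \<open>t\<close> and makes the gap
        less than 1 there: a contradiction.\<close>
      define t where "t = Inf S"
      have t: "t \<in> S" unfolding t_def using S by (intro closed_contains_Inf)
      have before: "\<bar>v1 y - v y\<bar> < 1" if "y \<in> {0..<t}" for y
        using that cInf_lower[of y S] S t by (force simp: t_def S_def not_less)
      have "\<bar>v1 t - v t\<bar> \<le> 1"
      proof -
        have "t \<noteq> 0" using t shoot_solD(1)[OF s] shoot_solD(1)[OF s1] by (auto simp: S_def)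
        then have t0: "0 < t" using t by (auto simp: S_def)
        have "continuous_on {0..t} (\<lambda>y. \<bar>v1 y - v y\<bar>)"
          using t by (intro continuous_on_subset[OF cd]) (auto simp: S_def)
        moreover have "closure {0..<t} = {0..t}" using t0 by (simp add: closure_atLeastLessThan)
        ultimately show ?thesis
          using before t0 continuous_le_on_closure[of "{0..<t}" "\<lambda>y. \<bar>v1 y - v y\<bar>" t 1] by force
      qed
      then have "\<bar>v1 y - v y\<bar> \<le> 1" if "y \<in> {0..t}" for y
        using before[of y] that by (cases "y = t") auto
      then have "\<bar>v1 t - v t\<bar> \<le> K * \<bar>z1 - z\<bar>"
        using t by (intro est[OF s1]) (auto simp: S_def)
      with K1 t show False by (auto simp: S_def)
    qed
    show "\<bar>v1 y - v y\<bar> \<le> K * \<bar>z1 - z\<bar>"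
      using y lt by (intro est[OF s1 y]) (auto intro: less_imp_le)
  qed (use K in auto)
qed


text \<open>After rescaling, a nonzero \<open>h\<close> becomes \<phi> with \<phi>(0) = \<psi>(1) =
  0 and \<phi>(1) \<noteq> 0. For a nearby slope z1 the Wronskian-type pairing starts at 0 and ends
  at \<open>shoot\<close> of z1 times \<phi>(1), while its variation is of order |z1 - z|^2. So the
  shooting function and its derivative vanish at z, which puts L in E.\<close>

lemma trivial_kernel_if_notin_E:
  fixes c0 L :: real and \<zeta> u u' h h' :: "real \<Rightarrow> real"
  assumes L: "0 < L" and LE: "L \<notin> E_set c0 \<zeta>"
    and u: "\<And>x. x \<in> {0..L} \<Longrightarrow> (u has_real_derivative u' x) (at x within {0..L})"
      "\<And>x. x \<in> {0..L} \<Longrightarrow>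
        (u' has_real_derivative (u x + c0) ^ 3 - (u x + c0) + \<zeta> x) (at x within {0..L})"
      "u 0 = 0" "u' L = 0"
    and h: "\<And>x. x \<in> {0..L} \<Longrightarrow> (h has_real_derivative h' x) (at x within {0..L})"
      "\<And>x. x \<in> {0..L} \<Longrightarrow>
        (h' has_real_derivative (3 * (u x + c0)\<^sup>2 - 1) * h x) (at x within {0..L})"
      "h 0 = 0" "h' L = 0"
    and x: "x \<in> {0..L}"
  shows "h x = 0"
proof (rule ccontr)
  assume "h x \<noteq> 0"
  have scale: "((\<lambda>y. f (L * y)) has_real_derivative L * D) (at y within {0..1})"
    if "y \<in> {0..1}" "(f has_real_derivative D) (at (L * y) within {0..L})" for f D y
  proof -
    have im: "(*) L ` {0..1} \<subseteq> {0..L}" using L by (auto simp: mult_le_cancel_left1)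
    have "(f \<circ> (\<lambda>y. L * y) has_real_derivative D * L) (at y within {0..1})"
      by (rule DERIV_image_chain[OF DERIV_subset[OF that(2) im]]) (auto intro!: derivative_eq_intros)
    then show ?thesis by (simp add: o_def mult.commute)
  qed
  have mem: "L * y \<in> {0..L}" if "y \<in> {0..1}" for y
    using that L by (auto simp: mult_le_cancel_left1)
  \<comment> \<open>The chain rule puts a factor L on each first derivative, hence L^2 in both
    second order equations.\<close>
  define v w \<phi> \<psi> where "v y = u (L * y) + c0" and "w y = L * u' (L * y)"
    and "\<phi> y = h (L * y)" and "\<psi> y = L * h' (L * y)" for y
  have Dv: "(v has_real_derivative w y) (at y within {0..1})" if "y \<in> {0..1}" for y
    unfolding v_def[abs_def] w_def using scale[OF that u(1)[OF mem[OF that]]]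
    by (auto intro!: derivative_eq_intros)
  have Dw: "(w has_real_derivative L\<^sup>2 * (v y ^ 3 - v y + \<zeta> (L * y))) (at y within {0..1})"
    if "y \<in> {0..1}" for y
    unfolding v_def w_def[abs_def]
    by (rule DERIV_cong[OF DERIV_cmult[OF scale[OF that u(2)[OF mem[OF that]]]]])
      (simp add: power2_eq_square mult.assoc)
  have D\<phi>: "(\<phi> has_real_derivative \<psi> y) (at y within {0..1})" if "y \<in> {0..1}" for y
    unfolding \<phi>_def[abs_def] \<psi>_def by (rule scale[OF that h(1)[OF mem[OF that]]])
  have D\<psi>: "(\<psi> has_real_derivative L\<^sup>2 * (3 * (v y)\<^sup>2 - 1) * \<phi> y) (at y within {0..1})"
    if "y \<in> {0..1}" for y
    unfolding \<phi>_def \<psi>_def[abs_def] v_def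
    by (rule DERIV_cong[OF DERIV_cmult[OF scale[OF that h(2)[OF mem[OF that]]]]])
      (simp add: power2_eq_square mult.assoc)
  define z where "z = w 0"
  have s: "shoot_sol c0 \<zeta> L z v w"
    unfolding shoot_sol_def using Dv Dw u(3) by (force simp: z_def v_def)
  have cv: "continuous_on {0..1} v" using Dv by (rule DERIV_continuous_on)
  have c\<phi>: "continuous_on {0..1} \<phi>" using D\<phi> by (rule DERIV_continuous_on)
  obtain B where B: "0 \<le> B" "\<And>y. y \<in> {0..1} \<Longrightarrow> \<bar>v y\<bar> \<le> B"
    by (rule continuous_abs_bound[OF cv]) (rule that)
  obtain P where P: "0 \<le> P" "\<And>y. y \<in> {0..1} \<Longrightarrow> \<bar>\<phi> y\<bar> \<le> P"
    by (rule continuous_abs_bound[OF c\<phi>]) (rule that)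
  have \<psi>1: "\<psi> 1 = 0" and \<phi>0: "\<phi> 0 = 0" using h by (auto simp: \<psi>_def \<phi>_def)
  \<comment> \<open>Otherwise \<phi> and \<psi> both vanish at 1, and the backward energy estimate
    forces \<phi> to vanish at x / L, where it equals h x.\<close>
  have \<phi>1: "\<phi> 1 \<noteq> 0"
  proof
    assume "\<phi> 1 = 0"
    have "continuous_on {0..1} (\<lambda>y. L\<^sup>2 * (3 * (v y)\<^sup>2 - 1))" using cv by (intro continuous_intros)
    then obtain M where M: "0 \<le> M" "\<And>y. y \<in> {0..1} \<Longrightarrow> \<bar>L\<^sup>2 * (3 * (v y)\<^sup>2 - 1)\<bar> \<le> M"
      by (rule continuous_abs_bound) (rule that)
    define t where "t = x / L"
    have t: "t \<in> {0..1}" "L * t = x" using x L by (auto simp: t_def)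
    have "(\<phi> t)\<^sup>2 + (\<psi> t)\<^sup>2 \<le> ((\<phi> 1)\<^sup>2 + (\<psi> 1)\<^sup>2) * exp ((1 + M) * (1 - t))"
    proof (rule energy_estimate(2)[where e'="\<lambda>y. L\<^sup>2 * (3 * (v y)\<^sup>2 - 1) * \<phi> y"])
      show "\<bar>L\<^sup>2 * (3 * (v y)\<^sup>2 - 1) * \<phi> y\<bar> \<le> M * \<bar>\<phi> y\<bar>" if "y \<in> {t..1}" for y
        using M(2)[of y] that t by (subst abs_mult) (intro mult_right_mono, auto)
      show "(\<phi> has_real_derivative \<psi> y) (at y within {t..1})"
        "(\<psi> has_real_derivative L\<^sup>2 * (3 * (v y)\<^sup>2 - 1) * \<phi> y) (at y within {t..1})" if "y \<in> {t..1}" for y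
        using that t by (auto intro!: DERIV_subset[OF D\<phi>] DERIV_subset[OF D\<psi>])
    qed (use t M in auto)
    then have "(\<phi> t)\<^sup>2 + (\<psi> t)\<^sup>2 \<le> 0" using \<open>\<phi> 1 = 0\<close> \<psi>1 by simp
    then have "\<phi> t = 0" by (simp add: sum_power2_le_zero_iff)
    with t \<open>h x \<noteq> 0\<close> show False by (simp add: \<phi>_def)
  qed
  obtain K \<delta> where K: "0 \<le> K" "0 < \<delta>"
    "\<And>z1 v1 w1 y. shoot_sol c0 \<zeta> L z1 v1 w1 \<Longrightarrow> \<bar>z1 - z\<bar> < \<delta> \<Longrightarrow> y \<in> {0..1} \<Longrightarrow> \<bar>v1 y - v y\<bar> \<le> K * \<bar>z1 - z\<bar>"
    by (rule shoot_sol_close[OF s]) (rule that)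
  have w1: "w 1 = 0" using u by (simp add: w_def)
  have sz: "shoot c0 \<zeta> L z = 0" using shoot_eq[OF s] w1 by simp
  \<comment> \<open>Bounds \<open>Q'\<close> below factor by factor: K^2 from the squared difference
    (with |z1 - z|^2 split off), P from \<phi>, and 3 B + K \<delta> from the last factor.\<close>
  define C where "C = L\<^sup>2 * K\<^sup>2 * P * (3 * B + K * \<delta>)"
  \<comment> \<open>The Wronskian of the difference of two shooting solutions with \<open>\<phi>\<close> has a derivative
    quadratic in that difference, so \<open>\<psi> 1 = 0\<close> makes the shooting function stationary.\<close>
  have est: "\<bar>shoot c0 \<zeta> L z1\<bar> * \<bar>\<phi> 1\<bar> \<le> C * \<bar>z1 - z\<bar>\<^sup>2"
    if z1: "z1 \<in> shoot_dom c0 \<zeta> L" and near: "\<bar>z1 - z\<bar> < \<delta>" for z1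
  proof -
    obtain v1 w1 where s1: "shoot_sol c0 \<zeta> L z1 v1 w1" using z1 by (auto simp: shoot_dom_def)
    define Q where "Q y = (w1 y - w y) * \<phi> y - (v1 y - v y) * \<psi> y" for y
    \<comment> \<open>With d = v1 - v this rests on (v + d)^3 - v^3 - 3 v^2 d = d^2 (3 v + d); all
      terms linear in d cancel.\<close>
    define Q' where "Q' y = L\<^sup>2 * ((v1 y - v y) * (v1 y - v y)) * \<phi> y * (3 * v y + (v1 y - v y))" for y
    have "norm (Q 1 - Q 0) \<le> (C * \<bar>z1 - z\<bar>\<^sup>2) * norm (1 - 0 :: real)"
    proof (rule field_differentiable_bound[where S="{0..1}" and f'=Q'])
      fix y :: real assume y: "y \<in> {0..1}"
      show "(Q has_field_derivative Q' y) (at y within {0..1})"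
        unfolding Q_def[abs_def]
        by (rule DERIV_cong[OF DERIV_diff[OF DERIV_mult[OF shoot_sol_diff(2)[OF s s1 y] D\<phi>[OF y]]
                DERIV_mult[OF shoot_sol_diff(1)[OF s s1 y] D\<psi>[OF y]]]])
          (simp add: Q'_def algebra_simps power2_eq_square)
      have d: "\<bar>v1 y - v y\<bar> \<le> K * \<bar>z1 - z\<bar>" by (rule K(3)[OF s1 near y])
      have "K * \<bar>z1 - z\<bar> \<le> K * \<delta>" using near K by (intro mult_left_mono) auto
      then have b: "\<bar>3 * v y + (v1 y - v y)\<bar> \<le> 3 * B + K * \<delta>"
        using d B(2)[OF y] by linarith
      have "norm (Q' y) = L\<^sup>2 * (\<bar>v1 y - v y\<bar> * \<bar>v1 y - v y\<bar>) * \<bar>\<phi> y\<bar> * \<bar>3 * v y + (v1 y - v y)\<bar>"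
        by (simp add: Q'_def abs_mult)
      also have "\<dots> \<le> L\<^sup>2 * ((K * \<bar>z1 - z\<bar>) * (K * \<bar>z1 - z\<bar>)) * P * (3 * B + K * \<delta>)"
        using d b P(2)[OF y] K P(1) B(1) by (intro mult_mono mult_nonneg_nonneg) auto
      also have "\<dots> = C * \<bar>z1 - z\<bar>\<^sup>2" by (simp add: C_def power2_eq_square)
      finally show "norm (Q' y) \<le> C * \<bar>z1 - z\<bar>\<^sup>2" .
    qed auto
    moreover have "Q 0 = 0" using \<phi>0 shoot_solD(1)[OF s] shoot_solD(1)[OF s1] by (simp add: Q_def)
    moreover have "Q 1 = shoot c0 \<zeta> L z1 * \<phi> 1"
      using w1 \<psi>1 shoot_eq[OF s1] by (simp add: Q_def)
    ultimately show ?thesis by (simp add: abs_mult)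
  qed
  have "(shoot c0 \<zeta> L has_real_derivative 0) (at z within shoot_dom c0 \<zeta> L)"
    unfolding has_field_derivative_iff
  proof (rule Lim_null_comparison)
    show "\<forall>\<^sub>F z1 in at z within shoot_dom c0 \<zeta> L.
        norm ((shoot c0 \<zeta> L z1 - shoot c0 \<zeta> L z) / (z1 - z)) \<le> C / \<bar>\<phi> 1\<bar> * \<bar>z1 - z\<bar>"
      unfolding eventually_at
    proof (intro exI[of _ \<delta>] conjI ballI impI K)
      fix z1 assume "z1 \<in> shoot_dom c0 \<zeta> L" "z1 \<noteq> z \<and> dist z1 z < \<delta>"
      then show "norm ((shoot c0 \<zeta> L z1 - shoot c0 \<zeta> L z) / (z1 - z)) \<le> C / \<bar>\<phi> 1\<bar> * \<bar>z1 - z\<bar>"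
        using est[of z1] \<phi>1 sz by (simp add: dist_norm field_simps power2_eq_square)
    qed
    have "((\<lambda>z1. C / \<bar>\<phi> 1\<bar> * \<bar>z1 - z\<bar>) \<longlongrightarrow> C / \<bar>\<phi> 1\<bar> * \<bar>z - z\<bar>) (at z within shoot_dom c0 \<zeta> L)"
      by (intro tendsto_intros)
    then show "((\<lambda>z1. C / \<bar>\<phi> 1\<bar> * \<bar>z1 - z\<bar>) \<longlongrightarrow> 0) (at z within shoot_dom c0 \<zeta> L)" by simp
  qed
  with LE L sz s show False unfolding E_set_def shoot_dom_def by blast
qed

section \<open>Bounded continuous functions and \<open>C\<^sup>1\<close> branches of fixed points\<close>

lemma mult_bcontfun:
  fixes f g :: "'a::topological_space \<Rightarrow>\<^sub>C 'b::real_normed_algebra"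
  shows "(\<lambda>x. f x * g x) \<in> bcontfun"
proof (rule bcontfun_normI)
  show "continuous_on UNIV (\<lambda>x. f x * g x)" by (intro continuous_intros) auto
  show "norm (f x * g x) \<le> norm f * norm g" for x
    by (rule norm_mult_ineq[THEN order_trans]) (intro mult_mono norm_bounded norm_ge_zero)
qed

text \<open>The pointwise product turns the function space into a normed algebra, so the cubic
  nonlinearity is differentiated and estimated by the generic product rules.\<close>

instantiation bcontfun :: (topological_space, real_normed_algebra) real_normed_algebra
begin

definition times_bcontfun :: "('a, 'b) bcontfun \<Rightarrow> ('a, 'b) bcontfun \<Rightarrow> ('a, 'b) bcontfun"
  where "times_bcontfun f g = Bcontfun (\<lambda>x. f x * g x)"

lemma apply_bcontfun_times [simp]: "apply_bcontfun (f * g) x = f x * g x"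
  for f g :: "('a, 'b) bcontfun"
  unfolding times_bcontfun_def by (simp add: Bcontfun_inverse mult_bcontfun)

instance
proof
  fix f g h :: "('a, 'b) bcontfun" and a :: real
  show "norm (f * g) \<le> norm f * norm g"
  proof (rule norm_bound)
    show "norm (apply_bcontfun (f * g) x) \<le> norm f * norm g" for x
      unfolding apply_bcontfun_times
      by (rule norm_mult_ineq[THEN order_trans]) (intro mult_mono norm_bounded norm_ge_zero)
  qed
qed (auto intro!: bcontfun_eqI simp: algebra_simps)

end

instance bcontfun :: (metric_space, banach) banach ..

section \<open>Bounded operators on C[0,L]\<close>

lemma bounded_linear_apply_bcontfun: "bounded_linear (\<lambda>f. apply_bcontfun f x)"
  by (rule bounded_linear_intro[where K=1]) (auto simp: norm_bounded)

text \<open>\<open>C[0,L]\<close> sits in the bounded continuous functions on the line by constant extension;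
  only the values on \<open>[0,L]\<close> are ever used.\<close>

definition ext_bcontfun :: "real \<Rightarrow> (real \<Rightarrow> real) \<Rightarrow> (real \<Rightarrow>\<^sub>C real)" where
  "ext_bcontfun L f = Bcontfun (\<lambda>x. f (clamp 0 L x))"

lemma clamp_real_mem: "0 \<le> L \<Longrightarrow> clamp 0 L x \<in> {0..L::real}"
  using clamp_in_interval[of 0 L x] by (simp add: cbox_interval)

lemma apply_ext_bcontfun:
  assumes "continuous_on {0..L} f"
  shows "apply_bcontfun (ext_bcontfun L f) x = f (clamp 0 L x)"
proof -
  obtain g :: "real \<Rightarrow>\<^sub>C real" where "\<And>x. g x = f (clamp 0 L x)"
    using continuous_on_cbox_bcontfunE[of 0 L f] assms by (metis box_real(2))
  then have "(\<lambda>x. f (clamp 0 L x)) = apply_bcontfun g" by auto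
  then show ?thesis unfolding ext_bcontfun_def by (metis apply_bcontfun_inverse)
qed

lemma apply_ext_bcontfun_mem [simp]:
  assumes "continuous_on {0..L} f" "x \<in> {0..L}"
  shows "apply_bcontfun (ext_bcontfun L f) x = f x"
  using assms clamp_cancel_cbox[of x 0 L] by (simp add: apply_ext_bcontfun)

lemma norm_ext_bcontfun_le:
  assumes "0 \<le> L" "continuous_on {0..L} f" "\<And>x. x \<in> {0..L} \<Longrightarrow> \<bar>f x\<bar> \<le> B"
  shows "norm (ext_bcontfun L f) \<le> B"
  using assms clamp_real_mem[OF assms(1)] by (intro norm_bound) (simp add: apply_ext_bcontfun)

lemma bounded_linear_ext_bcontfun:
  assumes L: "0 \<le> L" and c: "\<And>f. continuous_on {0..L} (P f)"
    and add: "\<And>f g x. x \<in> {0..L} \<Longrightarrow> P (f + g) x = P f x + P g x"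
    and scale: "\<And>r f x. x \<in> {0..L} \<Longrightarrow> P (r *\<^sub>R f) x = r * P f x"
    and bound: "\<And>f x. x \<in> {0..L} \<Longrightarrow> \<bar>P f x\<bar> \<le> K * norm f"
  shows "bounded_linear (\<lambda>f. ext_bcontfun L (P f))"
proof (rule bounded_linear_intro[where K=K])
  show "norm (ext_bcontfun L (P f)) \<le> norm f * K" for f
    by (subst mult.commute) (rule norm_ext_bcontfun_le[OF L c bound])
qed (auto intro!: bcontfun_eqI simp: apply_ext_bcontfun[OF c] add scale clamp_real_mem[OF L, simplified])

text \<open>The Volterra operator as a bounded operator; outside [0,L] the primitive is frozen at
  its endpoint values.\<close>

definition prim_bcontfun :: "real \<Rightarrow> (real \<Rightarrow>\<^sub>C real) \<Rightarrow> (real \<Rightarrow>\<^sub>C real)" where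
  "prim_bcontfun L f = ext_bcontfun L (\<lambda>x. integral {0..x} f)"

lemma integrable_on_bcontfun [simp]: "apply_bcontfun f integrable_on {a..b}"
  for f :: "real \<Rightarrow>\<^sub>C real"
  by (intro integrable_continuous_real) auto

lemma continuous_integral_bcontfun: "continuous_on {a..b} (\<lambda>x. integral {a..x} f)"
  for f :: "real \<Rightarrow>\<^sub>C real"
  by (rule indefinite_integral_continuous_1) simp

lemma apply_prim_bcontfun:
  "x \<in> {0..L} \<Longrightarrow> apply_bcontfun (prim_bcontfun L f) x = integral {0..x} f"
  unfolding prim_bcontfun_def by (simp add: continuous_integral_bcontfun)

lemma abs_integral_bcontfun_le:
  fixes f :: "real \<Rightarrow>\<^sub>C real"
  assumes "x \<in> {0..L}"
  shows "\<bar>integral {0..x} f\<bar> \<le> L * norm f"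
proof -
  have "norm (integral {0..x} f) \<le> norm f * (x - 0)"
    using assms norm_bounded[of f] by (intro integral_bound) auto
  also have "\<dots> \<le> L * norm f" using assms by (auto simp: mult.commute[of "norm f"] intro!: mult_right_mono)
  finally show ?thesis by simp
qed

lemma bounded_linear_prim_bcontfun: "0 \<le> L \<Longrightarrow> bounded_linear (prim_bcontfun L)"
  unfolding prim_bcontfun_def[abs_def]
  by (rule bounded_linear_ext_bcontfun[where K=L])
    (auto simp: continuous_integral_bcontfun integral_add abs_integral_bcontfun_le)

section \<open>Differentiable curves and the uniform contraction principle\<close>

lemma C1_differentiable_on_bounded_linear:
  assumes "bounded_linear T" "g C1_differentiable_on S"
  shows "(\<lambda>\<beta>. T (g \<beta>)) C1_differentiable_on S"
proof -
  obtain D where "\<And>x. x \<in> S \<Longrightarrow> (g has_vector_derivative D x) (at x)" "continuous_on S D"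
    using assms(2) unfolding C1_differentiable_on_def by blast
  then show ?thesis unfolding C1_differentiable_on_def
    using bounded_linear.has_vector_derivative[OF assms(1)] bounded_linear.continuous_on[OF assms(1)]
    by (intro exI[of _ "\<lambda>x. T (D x)"]) auto
qed

text \<open>\<open>q\<close> and \<open>A\<close> are the partial derivatives in \<beta> and h.
  Since \<open>A\<close> has norm at most 1/2, H is a contraction on a ball and the linearized fixed
  point equation k = A k + q is solvable; its solution is the derivative of the branch. Continuity
  of \<open>A\<close> is asked only for each fixed argument k, which suffices because the derivative
  is compared at a fixed vector.\<close>

theorem fixed_point_branch:
  fixes H :: "real \<Rightarrow> 'a::banach \<Rightarrow> 'a"
  assumes H0: "H 0 0 = 0"
    and D: "\<And>\<beta> h. ((\<lambda>(\<beta>, h). H \<beta> h) has_derivative (\<lambda>(s, k). s *\<^sub>R q \<beta> h + A \<beta> h k)) (at (\<beta>, h))"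
    and cq: "continuous_on UNIV (\<lambda>(\<beta>, h). q \<beta> h)"
    and cA: "\<And>k. continuous_on UNIV (\<lambda>(\<beta>, h). A \<beta> h k)"
    and b0: "0 < b0" and r: "0 < r"
    and contr: "\<And>\<beta> h k. \<bar>\<beta>\<bar> \<le> b0 \<Longrightarrow> norm h \<le> r \<Longrightarrow> norm (A \<beta> h k) \<le> norm k / 2"
  obtains b g where "0 < b" "b \<le> b0" "g 0 = 0" "g C1_differentiable_on {-b<..<b}"
    "\<And>\<beta>. \<bar>\<beta>\<bar> < b \<Longrightarrow> H \<beta> (g \<beta>) = g \<beta>"
proof -
  have blA: "bounded_linear (A \<beta> h)" for \<beta> h
  proof -
    have "bounded_linear (\<lambda>k. (\<lambda>(s, k). s *\<^sub>R q \<beta> h + A \<beta> h k) (0, k))"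
      using has_derivative_bounded_linear[OF D]
      by (rule bounded_linear_compose) (intro bounded_linear_Pair bounded_linear_zero bounded_linear_ident)
    then show ?thesis by simp
  qed
  note linA = bounded_linear.linear[OF blA]
  have fix_h: "((\<lambda>s. H s h) has_derivative (\<lambda>s. s *\<^sub>R q \<beta> h)) (at \<beta>)" for \<beta> h
  proof -
    have "((\<lambda>s. (s, h)) has_derivative (\<lambda>s. (s, 0))) (at \<beta>)"
      by (auto intro!: derivative_eq_intros)
    from has_derivative_compose[of "\<lambda>s. (s, h)" "\<lambda>s. (s, 0)" \<beta> UNIV "\<lambda>(\<beta>, h). H \<beta> h", OF this D]
    show ?thesis by (simp add: linear_0[OF linA])
  qed
  have fix_\<beta>: "(H \<beta> has_derivative A \<beta> h) (at h)" for \<beta> h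
  proof -
    have "((\<lambda>h. (\<beta>, h)) has_derivative (\<lambda>k. (0, k))) (at h)"
      by (auto intro!: derivative_eq_intros)
    from has_derivative_compose[of "\<lambda>h. (\<beta>, h)" "\<lambda>k. (0, k)" h UNIV "\<lambda>(\<beta>, h). H \<beta> h", OF this D]
    show ?thesis by simp
  qed
  have lip: "norm (H \<beta> h - H \<beta> k) \<le> norm (h - k) / 2"
    if \<beta>: "\<bar>\<beta>\<bar> \<le> b0" and hk: "norm h \<le> r" "norm k \<le> r" for \<beta> h k
  proof -
    have "norm (H \<beta> h - H \<beta> k) \<le> (1/2) * norm (h - k)"
    proof (rule differentiable_bound[where S="cball 0 r" and f'="A \<beta>"])
      fix x :: 'a assume "x \<in> cball 0 r"
      show "(H \<beta> has_derivative A \<beta> x) (at x within cball 0 r)"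
        by (rule has_derivative_at_withinI[OF fix_\<beta>])
      show "onorm (A \<beta> x) \<le> 1/2"
        using contr[OF \<beta>, of x] \<open>x \<in> cball 0 r\<close> by (intro onorm_bound) auto
    qed (use hk in auto)
    then show ?thesis by simp
  qed
  have "isCont (\<lambda>\<beta>. H \<beta> 0) 0" by (rule has_derivative_continuous[OF fix_h])
  then have "((\<lambda>\<beta>. H \<beta> 0) \<longlongrightarrow> 0) (at 0)" using H0 by (simp add: isCont_def)
  then have "\<forall>\<^sub>F \<beta> in at 0. norm (H \<beta> 0) < r / 2"
    using r by (auto dest!: tendstoD[where e="r/2"] simp: dist_norm)
  then obtain b1 where b1: "0 < b1" "\<And>\<beta>. \<beta> \<noteq> 0 \<Longrightarrow> \<bar>\<beta>\<bar> < b1 \<Longrightarrow> norm (H \<beta> 0) < r / 2"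
    unfolding eventually_at by (auto simp: dist_norm)
  \<comment> \<open>\<open>b1\<close> keeps H \<beta> 0 within half the radius; together with the
    contraction factor 1/2 the ball is mapped into itself.\<close>
  define b where "b = min b0 b1"
  have b: "0 < b" "b \<le> b0" using b0 b1 by (auto simp: b_def)
  have small: "norm (H \<beta> 0) \<le> r / 2" if "\<bar>\<beta>\<bar> < b" for \<beta>
    using b1(2)[of \<beta>] that H0 r by (cases "\<beta> = 0") (auto simp: b_def)
  have "\<exists>!h. h \<in> cball 0 r \<and> H \<beta> h = h" if \<beta>: "\<bar>\<beta>\<bar> < b" for \<beta>
  proof (rule Banach_fix[where c="1/2"])
    show "H \<beta> ` cball 0 r \<subseteq> cball 0 r"
    proof clarsimp
      fix h :: 'a assume "norm h \<le> r"
      then have "norm (H \<beta> h - H \<beta> 0) \<le> r / 2" using lip[of \<beta> h 0] \<beta> b r by simp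
      then show "norm (H \<beta> h) \<le> r"
        using small[OF \<beta>] norm_triangle_sub[of "H \<beta> h" "H \<beta> 0"] by linarith
    qed
    show "dist (H \<beta> x) (H \<beta> y) \<le> 1/2 * dist x y" if "x \<in> cball 0 r" "y \<in> cball 0 r" for x y
      using lip[of \<beta> x y] that \<beta> b by (simp add: dist_norm)
  qed (use r in \<open>auto intro: closed_cball complete_eq_closed[THEN iffD2]\<close>)
  then obtain g where g: "\<And>\<beta>. \<bar>\<beta>\<bar> < b \<Longrightarrow> norm (g \<beta>) \<le> r \<and> H \<beta> (g \<beta>) = g \<beta>"
    and g_unique: "\<And>\<beta> h. \<bar>\<beta>\<bar> < b \<Longrightarrow> norm h \<le> r \<Longrightarrow> H \<beta> h = h \<Longrightarrow> h = g \<beta>"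
    by (metis mem_cball_0)
  have g0: "g 0 = 0" using g_unique[of 0 0] H0 b r by simp
  \<comment> \<open>Formal differentiation of H \<beta> (g \<beta>) = g \<beta> determines the
    candidate derivative, obtained here as a fixed point of an affine contraction.\<close>
  have "\<exists>k. A \<beta> (g \<beta>) k + q \<beta> (g \<beta>) = k" if \<beta>: "\<bar>\<beta>\<bar> < b" for \<beta>
  proof -
    have "\<exists>!k. A \<beta> (g \<beta>) k + q \<beta> (g \<beta>) = k"
    proof (rule banach_fix_type[where c="1/2"])
      show "\<forall>x y. dist (A \<beta> (g \<beta>) x + q \<beta> (g \<beta>)) (A \<beta> (g \<beta>) y + q \<beta> (g \<beta>)) \<le> 1/2 * dist x y"
        using contr[of \<beta> "g \<beta>"] g[OF \<beta>] \<beta> b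
        by (auto simp: dist_norm linear_diff[OF linA, symmetric])
    qed auto
    then show ?thesis by blast
  qed
  then obtain g' where g': "\<And>\<beta>. \<bar>\<beta>\<bar> < b \<Longrightarrow> A \<beta> (g \<beta>) (g' \<beta>) + q \<beta> (g \<beta>) = g' \<beta>" by metis
  \<comment> \<open>Quantitative invertibility of 1 - A; it converts each residual estimate below
    into an estimate of the unknown itself.\<close>
  have half: "norm x \<le> 2 * norm (x - A \<beta> (g \<beta>) x)" if "\<bar>\<beta>\<bar> < b" for \<beta> x
    using contr[of \<beta> "g \<beta>" x] g[OF that] that b norm_triangle_sub[of x "A \<beta> (g \<beta>) x"] by simp
  have deriv: "(g has_vector_derivative g' \<beta>) (at \<beta>)" if \<beta>: "\<bar>\<beta>\<bar> < b" for \<beta>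
  proof -
    have near: "\<forall>\<^sub>F s in nhds \<beta>. \<bar>s\<bar> < b"
    proof -
      have "open {-b<..<b}" "\<beta> \<in> {-b<..<b}" using \<beta> by auto
      from eventually_nhds_in_open[OF this] show ?thesis by (auto elim!: eventually_mono)
    qed
    define K where "K = norm (q \<beta> (g \<beta>)) + 1"
    note fix_h[of "g \<beta>" \<beta>]
    then obtain d1 where d1: "0 < d1" "\<And>s. \<bar>s - \<beta>\<bar> < d1 \<Longrightarrow>
        norm (H s (g \<beta>) - H \<beta> (g \<beta>) - (s - \<beta>) *\<^sub>R q \<beta> (g \<beta>)) \<le> \<bar>s - \<beta>\<bar>"
      unfolding has_derivative_at_alt by (metis mult_1 real_norm_def zero_less_one)
    have lipg: "norm (g s - g \<beta>) \<le> 2 * K * \<bar>s - \<beta>\<bar>" if s: "\<bar>s - \<beta>\<bar> < d1" "\<bar>s\<bar> < b" for s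
    proof -
      have "norm (H s (g \<beta>) - H \<beta> (g \<beta>))
          \<le> norm (H s (g \<beta>) - H \<beta> (g \<beta>) - (s - \<beta>) *\<^sub>R q \<beta> (g \<beta>)) + norm ((s - \<beta>) *\<^sub>R q \<beta> (g \<beta>))"
        by (metis diff_add_cancel norm_triangle_ineq)
      also have "\<dots> \<le> K * \<bar>s - \<beta>\<bar>" using d1(2)[OF s(1)] by (simp add: K_def distrib_left distrib_right mult.commute[of _ "\<bar>s - \<beta>\<bar>"])
      finally have 1: "norm (H s (g \<beta>) - H \<beta> (g \<beta>)) \<le> K * \<bar>s - \<beta>\<bar>" .
      have 2: "norm (H s (g s) - H s (g \<beta>)) \<le> norm (g s - g \<beta>) / 2"
        using lip[of s "g s" "g \<beta>"] g[OF \<beta>] g[OF s(2)] s b by simp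
      have "g s - g \<beta> = (H s (g s) - H s (g \<beta>)) + (H s (g \<beta>) - H \<beta> (g \<beta>))"
        using g[OF \<beta>] g[OF s(2)] by simp
      then have "norm (g s - g \<beta>) \<le> norm (H s (g s) - H s (g \<beta>)) + norm (H s (g \<beta>) - H \<beta> (g \<beta>))"
        by (metis norm_triangle_ineq)
      then have "norm (g s - g \<beta>) \<le> norm (g s - g \<beta>) / 2 + K * \<bar>s - \<beta>\<bar>"
        using 1 2 by linarith
      then show ?thesis by linarith
    qed
    have K: "0 < K" by (simp add: K_def add_nonneg_pos)
    show ?thesis unfolding has_vector_derivative_def has_derivative_at_alt
    proof (intro conjI allI impI)
      show "bounded_linear (\<lambda>x. x *\<^sub>R g' \<beta>)" by (rule bounded_linear_scaleR_left)
      fix e :: real assume e: "0 < e"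
      \<comment> \<open>Anticipates the factor 1 + 2 K from the distance of (s, g s) to (\<beta>, g
        \<beta>) and the factor 2 from \<open>half\<close>.\<close>
      define e' where "e' = e / (2 * (1 + 2 * K))"
      have e': "0 < e'" "2 * (e' * (1 + 2 * K)) = e" using e K by (auto simp: e'_def field_simps)
      obtain d2 where d2: "0 < d2" "\<And>p. norm (p - (\<beta>, g \<beta>)) < d2 \<Longrightarrow>
          norm ((\<lambda>(\<beta>, h). H \<beta> h) p - (\<lambda>(\<beta>, h). H \<beta> h) (\<beta>, g \<beta>)
            - (\<lambda>(s, k). s *\<^sub>R q \<beta> (g \<beta>) + A \<beta> (g \<beta>) k) (p - (\<beta>, g \<beta>))) \<le> e' * norm (p - (\<beta>, g \<beta>))"
        using D[of \<beta> "g \<beta>"] e'(1) unfolding has_derivative_at_alt by blast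
      obtain d3 where d3: "0 < d3" "\<And>s. \<bar>s - \<beta>\<bar> < d3 \<Longrightarrow> \<bar>s\<bar> < b"
        using near unfolding eventually_nhds_metric by (auto simp: dist_norm)
      define d where "d = min d1 (min d3 (d2 / (1 + 2 * K)))"
      have d: "0 < d" using d1 d2 d3 K by (auto simp: d_def)
      show "\<exists>d>0. \<forall>y. norm (y - \<beta>) < d \<longrightarrow>
          norm (g y - g \<beta> - (y - \<beta>) *\<^sub>R g' \<beta>) \<le> e * norm (y - \<beta>)"
      proof (intro exI[of _ d] conjI allI impI d)
        fix s assume "norm (s - \<beta>) < d"
        then have s: "\<bar>s - \<beta>\<bar> < d1" "\<bar>s - \<beta>\<bar> < d3" "\<bar>s - \<beta>\<bar> * (1 + 2 * K) < d2"
          using K by (auto simp: d_def field_simps)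
        have sb: "\<bar>s\<bar> < b" using d3(2)[OF s(2)] .
        have n: "norm ((s, g s) - (\<beta>, g \<beta>)) \<le> \<bar>s - \<beta>\<bar> * (1 + 2 * K)"
          using norm_Pair_le[of "s - \<beta>" "g s - g \<beta>"] lipg[OF s(1) sb] by (simp add: algebra_simps)
        define R where "R = g s - g \<beta> - (s - \<beta>) *\<^sub>R g' \<beta>"
        have "A \<beta> (g \<beta>) (g s - g \<beta>) = A \<beta> (g \<beta>) R + (s - \<beta>) *\<^sub>R A \<beta> (g \<beta>) (g' \<beta>)"
          unfolding R_def by (simp add: linear_diff[OF linA] linear_scale[OF linA])
        moreover have "(s - \<beta>) *\<^sub>R g' \<beta> = (s - \<beta>) *\<^sub>R A \<beta> (g \<beta>) (g' \<beta>) + (s - \<beta>) *\<^sub>R q \<beta> (g \<beta>)"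
          using g'[OF \<beta>] by (metis scaleR_right_distrib)
        ultimately have "R - A \<beta> (g \<beta>) R
            = g s - g \<beta> - ((s - \<beta>) *\<^sub>R q \<beta> (g \<beta>) + A \<beta> (g \<beta>) (g s - g \<beta>))"
          by (simp add: R_def)
        also have "norm \<dots> \<le> e' * norm ((s, g s) - (\<beta>, g \<beta>))"
          using d2(2)[of "(s, g s)"] n s(3) g[OF \<beta>] g[OF sb] by simp
        also have "\<dots> \<le> e' * (\<bar>s - \<beta>\<bar> * (1 + 2 * K))" using n e' by (intro mult_left_mono) auto
        finally have "norm R \<le> 2 * (e' * (\<bar>s - \<beta>\<bar> * (1 + 2 * K)))"
          using half[OF \<beta>, of R] by linarith
        also have "\<dots> = e * \<bar>s - \<beta>\<bar>" using e'(2) by (metis mult.assoc mult.commute)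
        finally show "norm (g s - g \<beta> - (s - \<beta>) *\<^sub>R g' \<beta>) \<le> e * norm (s - \<beta>)"
          by (simp add: R_def)
      qed
    qed
  qed
  have "continuous (at \<beta>) g'" if \<beta>: "\<bar>\<beta>\<bar> < b" for \<beta>
  proof -
    have near: "\<forall>\<^sub>F s in at \<beta>. \<bar>s\<bar> < b"
    proof -
      have "open {-b<..<b}" "\<beta> \<in> {-b<..<b}" using \<beta> by auto
      from eventually_at_in_open'[OF this] show ?thesis by (auto elim!: eventually_mono)
    qed
    have cg: "((\<lambda>s. (s, g s)) \<longlongrightarrow> (\<beta>, g \<beta>)) (at \<beta>)"
      using has_vector_derivative_continuous[OF deriv[OF \<beta>]] by (intro tendsto_intros) (simp add: continuous_at)
    have lim: "((\<lambda>s. f s (g s)) \<longlongrightarrow> f \<beta> (g \<beta>)) (at \<beta>)"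
      if "continuous_on UNIV (\<lambda>(\<beta>, h). f \<beta> h)" for f :: "real \<Rightarrow> 'a \<Rightarrow> 'a"
    proof -
      have "isCont (\<lambda>(\<beta>, h). f \<beta> h) (\<beta>, g \<beta>)" using that by (simp add: continuous_on_eq_continuous_at)
      from isCont_tendsto_compose[OF this cg] show ?thesis by simp
    qed
    have "((\<lambda>s. 2 * norm ((A s (g s) (g' \<beta>) - A \<beta> (g \<beta>) (g' \<beta>)) + (q s (g s) - q \<beta> (g \<beta>)))) \<longlongrightarrow>
        2 * norm ((A \<beta> (g \<beta>) (g' \<beta>) - A \<beta> (g \<beta>) (g' \<beta>)) + (q \<beta> (g \<beta>) - q \<beta> (g \<beta>)))) (at \<beta>)"
      by (intro tendsto_intros lim cA cq)
    then have z: "((\<lambda>s. 2 * norm ((A s (g s) (g' \<beta>) - A \<beta> (g \<beta>) (g' \<beta>)) + (q s (g s) - q \<beta> (g \<beta>)))) \<longlongrightarrow> 0) (at \<beta>)"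
      by simp
    have "\<forall>\<^sub>F s in at \<beta>. norm (g' s - g' \<beta>)
        \<le> 2 * norm ((A s (g s) (g' \<beta>) - A \<beta> (g \<beta>) (g' \<beta>)) + (q s (g s) - q \<beta> (g \<beta>)))"
      using near
    proof eventually_elim
      case (elim s)
      \<comment> \<open>Subtracting the two linear equations leaves only differences of
        \<open>A\<close> and \<open>q\<close> along the branch at the fixed vector g'
        \<beta>.\<close>
      have "(g' s - g' \<beta>) - A s (g s) (g' s - g' \<beta>)
          = (A s (g s) (g' \<beta>) - A \<beta> (g \<beta>) (g' \<beta>)) + (q s (g s) - q \<beta> (g \<beta>))"
        using g'[OF \<beta>] g'[OF elim] by (simp add: linear_diff[OF linA] algebra_simps)
      then show ?case using half[OF elim, of "g' s - g' \<beta>"] by simp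
    qed
    then have "((\<lambda>s. g' s - g' \<beta>) \<longlongrightarrow> 0) (at \<beta>)" by (rule Lim_null_comparison[OF _ z])
    then show ?thesis using LIM_zero_cancel by (auto simp: continuous_at)
  qed
  then have "continuous_on {-b<..<b} g'"
    by (auto intro!: continuous_at_imp_continuous_on)
  with deriv have "g C1_differentiable_on {-b<..<b}"
    unfolding C1_differentiable_on_def by (intro exI[of _ g']) auto
  with b g0 g show thesis by (intro that[of b g]) auto
qed

section \<open>Linear second order boundary value problems\<close>

lemma has_real_derivative_transform:
  fixes f g :: "real \<Rightarrow> real"
  assumes "x \<in> S" "\<And>y. y \<in> S \<Longrightarrow> g y = f y" "(f has_real_derivative D) (at x within S)"
  shows "(g has_real_derivative D) (at x within S)"
  using has_field_derivative_transform_within[OF assms(3) zero_less_one assms(1), of g] assms(2) by simp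

lemma DERIV_prim_bcontfun:
  assumes "x \<in> {0..L}"
  shows "(apply_bcontfun (prim_bcontfun L f) has_real_derivative f x) (at x within {0..L})"
  by (rule has_real_derivative_transform[OF assms _ integral_has_real_derivative[OF _ assms]])
    (auto simp: apply_prim_bcontfun)

text \<open>Each integration against the weight exp(K s) gains a factor 1 / K; two of them beat the
  coefficient bound when K is large.\<close>

lemma abs_integral_exp_bound:
  fixes f :: "real \<Rightarrow> real"
  assumes K: "0 < K" and t: "0 \<le> t" and c: "continuous_on {0..t} f"
    and N: "\<And>s. s \<in> {0..t} \<Longrightarrow> \<bar>f s\<bar> \<le> N * exp (K * s)"
  shows "\<bar>integral {0..t} f\<bar> \<le> N / K * exp (K * t)"
proof -
  have "\<bar>f 0\<bar> \<le> N" using N[of 0] t by simp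
  then have N0: "0 \<le> N" by linarith
  have I: "((\<lambda>s. N * exp (K * s)) has_integral (N / K * exp (K * t) - N / K * exp (K * 0))) {0..t}"
    using t K by (intro fundamental_theorem_of_calculus)
      (auto intro!: derivative_eq_intros simp: has_real_derivative_iff_has_vector_derivative[symmetric])
  have "norm (integral {0..t} f) \<le> integral {0..t} (\<lambda>s. N * exp (K * s))"
    using c N by (intro integral_norm_bound_integral integrable_continuous_real has_integral_integrable[OF I]) auto
  also have "\<dots> \<le> N / K * exp (K * t)" unfolding integral_unique[OF I] using K N0 by simp
  finally show ?thesis by simp
qed

text \<open>Existence by contraction in the weighted unknown \<open>exp (- K x) y x\<close> with \<open>K\<close> large.\<close>

lemma linear_ivp:
  fixes q :: "real \<Rightarrow> real"
  assumes L: "0 \<le> L" and q: "continuous_on {0..L} q"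
  obtains y y' where "y 0 = a" "y' 0 = b"
    "\<And>x. x \<in> {0..L} \<Longrightarrow> (y has_real_derivative y' x) (at x within {0..L})"
    "\<And>x. x \<in> {0..L} \<Longrightarrow> (y' has_real_derivative q x * y x) (at x within {0..L})"
proof -
  obtain M where M: "0 \<le> M" "\<And>x. x \<in> {0..L} \<Longrightarrow> \<bar>q x\<bar> \<le> M"
    by (rule continuous_abs_bound[OF q]) (rule that)
  \<comment> \<open>Then K \<ge> 1 and K * K \<ge> K \<ge> 2 M, so two integrations give the factor
    M / K^2 \<le> 1/2.\<close>
  define K where "K = 2 * M + 1"
  have K: "0 < K" "M / K / K \<le> 1 / 2"
  proof -
    show "0 < K" using M by (simp add: K_def)
    have "2 * M \<le> K * 1" "1 \<le> K" using M by (auto simp: K_def)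
    then have "2 * M \<le> K * K" using mult_left_mono[of 1 K K] \<open>0 < K\<close> by linarith
    then show "M / K / K \<le> 1 / 2" using \<open>0 < K\<close> by (simp add: field_simps)
  qed
  define Q Ep Em y0 where "Q = ext_bcontfun L q" and "Ep = ext_bcontfun L (\<lambda>x. exp (K * x))"
    and "Em = ext_bcontfun L (\<lambda>x. exp (- K * x))" and "y0 = ext_bcontfun L (\<lambda>x. a + b * x)"
  let ?J = "prim_bcontfun L"
  have ev: "Q x = q x" "Ep x = exp (K * x)" "Em x = exp (- K * x)" "y0 x = a + b * x" if "x \<in> {0..L}" for x
    unfolding Q_def Ep_def Em_def y0_def using that q
    by (auto intro!: apply_ext_bcontfun_mem continuous_intros)
  \<comment> \<open>The twice iterated integral of q y, conjugated by the weight: the unknown is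
    \<open>f\<close> with y = \<open>Ep * f\<close>.\<close>
  define A where "A f = Em * ?J (?J (Q * (Ep * f)))" for f
  have lin: "linear ?J" using bounded_linear_prim_bcontfun[OF L] by (rule bounded_linear.linear)
  have A_diff: "A f - A g = A (f - g)" for f g
    unfolding A_def by (simp add: right_diff_distrib linear_diff[OF lin])
  have A_bound: "norm (A f) \<le> 1 / 2 * norm f" for f
  proof (rule norm_bound)
    fix x0 :: real
    define x where "x = clamp 0 L x0"
    have x: "x \<in> {0..L}" unfolding x_def by (rule clamp_real_mem[OF L])
    have J1: "\<bar>?J (Q * (Ep * f)) t\<bar> \<le> M * norm f / K * exp (K * t)" if t: "t \<in> {0..L}" for t
      unfolding apply_prim_bcontfun[OF t]
    proof (rule abs_integral_exp_bound[OF K(1)])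
      fix s assume "s \<in> {0..t}"
      then have s: "s \<in> {0..L}" using t by auto
      have "\<bar>q s\<bar> * (exp (K * s) * \<bar>f s\<bar>) \<le> M * (exp (K * s) * norm f)"
        using M(2)[OF s] norm_bounded[of f s] M(1) by (intro mult_mono) auto
      then show "\<bar>(Q * (Ep * f)) s\<bar> \<le> M * norm f * exp (K * s)"
        using s by (simp add: ev abs_mult mult_ac)
    qed (use t in \<open>auto intro!: continuous_intros\<close>)
    have "\<bar>?J (?J (Q * (Ep * f))) x\<bar> \<le> M * norm f / K / K * exp (K * x)"
      unfolding apply_prim_bcontfun[OF x]
      by (rule abs_integral_exp_bound[OF K(1)]) (use x J1 in auto)
    then have "exp (- K * x) * \<bar>?J (?J (Q * (Ep * f))) x\<bar> \<le> exp (- K * x) * (M * norm f / K / K * exp (K * x))"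
      by (rule mult_left_mono) simp
    also have "\<dots> = M / K / K * norm f" by (simp add: exp_minus field_simps)
    also have "\<dots> \<le> 1 / 2 * norm f" using K by (intro mult_right_mono) auto
    finally have "\<bar>A f x\<bar> \<le> 1 / 2 * norm f" unfolding A_def by (simp add: ev[OF x] abs_mult)
    \<comment> \<open>Off [0,L] both factors are clamped, so the supremum over the line is that over
      [0,L].\<close>
    moreover have "A f x0 = A f x"
    proof -
      have "Em x0 = exp (- K * x)"
        unfolding Em_def x_def by (rule apply_ext_bcontfun) (intro continuous_intros)
      moreover have "?J g x0 = integral {0..x} g" for g
        unfolding prim_bcontfun_def x_def by (rule apply_ext_bcontfun[OF continuous_integral_bcontfun])
      ultimately show ?thesis using ev(3)[OF x] apply_prim_bcontfun[OF x] by (simp add: A_def)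
    qed
    ultimately show "norm (A f x0) \<le> 1 / 2 * norm f" by simp
  qed
  have "\<exists>!z. Em * y0 + A z = z"
    by (rule banach_fix_type[where c="1/2"]) (use A_bound in \<open>auto simp: dist_norm A_diff\<close>)
  then obtain z where z: "Em * y0 + A z = z" by blast
  define y where "y = Ep * z"
  define y' where "y' x = b + ?J (Q * y) x" for x
  have y_eq: "y x = a + b * x + ?J (?J (Q * y)) x" if x: "x \<in> {0..L}" for x
  proof -
    have "y x = exp (K * x) * (Em * y0 + A z) x" unfolding y_def z using x by (simp add: ev)
    also have "\<dots> = (exp (K * x) * exp (- K * x)) * (a + b * x + ?J (?J (Q * y)) x)"
      using x by (simp add: ev A_def y_def algebra_simps)
    finally show ?thesis by (simp add: exp_minus)
  qed
  show thesis
  proof (rule that[of "apply_bcontfun y" y'])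
    show "y 0 = a" using y_eq[of 0] L apply_prim_bcontfun[of 0 L] by simp
    show "y' 0 = b" using L apply_prim_bcontfun[of 0 L] by (simp add: y'_def)
    fix x assume x: "x \<in> {0..L}"
    have "((\<lambda>x. a + b * x + ?J (?J (Q * y)) x) has_real_derivative y' x) (at x within {0..L})"
      unfolding y'_def by (rule derivative_eq_intros DERIV_prim_bcontfun[OF x] refl | simp)+
    then show "(apply_bcontfun y has_real_derivative y' x) (at x within {0..L})"
      by (rule has_real_derivative_transform[OF x, rotated]) (simp add: y_eq)
    have "((\<lambda>x. b + ?J (Q * y) x) has_real_derivative 0 + (Q * y) x) (at x within {0..L})"
      by (rule DERIV_add[OF DERIV_const DERIV_prim_bcontfun[OF x]])
    then show "(y' has_real_derivative q x * y x) (at x within {0..L})"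
      unfolding y'_def[abs_def] using x by (simp add: ev)
  qed
qed

definition trivial_bvp :: "real \<Rightarrow> (real \<Rightarrow> real) \<Rightarrow> bool" where
  "trivial_bvp L q \<longleftrightarrow> (\<forall>h h'. (\<forall>x\<in>{0..L}. (h has_real_derivative h' x) (at x within {0..L}) \<and>
        (h' has_real_derivative q x * h x) (at x within {0..L})) \<longrightarrow>
      h 0 = 0 \<longrightarrow> h' L = 0 \<longrightarrow> (\<forall>x\<in>{0..L}. h x = 0))"

text \<open>Green's operator built from the solutions \<open>\<phi>\<close>, \<open>\<omega>\<close> of \<open>y'' = q y\<close> adapted to the left and right
  boundary conditions; their Wronskian is nonzero because the homogeneous problem is trivial.\<close>

lemma green_operator:
  fixes q :: "real \<Rightarrow> real"
  assumes L: "0 < L" and q: "continuous_on {0..L} q"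
    and trivial: "trivial_bvp L q"
  obtains G G' :: "(real \<Rightarrow>\<^sub>C real) \<Rightarrow> (real \<Rightarrow>\<^sub>C real)"
  where "bounded_linear G" "bounded_linear G'"
    "\<And>f. G f 0 = 0" "\<And>f. G' f L = 0"
    "\<And>f x. x \<in> {0..L} \<Longrightarrow> (apply_bcontfun (G f) has_real_derivative G' f x) (at x within {0..L})"
    "\<And>f x. x \<in> {0..L} \<Longrightarrow>
      (apply_bcontfun (G' f) has_real_derivative q x * G f x - f x) (at x within {0..L})"
proof -
  have L0: "0 \<le> L" using L by simp
  obtain \<phi> \<phi>' where \<phi>: "\<phi> 0 = 0" "\<phi>' 0 = 1"
    "\<And>x. x \<in> {0..L} \<Longrightarrow> (\<phi> has_real_derivative \<phi>' x) (at x within {0..L})"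
    "\<And>x. x \<in> {0..L} \<Longrightarrow> (\<phi>' has_real_derivative q x * \<phi> x) (at x within {0..L})"
    by (rule linear_ivp[OF L0 q, of 0 1]) (rule that)
  have "continuous_on {0..L} (\<lambda>x. q (L - x))"
    by (rule continuous_on_compose2[OF q]) (auto intro!: continuous_intros)
  then obtain \<eta> \<eta>' where \<eta>: "\<eta> 0 = 1" "\<eta>' 0 = 0"
    "\<And>x. x \<in> {0..L} \<Longrightarrow> (\<eta> has_real_derivative \<eta>' x) (at x within {0..L})"
    "\<And>x. x \<in> {0..L} \<Longrightarrow> (\<eta>' has_real_derivative q (L - x) * \<eta> x) (at x within {0..L})"
    by (rule linear_ivp[OF L0, of _ 1 0]) (rule that)
  \<comment> \<open>Reflection x -> L - x turns data at the right end into an initial value problem;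
    the derivative changes sign.\<close>
  define \<omega> \<omega>' where "\<omega> x = \<eta> (L - x)" and "\<omega>' x = - \<eta>' (L - x)" for x
  have refl_D: "((\<lambda>x. f (L - x)) has_real_derivative - D) (at x within {0..L})"
    if "x \<in> {0..L}" "(f has_real_derivative D) (at (L - x) within {0..L})" for f D x
  proof -
    have im: "(-) L ` {0..L} \<subseteq> {0..L}" by auto
    have "(f \<circ> (\<lambda>y. L - y) has_real_derivative D * (- 1)) (at x within {0..L})"
      by (rule DERIV_image_chain[OF DERIV_subset[OF that(2) im]]) (auto intro!: derivative_eq_intros)
    then show ?thesis by (simp add: o_def)
  qed
  have \<omega>: "(\<omega> has_real_derivative \<omega>' x) (at x within {0..L})"
    "(\<omega>' has_real_derivative q x * \<omega> x) (at x within {0..L})" "\<omega> L = 1" "\<omega>' L = 0" if x: "x \<in> {0..L}" for x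
  proof -
    have x': "L - x \<in> {0..L}" using x by auto
    show "(\<omega> has_real_derivative \<omega>' x) (at x within {0..L})"
      unfolding \<omega>_def[abs_def] \<omega>'_def using refl_D[OF x \<eta>(3)[OF x']] .
    show "(\<omega>' has_real_derivative q x * \<omega> x) (at x within {0..L})"
      unfolding \<omega>_def \<omega>'_def[abs_def] using DERIV_minus[OF refl_D[OF x \<eta>(4)[OF x']]] by simp
    show "\<omega> L = 1" "\<omega>' L = 0" by (auto simp: \<omega>_def \<omega>'_def \<eta>)
  qed
  \<comment> \<open>Otherwise \<phi> solves the homogeneous boundary value problem and vanishes,
    contradicting its unit slope at 0.\<close>
  have "\<phi>' L \<noteq> 0"
  proof
    assume "\<phi>' L = 0"
    then have "\<phi> x = 0" if "x \<in> {0..L}" for x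
      using trivial \<phi>(1,3,4) that unfolding trivial_bvp_def by blast
    then have "((\<lambda>x. 0) has_real_derivative \<phi>' 0) (at 0 within {0..L})"
      using L by (intro has_real_derivative_transform[OF _ _ \<phi>(3)[of 0]]) auto
    moreover have "at 0 within {0..L} \<noteq> bot" using L by (simp add: trivial_limit_within islimpt_Icc)
    ultimately have "\<phi>' 0 = 0" by (metis DERIV_const has_real_derivative_iff_has_vector_derivative vector_derivative_unique_within)
    with \<phi>(2) show False by simp
  qed
  define W where "W x = \<phi>' x * \<omega> x - \<phi> x * \<omega>' x" for x
  have W: "W x = \<phi>' L" if "x \<in> {0..L}" for x
  proof -
    have "(W has_real_derivative 0) (at x within {0..L})" if "x \<in> {0..L}" for x
      unfolding W_def[abs_def]
      by (rule DERIV_cong[OF DERIV_diff[OF DERIV_mult[OF \<phi>(4)[OF that] \<omega>(1)[OF that]]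
            DERIV_mult[OF \<phi>(3)[OF that] \<omega>(2)[OF that]]]]) (simp add: algebra_simps)
    then obtain k where "\<forall>x\<in>{0..L}. W x = k"
      using has_field_derivative_zero_constant[of "{0..L}" W] by auto
    then have "W x = W L" using that L by simp
    then show ?thesis using L \<omega>(3,4)[of L] by (simp add: W_def)
  qed
  have cont: "continuous_on {0..L} \<phi>" "continuous_on {0..L} \<phi>'" "continuous_on {0..L} \<omega>" "continuous_on {0..L} \<omega>'"
    by (rule DERIV_continuous_on, erule \<phi> \<omega>)+
  let ?E = "ext_bcontfun L" and ?J = "prim_bcontfun L" and ?c = "1 / \<phi>' L"
  note [simp] = cont
  \<comment> \<open>This is (1/W) (a(x) int_x^L \<omega> f + b(x) int_0^x \<phi> f). The pair
    (\<phi>, \<omega>) gives the Green operator, the pair of derivatives gives its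
    x-derivative.\<close>
  define S where "S a b f = ?c *\<^sub>R (?J (?E \<omega> * f) L *\<^sub>R ?E a - ?E a * ?J (?E \<omega> * f) + ?E b * ?J (?E \<phi> * f))"
    for a b :: "real \<Rightarrow> real" and f
  have bl: "bounded_linear (S a b)" for a b
  proof -
    have J: "bounded_linear (\<lambda>f. ?J (g * f))" for g
      using bounded_linear_compose[OF bounded_linear_prim_bcontfun[OF L0] bounded_linear_mult_right] .
    show ?thesis unfolding S_def[abs_def]
      by (intro bounded_linear_compose[OF bounded_linear_scaleR_right] bounded_linear_add bounded_linear_sub
          bounded_linear_compose[OF bounded_linear_scaleR_left]
          bounded_linear_compose[OF bounded_linear_mult_right J]
          bounded_linear_compose[OF bounded_linear_apply_bcontfun J])
  qed
  \<comment> \<open>The last term comes from differentiating the integration limits. It cancels for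
    the pair (\<phi>, \<omega>) and becomes -f for the pair of derivatives, by the constant
    Wronskian.\<close>
  have D: "(apply_bcontfun (S a b f) has_real_derivative
      ?c * (a' x * (?J (?E \<omega> * f) L - ?J (?E \<omega> * f) x) + b' x * ?J (?E \<phi> * f) x
        + (b x * \<phi> x - a x * \<omega> x) * f x)) (at x within {0..L})"
    if x: "x \<in> {0..L}" and ab: "\<And>x. x \<in> {0..L} \<Longrightarrow> (a has_real_derivative a' x) (at x within {0..L})"
      "\<And>x. x \<in> {0..L} \<Longrightarrow> (b has_real_derivative b' x) (at x within {0..L})" for a b a' b' f x
  proof -
    have c1: "continuous_on {0..L} a" using ab(1) by (rule DERIV_continuous_on)
    have c2: "continuous_on {0..L} b" using ab(2) by (rule DERIV_continuous_on)
    have "((\<lambda>x. ?c * (?J (?E \<omega> * f) L * a x - a x * ?J (?E \<omega> * f) x + b x * ?J (?E \<phi> * f) x)) has_real_derivative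
      ?c * (a' x * (?J (?E \<omega> * f) L - ?J (?E \<omega> * f) x) + b' x * ?J (?E \<phi> * f) x
        + (b x * \<phi> x - a x * \<omega> x) * f x)) (at x within {0..L})"
      by (rule derivative_eq_intros ab[OF x] DERIV_prim_bcontfun[OF x] refl)+
        (use x in \<open>simp add: algebra_simps\<close>)
    then show ?thesis
      by (rule has_real_derivative_transform[OF x, rotated]) (simp add: S_def c1 c2)
  qed
  show thesis
  proof (rule that[of "S \<phi> \<omega>" "S \<phi>' \<omega>'"])
    show "S \<phi> \<omega> f 0 = 0" for f
      using L apply_prim_bcontfun[of 0 L] \<phi>(1) by (simp add: S_def)
    show "S \<phi>' \<omega>' f L = 0" for f
      using L \<omega>(4)[of L] by (simp add: S_def)
    fix f x assume x: "x \<in> {0..L}"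
    show "(apply_bcontfun (S \<phi> \<omega> f) has_real_derivative S \<phi>' \<omega>' f x) (at x within {0..L})"
      by (rule DERIV_cong[OF D[OF x \<phi>(3) \<omega>(1)]]) (use x in \<open>auto simp: S_def algebra_simps\<close>)
    have "?c * (\<omega>' x * \<phi> x - \<phi>' x * \<omega> x) = - 1"
      using W[OF x] \<open>\<phi>' L \<noteq> 0\<close> by (simp add: W_def field_simps)
    then have "?c * ((\<omega>' x * \<phi> x - \<phi>' x * \<omega> x) * f x) = - f x" by (metis mult.assoc mult_minus1)
    moreover have "?c * (q x * \<phi> x * (?J (?E \<omega> * f) L - ?J (?E \<omega> * f) x) + q x * \<omega> x * ?J (?E \<phi> * f) x)
        = q x * S \<phi> \<omega> f x"
      using x by (simp add: S_def algebra_simps)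
    ultimately show "(apply_bcontfun (S \<phi>' \<omega>' f) has_real_derivative q x * S \<phi> \<omega> f x - f x) (at x within {0..L})"
      by (intro DERIV_cong[OF D[OF x \<phi>(4) \<omega>(2)]]) (simp_all only: distrib_left[of ?c "_ + _"] diff_conv_add_uminus)
  qed (rule bl)+
qed

section \<open>\<open>C\<^sup>1\<close> curves in \<open>H\<^sup>4\<close>\<close>

text \<open>Locally the derivative is the termwise differentiated power series. Closure of
  analyticity under \<open>deriv\<close> allows the differentiation to be repeated.\<close>

lemma real_analytic_on_DERIV:
  assumes "real_analytic_on g I"
  shows "real_analytic_on (deriv g) I"
    and "\<And>x. x \<in> I \<Longrightarrow> (g has_real_derivative deriv g x) (at x)"
proof -
  have loc: "\<exists>r>0. \<exists>a :: nat \<Rightarrow> real. \<forall>x. \<bar>x - p\<bar> < r \<longrightarrow>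
      (g has_real_derivative deriv g x) (at x) \<and> (\<lambda>n. a n * (x - p) ^ n) sums deriv g x"
    if "p \<in> I" for p
  proof -
    obtain r and a :: "nat \<Rightarrow> real" where r: "0 < r" and a: "\<And>x. \<bar>x - p\<bar> < r \<Longrightarrow> (\<lambda>n. a n * (x - p) ^ n) sums g x"
      using assms \<open>p \<in> I\<close> unfolding real_analytic_on_def by blast
    have s: "(\<lambda>n. a n * t ^ n) sums g (p + t)" if "norm t < r" for t
      using a[of "p + t"] that by simp
    have Dt: "((\<lambda>t. \<Sum>n. a n * t ^ n) has_real_derivative (\<Sum>n. diffs a n * t ^ n)) (at t)" if "norm t < r" for t
      using termdiffs_strong'[OF sums_summable[OF s] that] by blast
    have Dg: "(g has_real_derivative (\<Sum>n. diffs a n * (x - p) ^ n)) (at x)" if x: "\<bar>x - p\<bar> < r" for x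
    proof -
      have "((\<lambda>x. \<Sum>n. a n * (x - p) ^ n) has_real_derivative (\<Sum>n. diffs a n * (x - p) ^ n) * 1) (at x)"
        by (rule DERIV_chain2[where g="\<lambda>x. x - p", OF Dt]) (use x in \<open>auto intro!: derivative_eq_intros\<close>)
      moreover have "\<forall>\<^sub>F y in nhds x. (\<Sum>n. a n * (y - p) ^ n) = g y"
      proof -
        have "open (ball p r)" "x \<in> ball p r" using x by (auto simp: dist_real_def)
        from eventually_nhds_in_open[OF this] show ?thesis
          by (rule eventually_mono) (use a in \<open>auto simp: dist_real_def abs_minus_commute sums_unique[symmetric]\<close>)
      qed
      ultimately show ?thesis
        using DERIV_cong_ev[of x x "\<lambda>x. \<Sum>n. a n * (x - p) ^ n" g] by simp
    qed
    have "(\<lambda>n. diffs a n * (x - p) ^ n) sums deriv g x" if x: "\<bar>x - p\<bar> < r" for x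
    proof -
      have "((\<lambda>t. g (p + t)) has_real_derivative deriv g x * 1) (at (x - p))"
        by (rule DERIV_chain2[where g="\<lambda>t. p + t"])
          (use Dg[OF x] in \<open>auto intro!: derivative_eq_intros simp: DERIV_imp_deriv\<close>)
      from termdiffs_sums_strong[OF s this] x show ?thesis by simp
    qed
    moreover have "(g has_real_derivative deriv g x) (at x)" if x: "\<bar>x - p\<bar> < r" for x
      using Dg[OF x] DERIV_imp_deriv[OF Dg[OF x]] by simp
    ultimately show ?thesis
      using r by (intro exI[of _ r] conjI exI[of _ "diffs a"] allI impI)
  qed
  then show "real_analytic_on (deriv g) I" unfolding real_analytic_on_def by blast
  show "(g has_real_derivative deriv g x) (at x)" if "x \<in> I" for x
    using loc[OF that] by force
qed

lemma real_analytic_on_C2: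
  assumes "real_analytic_on \<zeta> I" "{0..L} \<subseteq> I"
  obtains \<zeta>1 \<zeta>2 where "\<And>x. x \<in> {0..L} \<Longrightarrow> (\<zeta> has_real_derivative \<zeta>1 x) (at x within {0..L})"
    "\<And>x. x \<in> {0..L} \<Longrightarrow> (\<zeta>1 has_real_derivative \<zeta>2 x) (at x within {0..L})"
    "continuous_on {0..L} \<zeta>2"
proof (rule that[of "deriv \<zeta>" "deriv (deriv \<zeta>)"])
  note A = assms(1) real_analytic_on_DERIV(1)[OF assms(1)]
  note A2 = real_analytic_on_DERIV(1)[OF A(2)]
  show "(\<zeta> has_real_derivative deriv \<zeta> x) (at x within {0..L})"
    "(deriv \<zeta> has_real_derivative deriv (deriv \<zeta>) x) (at x within {0..L})" if "x \<in> {0..L}" for x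
    by (rule has_field_derivative_at_within[OF real_analytic_on_DERIV(2)[OF A(1)]]
        has_field_derivative_at_within[OF real_analytic_on_DERIV(2)[OF A(2)]],
      use that assms(2) in blast)+
  \<comment> \<open>A third derivative is taken only to obtain continuity of the second.\<close>
  have "(deriv (deriv \<zeta>) has_real_derivative deriv (deriv (deriv \<zeta>)) x) (at x within {0..L})" if "x \<in> {0..L}" for x
    by (rule has_field_derivative_at_within[OF real_analytic_on_DERIV(2)[OF A2]])
      (use that assms(2) in blast)
  then show "continuous_on {0..L} (deriv (deriv \<zeta>))" by (rule DERIV_continuous_on)
qed

section \<open>Curves of classical derivative families\<close>

lemma classical_derivs_lincomb:
  assumes "classical_derivs n L F" "classical_derivs n L G"
  shows "classical_derivs n L (\<lambda>j x. a * F j x + b * G j x)"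
  using assms unfolding classical_derivs_def
  by (auto intro!: derivative_eq_intros continuous_intros)

text \<open>Derivatives in \<beta> and x commute: the relation between consecutive orders is written
  in integral form, differentiated in \<beta> through bounded evaluation and integration
  functionals, and then differentiated back in x.\<close>

lemma C1_curve_derivative:
  fixes \<gamma> D :: "nat \<Rightarrow> real \<Rightarrow> (real \<Rightarrow>\<^sub>C real)"
  assumes L: "0 < L" and B: "open B"
    and \<gamma>: "\<And>\<beta>. \<beta> \<in> B \<Longrightarrow> classical_derivs n L (\<lambda>j. \<gamma> j \<beta>)"
    and D: "\<And>j \<beta>. j \<le> n \<Longrightarrow> \<beta> \<in> B \<Longrightarrow> (\<gamma> j has_vector_derivative D j \<beta>) (at \<beta>)"
    and \<beta>: "\<beta> \<in> B"
  shows "classical_derivs n L (\<lambda>j. D j \<beta>)"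
proof -
  have ev: "((\<lambda>s. \<gamma> j s x) has_vector_derivative D j \<beta> x) (at \<beta>)" if "j \<le> n" for j x
    by (rule bounded_linear.has_vector_derivative[OF bounded_linear_apply_bcontfun D[OF that \<beta>]])
  have step: "D j \<beta> x = D j \<beta> 0 + prim_bcontfun L (D (Suc j) \<beta>) x" if j: "j < n" and x: "x \<in> {0..L}" for j x
  proof -
    have eq: "\<gamma> j s x = \<gamma> j s 0 + prim_bcontfun L (\<gamma> (Suc j) s) x" if s: "s \<in> B" for s
    proof -
      have "(apply_bcontfun (\<gamma> (Suc j) s) has_integral (\<gamma> j s x - \<gamma> j s 0)) {0..x}"
        using x \<gamma>[OF s] j
        by (intro fundamental_theorem_of_calculus)
          (auto simp: classical_derivs_def has_real_derivative_iff_has_vector_derivative[symmetric]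
            intro: DERIV_subset[of _ _ _ "{0..L}"])
      then show ?thesis using x by (simp add: apply_prim_bcontfun integral_unique)
    qed
    have "((\<lambda>s. \<gamma> j s 0 + prim_bcontfun L (\<gamma> (Suc j) s) x) has_vector_derivative
        D j \<beta> 0 + prim_bcontfun L (D (Suc j) \<beta>) x) (at \<beta>)"
      using j L by (intro has_vector_derivative_add ev
          bounded_linear.has_vector_derivative[OF bounded_linear_compose[OF bounded_linear_apply_bcontfun bounded_linear_prim_bcontfun]]
          D \<beta>) auto
    then have "((\<lambda>s. \<gamma> j s x) has_vector_derivative D j \<beta> 0 + prim_bcontfun L (D (Suc j) \<beta>) x) (at \<beta>)"
      by (rule has_vector_derivative_transform_within_open[OF _ B \<beta>]) (simp add: eq)
    then show ?thesis using vector_derivative_unique_at ev[of j x] j by force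
  qed
  have tr: "(D j \<beta> has_real_derivative D (Suc j) \<beta> x) (at x within {0..L})"
    if j: "j < n" and x: "x \<in> {0..L}" for j x
  proof -
    have "((\<lambda>x. D j \<beta> 0 + prim_bcontfun L (D (Suc j) \<beta>) x) has_real_derivative 0 + D (Suc j) \<beta> x)
        (at x within {0..L})"
      by (rule DERIV_add[OF DERIV_const DERIV_prim_bcontfun[OF x]])
    then have "((\<lambda>x. D j \<beta> 0 + prim_bcontfun L (D (Suc j) \<beta>) x) has_real_derivative D (Suc j) \<beta> x)
        (at x within {0..L})" by simp
    then show ?thesis by (rule has_real_derivative_transform[OF x, rotated]) (rule step[OF j])
  qed
  show ?thesis unfolding classical_derivs_def by (intro conjI allI impI ballI tr) auto
qed

lemma has_vector_derivative_diff_quotient: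
  assumes "(f has_vector_derivative d) (at x)"
  shows "((\<lambda>s. (f s - f x) /\<^sub>R (s - x)) \<longlongrightarrow> d) (at x)"
proof (rule tendstoI)
  fix e :: real assume e: "0 < e"
  then obtain r where r: "0 < r" "\<And>s. \<bar>s - x\<bar> < r \<Longrightarrow> norm (f s - f x - (s - x) *\<^sub>R d) \<le> e / 2 * \<bar>s - x\<bar>"
    using assms half_gt_zero[OF e] unfolding has_vector_derivative_def has_derivative_at_alt real_norm_def by blast
  have "dist ((f s - f x) /\<^sub>R (s - x)) d < e" if s: "s \<noteq> x" "\<bar>s - x\<bar> < r" for s
  proof -
    have "(f s - f x) /\<^sub>R (s - x) - d = (f s - f x - (s - x) *\<^sub>R d) /\<^sub>R (s - x)"
      using s by (simp add: scaleR_diff_right)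
    then have "dist ((f s - f x) /\<^sub>R (s - x)) d = norm (f s - f x - (s - x) *\<^sub>R d) / \<bar>s - x\<bar>"
      by (simp add: dist_norm divide_inverse mult.commute)
    also have "\<dots> \<le> e / 2" using r(2)[OF s(2)] s(1) by (simp add: field_simps)
    finally show ?thesis using e by simp
  qed
  with r(1) show "\<forall>\<^sub>F s in at x. dist ((f s - f x) /\<^sub>R (s - x)) d < e"
    unfolding eventually_at by (auto simp: dist_real_def)
qed

text \<open>Sup-norm C^1 dependence of all five derivatives controls the difference quotients in
  H^4. The base function \<open>u\<close> cancels in every difference, so it may be any
  representative.\<close>

lemma C1_into_H4_I:
  fixes \<gamma> :: "nat \<Rightarrow> real \<Rightarrow> (real \<Rightarrow>\<^sub>C real)"
  assumes L: "0 < L" and b: "0 < b"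
    and \<gamma>: "\<And>\<beta>. \<beta> \<in> {-b<..<b} \<Longrightarrow> classical_derivs 4 L (\<lambda>j. \<gamma> j \<beta>)"
    and C1: "\<And>j. j \<le> 4 \<Longrightarrow> \<gamma> j C1_differentiable_on {-b<..<b}"
    and U: "\<And>\<beta>. \<beta> \<in> {-b<..<b} \<Longrightarrow> (\<lambda>x. u x + \<gamma> 0 \<beta> x) \<in> sobolev 4 L"
  shows "C1_into_H4 L b (\<lambda>\<beta> x. u x + \<gamma> 0 \<beta> x)"
proof -
  let ?B = "{-b<..<b}"
  have "\<forall>j. \<exists>D. j \<le> 4 \<longrightarrow> (\<forall>\<beta>\<in>?B. (\<gamma> j has_vector_derivative D \<beta>) (at \<beta>)) \<and> continuous_on ?B D"
    using C1 unfolding C1_differentiable_on_def by blast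
  from choice[OF this] obtain D where
    D: "\<And>j \<beta>. j \<le> 4 \<Longrightarrow> \<beta> \<in> ?B \<Longrightarrow> (\<gamma> j has_vector_derivative D j \<beta>) (at \<beta>)"
    and cD: "\<And>j. j \<le> 4 \<Longrightarrow> continuous_on ?B (D j)" by blast
  have \<delta>: "classical_derivs 4 L (\<lambda>j. D j \<beta>)" if "\<beta> \<in> ?B" for \<beta>
    by (rule C1_curve_derivative[where B="?B" and \<gamma>=\<gamma>]) (use L \<gamma> D that in auto)
  have near: "\<forall>\<^sub>F s in at \<beta>. s \<in> ?B" if "\<beta> \<in> ?B" for \<beta>
    using eventually_at_in_open'[of ?B \<beta>] that by simp
  have norm0: "0 \<le> sobolev_norm 4 L v" for v
    unfolding sobolev_norm_def by (intro real_sqrt_ge_zero sum_nonneg) simp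
  show ?thesis unfolding C1_into_H4_def
  proof (intro exI[of _ "\<lambda>\<beta>. apply_bcontfun (D 0 \<beta>)"] ballI conjI)
    fix \<beta> assume \<beta>: "\<beta> \<in> ?B"
    show "(\<lambda>x. u x + \<gamma> 0 \<beta> x) \<in> sobolev 4 L" by (rule U[OF \<beta>])
    show "apply_bcontfun (D 0 \<beta>) \<in> sobolev 4 L"
      using classical_derivs_sobolev(1)[OF L \<delta>[OF \<beta>] continuous_measurable_ivl ae_eq_refl] by simp
    let ?R = "\<lambda>j s. (\<gamma> j s - \<gamma> j \<beta>) /\<^sub>R (s - \<beta>) - D j \<beta>"
    have "((\<lambda>s. sqrt L * (\<Sum>j\<le>4. norm (?R j s))) \<longlongrightarrow> sqrt L * (\<Sum>j\<le>(4::nat). norm (0 :: real \<Rightarrow>\<^sub>C real))) (at \<beta>)"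
    proof (intro tendsto_intros)
      fix j :: nat assume "j \<in> {..4}"
      then have "(\<gamma> j has_vector_derivative D j \<beta>) (at \<beta>)" using D \<beta> by auto
      then have "((\<lambda>s. (\<gamma> j s - \<gamma> j \<beta>) /\<^sub>R (s - \<beta>)) \<longlongrightarrow> D j \<beta>) (at \<beta>)"
        by (rule has_vector_derivative_diff_quotient)
      then show "(?R j \<longlongrightarrow> 0) (at \<beta>)" by (simp add: LIM_zero)
    qed
    then have lim: "((\<lambda>s. sqrt L * (\<Sum>j\<le>4. norm (?R j s))) \<longlongrightarrow> 0) (at \<beta>)" by simp
    have "\<forall>\<^sub>F s in at \<beta>. norm (sobolev_norm 4 L (\<lambda>x. ((u x + \<gamma> 0 s x) - (u x + \<gamma> 0 \<beta> x)) / (s - \<beta>) - D 0 \<beta> x))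
        \<le> sqrt L * (\<Sum>j\<le>4. norm (?R j s))"
      using near[OF \<beta>]
    proof eventually_elim
      case (elim s)
      have "classical_derivs 4 L (\<lambda>j x. inverse (s - \<beta>) * (1 * \<gamma> j s x + (-1) * \<gamma> j \<beta> x) + (-1) * D j \<beta> x)"
        by (intro classical_derivs_lincomb \<gamma> \<delta> elim \<beta>)
      then have c: "classical_derivs 4 L (\<lambda>j x. ?R j s x)" by simp
      have "sobolev_norm 4 L (\<lambda>x. ?R 0 s x) \<le> sqrt L * (\<Sum>j\<le>4. norm (?R j s))"
        by (rule sobolev_norm_le[OF L c]) (use norm_bounded in \<open>metis real_norm_def\<close>)
      then show ?case using norm0 by (simp add: divide_inverse mult.commute)
    qed
    then show "((\<lambda>s. sobolev_norm 4 L (\<lambda>x. ((u x + \<gamma> 0 s x) - (u x + \<gamma> 0 \<beta> x)) / (s - \<beta>) - D 0 \<beta> x)) \<longlongrightarrow> 0) (at \<beta>)"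
      by (rule Lim_null_comparison[OF _ lim])
    have "((\<lambda>s. sqrt L * (\<Sum>j\<le>4. norm (D j s - D j \<beta>))) \<longlongrightarrow> sqrt L * (\<Sum>j\<le>(4::nat). norm (0 :: real \<Rightarrow>\<^sub>C real))) (at \<beta>)"
    proof (intro tendsto_intros)
      fix j :: nat assume "j \<in> {..4}"
      then have "isCont (D j) \<beta>"
        using cD[of j] \<beta> by (simp add: continuous_on_eq_continuous_at)
      then show "((\<lambda>s. D j s - D j \<beta>) \<longlongrightarrow> 0) (at \<beta>)" by (simp add: isCont_def LIM_zero)
    qed
    then have lim': "((\<lambda>s. sqrt L * (\<Sum>j\<le>4. norm (D j s - D j \<beta>))) \<longlongrightarrow> 0) (at \<beta>)" by simp
    have "\<forall>\<^sub>F s in at \<beta>. norm (sobolev_norm 4 L (\<lambda>x. D 0 s x - D 0 \<beta> x)) \<le> sqrt L * (\<Sum>j\<le>4. norm (D j s - D j \<beta>))"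
      using near[OF \<beta>]
    proof eventually_elim
      case (elim s)
      have "classical_derivs 4 L (\<lambda>j x. 1 * D j s x + (-1) * D j \<beta> x)"
        by (intro classical_derivs_lincomb \<delta> elim \<beta>)
      then have c: "classical_derivs 4 L (\<lambda>j x. (D j s - D j \<beta>) x)" by simp
      have "sobolev_norm 4 L (\<lambda>x. (D 0 s - D 0 \<beta>) x) \<le> sqrt L * (\<Sum>j\<le>4. norm (D j s - D j \<beta>))"
        by (rule sobolev_norm_le[OF L c]) (use norm_bounded in \<open>metis real_norm_def\<close>)
      then show ?case using norm0 by simp
    qed
    then show "((\<lambda>s. sobolev_norm 4 L (\<lambda>x. D 0 s x - D 0 \<beta> x)) \<longlongrightarrow> 0) (at \<beta>)"
      by (rule Lim_null_comparison[OF _ lim'])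
  qed
qed

text \<open>Differentiability at 0 of the five curves gives a linear bound near 0. The interval may
  shrink, since the \<beta>-derivative need not stay bounded towards the ends of the original
  one.\<close>

lemma C1_curve_sobolev_norm_bound:
  fixes \<gamma> :: "nat \<Rightarrow> real \<Rightarrow> (real \<Rightarrow>\<^sub>C real)"
  assumes L: "0 < L" and b: "0 < b"
    and \<gamma>: "\<And>\<beta>. \<beta> \<in> {-b<..<b} \<Longrightarrow> classical_derivs 4 L (\<lambda>j. \<gamma> j \<beta>)"
    and C1: "\<And>j. j \<le> 4 \<Longrightarrow> \<gamma> j C1_differentiable_on {-b<..<b}"
    and \<gamma>0: "\<gamma> 0 0 = 0"
  obtains b' C where "0 < b'" "b' \<le> b" "0 < C"
    "\<And>\<beta>. \<beta> \<in> {-b'<..<b'} \<Longrightarrow> sobolev_norm 4 L (\<gamma> 0 \<beta>) \<le> C * \<bar>\<beta>\<bar>"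
proof -
  have "\<exists>N. \<forall>\<^sub>F \<beta> in nhds 0. norm (\<gamma> j \<beta> - \<gamma> j 0) \<le> N * \<bar>\<beta>\<bar>" if j: "j \<le> 4" for j
  proof -
    obtain d where "(\<gamma> j has_vector_derivative d) (at 0)"
      using C1[OF j] b unfolding C1_differentiable_on_def by force
    then obtain e where e: "0 < e" "\<And>\<beta>. \<bar>\<beta>\<bar> < e \<Longrightarrow> norm (\<gamma> j \<beta> - \<gamma> j 0 - \<beta> *\<^sub>R d) \<le> \<bar>\<beta>\<bar>"
      unfolding has_vector_derivative_def has_derivative_at_alt
      by (metis diff_zero mult_1 real_norm_def zero_less_one)
    have "norm (\<gamma> j \<beta> - \<gamma> j 0) \<le> (1 + norm d) * \<bar>\<beta>\<bar>" if "\<bar>\<beta>\<bar> < e" for \<beta>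
      using e(2)[OF that] norm_triangle_sub[of "\<gamma> j \<beta> - \<gamma> j 0" "\<beta> *\<^sub>R d"] by (simp add: algebra_simps)
    then show ?thesis using e(1) unfolding eventually_nhds_metric
      by (intro exI[of _ "1 + norm d"] exI[of _ e]) (auto simp: dist_real_def)
  qed
  then have "\<forall>j. \<exists>N. j \<le> 4 \<longrightarrow> (\<forall>\<^sub>F \<beta> in nhds 0. norm (\<gamma> j \<beta> - \<gamma> j 0) \<le> N * \<bar>\<beta>\<bar>)" by blast
  from choice[OF this] obtain N where
    N: "\<And>j. j \<le> 4 \<Longrightarrow> \<forall>\<^sub>F \<beta> in nhds 0. norm (\<gamma> j \<beta> - \<gamma> j 0) \<le> N j * \<bar>\<beta>\<bar>" by blast
  have "\<forall>\<^sub>F \<beta> in nhds 0. \<forall>j\<in>{..4}. norm (\<gamma> j \<beta> - \<gamma> j 0) \<le> N j * \<bar>\<beta>\<bar>"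
    by (rule eventually_ball_finite) (use N in auto)
  then obtain e where e: "0 < e" "\<And>\<beta> j. \<bar>\<beta>\<bar> < e \<Longrightarrow> j \<le> 4 \<Longrightarrow> norm (\<gamma> j \<beta> - \<gamma> j 0) \<le> N j * \<bar>\<beta>\<bar>"
    unfolding eventually_nhds_metric by (auto simp: dist_real_def)
  \<comment> \<open>The summand 1 only ensures that the constant is positive.\<close>
  define C where "C = sqrt L * (\<Sum>j\<le>4. \<bar>N j\<bar>) + 1"
  show thesis
  proof (rule that[of "min b e" C])
    show "0 < C" unfolding C_def using L by (intro add_nonneg_pos mult_nonneg_nonneg sum_nonneg) auto
    fix \<beta> assume \<beta>: "\<beta> \<in> {- min b e<..<min b e}"
    have "classical_derivs 4 L (\<lambda>j x. 1 * \<gamma> j \<beta> x + (-1) * \<gamma> j 0 x)"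
      using \<beta> b by (intro classical_derivs_lincomb \<gamma>) auto
    then have c: "classical_derivs 4 L (\<lambda>j x. (\<gamma> j \<beta> - \<gamma> j 0) x)" by simp
    have "sobolev_norm 4 L (\<lambda>x. (\<gamma> 0 \<beta> - \<gamma> 0 0) x) \<le> sqrt L * (\<Sum>j\<le>4. \<bar>N j\<bar> * \<bar>\<beta>\<bar>)"
    proof (rule sobolev_norm_le[OF L c])
      fix j x assume "j \<le> (4::nat)"
      have "\<bar>(\<gamma> j \<beta> - \<gamma> j 0) x\<bar> \<le> norm (\<gamma> j \<beta> - \<gamma> j 0)" by (metis norm_bounded real_norm_def)
      also have "\<dots> \<le> N j * \<bar>\<beta>\<bar>" using e(2)[of \<beta> j] \<beta> \<open>j \<le> 4\<close> by auto
      also have "\<dots> \<le> \<bar>N j\<bar> * \<bar>\<beta>\<bar>" by (intro mult_right_mono) auto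
      finally show "\<bar>(\<gamma> j \<beta> - \<gamma> j 0) x\<bar> \<le> \<bar>N j\<bar> * \<bar>\<beta>\<bar>" .
    qed
    also have "\<dots> \<le> C * \<bar>\<beta>\<bar>" by (simp add: C_def sum_distrib_right[symmetric] distrib_right mult.assoc)
    finally show "sobolev_norm 4 L (\<gamma> 0 \<beta>) \<le> C * \<bar>\<beta>\<bar>" by (simp add: \<gamma>0)
  qed (use b e in auto)
qed

section \<open>Steady states\<close>

lemma all_le_4: "(\<forall>j\<le>4. P j) \<longleftrightarrow> P 0 \<and> P 1 \<and> P 2 \<and> P 3 \<and> P (4::nat)"
  by (auto simp: numeral_eq_Suc le_Suc_eq)

lemma all_less_4: "(\<forall>j<4. P j) \<longleftrightarrow> P 0 \<and> P 1 \<and> P 2 \<and> P (3::nat)"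
  by (auto simp: numeral_eq_Suc less_Suc_eq)

lemma classical_derivs_4:
  "classical_derivs 4 L F \<longleftrightarrow> (\<forall>x\<in>{0..L}.
     (F 0 has_real_derivative F 1 x) (at x within {0..L}) \<and>
     (F 1 has_real_derivative F 2 x) (at x within {0..L}) \<and>
     (F 2 has_real_derivative F 3 x) (at x within {0..L}) \<and>
     (F 3 has_real_derivative F 4 x) (at x within {0..L})) \<and> continuous_on {0..L} (F 4)"
  unfolding classical_derivs_def all_less_4 by (simp add: ball_conj_distrib eval_nat_numeral)

text \<open>Here \<open>weak_second_deriv_zero\<close> is applied with the potential
  \<open>mu\<close> and the cubic reaction term plus \<zeta>; its conclusion g2 = p is the classical
  equation.\<close>

lemma steady_state_rep:
  assumes L: "0 < L"
    and \<zeta>: "\<And>x. x \<in> {0..L} \<Longrightarrow> (\<zeta> has_real_derivative \<zeta>1 x) (at x within {0..L})"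
      "\<And>x. x \<in> {0..L} \<Longrightarrow> (\<zeta>1 has_real_derivative \<zeta>2 x) (at x within {0..L})"
      "continuous_on {0..L} \<zeta>2"
    and u: "u \<in> X_space c0 \<zeta> L" and F0: "ae_eq L (F_op c0 \<zeta> L u 0) (\<lambda>x. 0)"
  obtains g0 g1 where "ae_eq L u g0" "g0 0 = 0" "g1 L = 0"
    "\<And>x. x \<in> {0..L} \<Longrightarrow> (g0 has_real_derivative g1 x) (at x within {0..L})"
    "\<And>x. x \<in> {0..L} \<Longrightarrow>
      (g1 has_real_derivative (g0 x + c0) ^ 3 - (g0 x + c0) + \<zeta> x) (at x within {0..L})"
proof -
  have u4: "u \<in> sobolev 4 L" and bc: "trace_at L u 0 = 0" "trace_at L (wderiv L 1 u) L = 0"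
    "trace_at L (mu c0 \<zeta> L u) 0 = 0" "trace_at L (wderiv L 1 (mu c0 \<zeta> L u)) L = 0"
    using u by (auto simp: X_space_def)
  obtain g0 g1 g2 g3 v4 where g: "ae_eq L u g0"
    "\<And>x. x \<in> {0..L} \<Longrightarrow> (g0 has_real_derivative g1 x) (at x within {0..L})"
    "\<And>x. x \<in> {0..L} \<Longrightarrow> (g1 has_real_derivative g2 x) (at x within {0..L})"
    "\<And>x. x \<in> {0..L} \<Longrightarrow> (g2 has_real_derivative g3 x) (at x within {0..L})"
    "continuous_on {0..L} g3" "v4 \<in> L2 L" "weak_deriv L 1 g3 v4"
    by (rule sobolev_4_rep[OF L u4]) (rule that)
  have um: "u \<in> borel_measurable (ivl L)" using u4 by (simp add: sobolev_def L2_def)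
  have c0: "continuous_on {0..L} g0" using g(2) by (rule DERIV_continuous_on)
  have c1: "continuous_on {0..L} g1" using g(3) by (rule DERIV_continuous_on)
  have c2: "continuous_on {0..L} g2" using g(4) by (rule DERIV_continuous_on)
  have c\<zeta>: "continuous_on {0..L} \<zeta>" using \<zeta>(1) by (rule DERIV_continuous_on)
  have "classical_derivs 2 L (\<lambda>j. [g0, g1, g2] ! j)"
    using g(2,3) c2 by (auto simp: classical_derivs_def numeral_2_eq_2 less_Suc_eq)
  note S = classical_derivs_sobolev[OF L this um, simplified nth_Cons_0, OF g(1)]
  have w1: "ae_eq L (wderiv L 1 u) g1" using S(4)[of 1] by simp
  have w2: "ae_eq L (wderiv L 2 u) g2" using S(4)[of 2] by simp
  have w2m: "wderiv L 2 u \<in> borel_measurable (ivl L)" using L2_measurable[OF S(2)[of 2]] by simp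
  let ?p = "\<lambda>x. (g0 x + c0) ^ 3 - (g0 x + c0) + \<zeta> x"
  let ?p1 = "\<lambda>x. 3 * (g0 x + c0)\<^sup>2 * g1 x - g1 x + \<zeta>1 x"
  let ?p2 = "\<lambda>x. 6 * (g0 x + c0) * g1 x * g1 x + 3 * (g0 x + c0)\<^sup>2 * g2 x - g2 x + \<zeta>2 x"
  have mm: "mu c0 \<zeta> L u \<in> borel_measurable (ivl L)"
    unfolding mu_def using um w2m continuous_measurable_ivl[OF c\<zeta>] by measurable
  have ma: "ae_eq L (mu c0 \<zeta> L u) (\<lambda>x. ?p x - g2 x)"
    using w2 g(1) unfolding ae_eq_def mu_def by eventually_elim simp
  have eq: "ae_eq L (wderiv L 2 (mu c0 \<zeta> L u)) (\<lambda>x. 0)" using F0 by (simp add: F_op_def)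
  have g2p: "g2 x = ?p x" if "x \<in> {0..L}" for x
  proof (rule weak_second_deriv_zero[OF L mm ma g(4-7) _ _ _ bc(3,4) eq that])
    show "(?p has_real_derivative ?p1 x) (at x within {0..L})" if "x \<in> {0..L}" for x
      using that by (auto intro!: derivative_eq_intros g \<zeta> simp: algebra_simps)
    show "(?p1 has_real_derivative ?p2 x) (at x within {0..L})" if "x \<in> {0..L}" for x
      using that by (auto intro!: derivative_eq_intros g \<zeta> simp: algebra_simps)
    show "continuous_on {0..L} ?p2" by (intro continuous_intros c0 c1 c2 \<zeta>)
  qed
  show thesis
  proof (rule that[OF g(1) _ _ g(2)])
    show "g0 0 = 0" using trace_at_eq[OF L c0 ae_eq_sym[OF g(1)], of 0] bc(1) L by simp
    show "g1 L = 0" using trace_at_eq[OF L c1 ae_eq_sym[OF w1], of L] bc(2) L by simp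
    show "(g1 has_real_derivative ?p x) (at x within {0..L})" if "x \<in> {0..L}" for x
      using g(3)[OF that] g2p[OF that] by simp
  qed
qed

text \<open>The same reduction for the linearized potential. Its coefficient contains
  \<open>u\<close> itself, which is first replaced almost everywhere by the smooth
  \<open>g0\<close>.\<close>

lemma lin_op_kernel:
  assumes L: "0 < L" and um: "u \<in> borel_measurable (ivl L)" and ug: "ae_eq L u g0"
    and g: "\<And>x. x \<in> {0..L} \<Longrightarrow> (g0 has_real_derivative g1 x) (at x within {0..L})"
      "\<And>x. x \<in> {0..L} \<Longrightarrow> (g1 has_real_derivative g2 x) (at x within {0..L})"
      "continuous_on {0..L} g2"
    and trivial: "trivial_bvp L (\<lambda>x. 3 * (g0 x + c0)\<^sup>2 - 1)"
    and h: "h \<in> lin_dom c0 L u" and eq: "ae_eq L (lin_op c0 L u h) (\<lambda>x. 0)"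
  shows "ae_eq L h (\<lambda>x. 0)"
proof -
  have h4: "h \<in> sobolev 4 L" and bc: "trace_at L h 0 = 0" "trace_at L (wderiv L 1 h) L = 0"
    "trace_at L (lin_mu c0 L u h) 0 = 0" "trace_at L (wderiv L 1 (lin_mu c0 L u h)) L = 0"
    using h by (auto simp: lin_dom_def)
  obtain h0 h1 h2 h3 v4 where k: "ae_eq L h h0"
    "\<And>x. x \<in> {0..L} \<Longrightarrow> (h0 has_real_derivative h1 x) (at x within {0..L})"
    "\<And>x. x \<in> {0..L} \<Longrightarrow> (h1 has_real_derivative h2 x) (at x within {0..L})"
    "\<And>x. x \<in> {0..L} \<Longrightarrow> (h2 has_real_derivative h3 x) (at x within {0..L})"
    "continuous_on {0..L} h3" "v4 \<in> L2 L" "weak_deriv L 1 h3 v4"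
    by (rule sobolev_4_rep[OF L h4]) (rule that)
  have hm: "h \<in> borel_measurable (ivl L)" using h4 by (simp add: sobolev_def L2_def)
  have c: "continuous_on {0..L} g0" using g(1) by (rule DERIV_continuous_on)
  have c': "continuous_on {0..L} g1" using g(2) by (rule DERIV_continuous_on)
  have ch0: "continuous_on {0..L} h0" using k(2) by (rule DERIV_continuous_on)
  have ch1: "continuous_on {0..L} h1" using k(3) by (rule DERIV_continuous_on)
  have ch2: "continuous_on {0..L} h2" using k(4) by (rule DERIV_continuous_on)
  have "classical_derivs 2 L (\<lambda>j. [h0, h1, h2] ! j)"
    using k(2,3) ch2 by (auto simp: classical_derivs_def numeral_2_eq_2 less_Suc_eq)
  note S = classical_derivs_sobolev[OF L this hm, simplified nth_Cons_0, OF k(1)]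
  have w1: "ae_eq L (wderiv L 1 h) h1" using S(4)[of 1] by simp
  have w2: "ae_eq L (wderiv L 2 h) h2" using S(4)[of 2] by simp
  have w2m: "wderiv L 2 h \<in> borel_measurable (ivl L)" using L2_measurable[OF S(2)[of 2]] by simp
  let ?p = "\<lambda>x. (3 * (g0 x + c0)\<^sup>2 - 1) * h0 x"
  let ?p1 = "\<lambda>x. 6 * (g0 x + c0) * g1 x * h0 x + (3 * (g0 x + c0)\<^sup>2 - 1) * h1 x"
  let ?p2 = "\<lambda>x. 6 * g1 x * g1 x * h0 x + 6 * (g0 x + c0) * g2 x * h0 x
    + 12 * (g0 x + c0) * g1 x * h1 x + (3 * (g0 x + c0)\<^sup>2 - 1) * h2 x"
  have mm: "lin_mu c0 L u h \<in> borel_measurable (ivl L)"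
    unfolding lin_mu_def using um w2m hm by measurable
  have ma: "ae_eq L (lin_mu c0 L u h) (\<lambda>x. ?p x - h2 x)"
    using w2 k(1) ug unfolding ae_eq_def lin_mu_def by eventually_elim simp
  have h2p: "h2 x = ?p x" if "x \<in> {0..L}" for x
  proof (rule weak_second_deriv_zero[OF L mm ma k(4-7) _ _ _ bc(3,4) _ that])
    show "(?p has_real_derivative ?p1 x) (at x within {0..L})" if "x \<in> {0..L}" for x
      using that by (auto intro!: derivative_eq_intros g k simp: algebra_simps)
    show "(?p1 has_real_derivative ?p2 x) (at x within {0..L})" if "x \<in> {0..L}" for x
      using that by (auto intro!: derivative_eq_intros g k simp: algebra_simps)
    show "continuous_on {0..L} ?p2" by (intro continuous_intros c c' g ch0 ch1 ch2)
    show "ae_eq L (wderiv L 2 (lin_mu c0 L u h)) (\<lambda>x. 0)" using eq by (simp add: lin_op_def)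
  qed
  have "(h1 has_real_derivative (3 * (g0 x + c0)\<^sup>2 - 1) * h0 x) (at x within {0..L})" if "x \<in> {0..L}" for x
    using k(3)[OF that] h2p[OF that] by simp
  moreover have "h0 0 = 0" using trace_at_eq[OF L ch0 ae_eq_sym[OF k(1)], of 0] bc(1) L by simp
  moreover have "h1 L = 0" using trace_at_eq[OF L ch1 ae_eq_sym[OF w1], of L] bc(2) L by simp
  ultimately have "h0 x = 0" if "x \<in> {0..L}" for x
    using trivial k(2) that unfolding trivial_bvp_def by blast
  then have "ae_eq L h0 (\<lambda>x. 0)" by (intro ae_eqI) auto
  with k(1) show ?thesis by (rule ae_eq_trans)
qed

text \<open>The way back to the weak formulation: a classical function \<open>m\<close> with m'' =
  \<beta> F 1 represents the potential, so its boundary values are the required traces.\<close>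

lemma steady_state_classical:
  assumes L: "0 < L" and F: "classical_derivs 4 L F"
    and w: "w \<in> borel_measurable (ivl L)" "ae_eq L w (F 0)"
    and c\<zeta>: "continuous_on {0..L} \<zeta>"
    and m: "\<And>x. x \<in> {0..L} \<Longrightarrow> - F 2 x + (F 0 x + c0) ^ 3 - (F 0 x + c0) + \<zeta> x = m x"
      "\<And>x. x \<in> {0..L} \<Longrightarrow> (m has_real_derivative m1 x) (at x within {0..L})"
      "\<And>x. x \<in> {0..L} \<Longrightarrow> (m1 has_real_derivative \<beta> * F 1 x) (at x within {0..L})"
    and bc: "F 0 0 = 0" "F 1 L = 0" "m 0 = 0" "m1 L = 0"
  shows "w \<in> X_space c0 \<zeta> L" "ae_eq L (F_op c0 \<zeta> L w \<beta>) (\<lambda>x. 0)"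
proof -
  note S = classical_derivs_sobolev[OF L F w]
  note C = classical_derivs_continuous[OF F]
  have w1: "ae_eq L (wderiv L 1 w) (F 1)" using S(4)[of 1] by simp
  have w2: "ae_eq L (wderiv L 2 w) (F 2)" using S(4)[of 2] by simp
  have w2m: "wderiv L 2 w \<in> borel_measurable (ivl L)" using L2_measurable[OF S(2)[of 2]] by simp
  have mm: "mu c0 \<zeta> L w \<in> borel_measurable (ivl L)"
    unfolding mu_def using w(1) w2m continuous_measurable_ivl[OF c\<zeta>] by measurable
  have eqm: "ae_eq L (\<lambda>x. - F 2 x + (F 0 x + c0) ^ 3 - (F 0 x + c0) + \<zeta> x) m"
    by (rule ae_eqI) (use m(1) in auto)
  have "ae_eq L (mu c0 \<zeta> L w) (\<lambda>x. - F 2 x + (F 0 x + c0) ^ 3 - (F 0 x + c0) + \<zeta> x)"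
    using w2 w(2) unfolding ae_eq_def mu_def by eventually_elim simp
  then have ma: "ae_eq L (mu c0 \<zeta> L w) m" using eqm by (rule ae_eq_trans)
  have cF1: "continuous_on {0..L} (F 1)" by (rule C) simp
  have cm: "continuous_on {0..L} m" using m(2) by (rule DERIV_continuous_on)
  have cm1: "continuous_on {0..L} m1" using m(3) by (rule DERIV_continuous_on)
  have M: "classical_derivs 2 L (\<lambda>j. [m, m1, \<lambda>x. \<beta> * F 1 x] ! j)"
    using m(2,3) cF1 by (auto simp: classical_derivs_def numeral_2_eq_2 less_Suc_eq intro!: continuous_intros)
  note SM = classical_derivs_sobolev[OF L M mm, simplified nth_Cons_0, OF ma]
  have a1: "ae_eq L (wderiv L 1 (mu c0 \<zeta> L w)) m1" using SM(4)[of 1] by simp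
  have a2: "ae_eq L (wderiv L 2 (mu c0 \<zeta> L w)) (\<lambda>x. \<beta> * F 1 x)" using SM(4)[of 2] by simp
  show "w \<in> X_space c0 \<zeta> L"
    unfolding X_space_def
    using S(1) L bc trace_at_eq[OF L C ae_eq_sym[OF w(2)], of 0] trace_at_eq[OF L cF1 ae_eq_sym[OF w1], of L]
      trace_at_eq[OF L cm ae_eq_sym[OF ma], of 0] trace_at_eq[OF L cm1 ae_eq_sym[OF a1], of L]
    by simp
  show "ae_eq L (F_op c0 \<zeta> L w \<beta>) (\<lambda>x. 0)"
    using a2 w1 unfolding ae_eq_def F_op_def by eventually_elim simp
qed

text \<open>With v = g0 + c0, expanding (v + h)^3 - (v + h) leaves (3 v^2 - 1) h + 3 v h^2 + h^3
  beyond the terms of the steady state itself. The linear part goes into the Green operator, the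
  rest into \<open>N\<close>.\<close>

lemma steady_branch:
  fixes g0 g1 p :: "real \<Rightarrow> real" and c0 L :: real
  assumes L: "0 < L"
    and g: "\<And>x. x \<in> {0..L} \<Longrightarrow> (g0 has_real_derivative g1 x) (at x within {0..L})"
      "\<And>x. x \<in> {0..L} \<Longrightarrow> (g1 has_real_derivative p x) (at x within {0..L})"
      "continuous_on {0..L} p"
    and trivial: "trivial_bvp L (\<lambda>x. 3 * (g0 x + c0)\<^sup>2 - 1)"
  obtains b and \<gamma> :: "nat \<Rightarrow> real \<Rightarrow> (real \<Rightarrow>\<^sub>C real)" where "0 < b" "\<gamma> 0 0 = 0"
    "\<And>j. j \<le> 4 \<Longrightarrow> \<gamma> j C1_differentiable_on {-b<..<b}"
    "\<And>\<beta>. \<beta> \<in> {-b<..<b} \<Longrightarrow> classical_derivs 4 L (\<lambda>j. \<gamma> j \<beta>)"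
    "\<And>\<beta>. \<beta> \<in> {-b<..<b} \<Longrightarrow> \<gamma> 0 \<beta> 0 = 0 \<and> \<gamma> 1 \<beta> L = 0"
    "\<And>\<beta> x. \<beta> \<in> {-b<..<b} \<Longrightarrow> x \<in> {0..L} \<Longrightarrow>
      \<gamma> 2 \<beta> x = (3 * (g0 x + c0)\<^sup>2 - 1) * \<gamma> 0 \<beta> x
        - (\<beta> * (integral {0..x} (\<lambda>s. g0 s + \<gamma> 0 \<beta> s) - (g0 L + \<gamma> 0 \<beta> L) * x)
           - 3 * (g0 x + c0) * (\<gamma> 0 \<beta> x)\<^sup>2 - (\<gamma> 0 \<beta> x) ^ 3)"
proof -
  have L0: "0 \<le> L" and memL: "0 \<in> {0..L}" "L \<in> {0..L}" using L by auto
  have cg0 [simp]: "continuous_on {0..L} g0" using g(1) by (rule DERIV_continuous_on)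
  have cg1 [simp]: "continuous_on {0..L} g1" using g(2) by (rule DERIV_continuous_on)
  note [simp] = g(3)
  let ?q = "\<lambda>x. 3 * (g0 x + c0)\<^sup>2 - 1"
  have cq [simp]: "continuous_on {0..L} ?q" by (intro continuous_intros cg0)
  obtain G G' :: "(real \<Rightarrow>\<^sub>C real) \<Rightarrow> (real \<Rightarrow>\<^sub>C real)" where G: "bounded_linear G" "bounded_linear G'"
    "\<And>f. G f 0 = 0" "\<And>f. G' f L = 0"
    "\<And>f x. x \<in> {0..L} \<Longrightarrow> (apply_bcontfun (G f) has_real_derivative G' f x) (at x within {0..L})"
    "\<And>f x. x \<in> {0..L} \<Longrightarrow> (apply_bcontfun (G' f) has_real_derivative ?q x * G f x - f x) (at x within {0..L})"
    by (rule green_operator[OF L cq trivial]) (rule that)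
  let ?J = "prim_bcontfun L" and ?E = "ext_bcontfun L"
  define U V U1 U2 Q X where "U = ?E g0" and "V = ?E (\<lambda>x. g0 x + c0)" and "U1 = ?E g1" and "U2 = ?E p"
    and "Q = ?E ?q" and "X = ?E (\<lambda>x. x)"
  have ev: "U x = g0 x" "V x = g0 x + c0" "U1 x = g1 x" "U2 x = p x" "Q x = ?q x" "X x = x" if "x \<in> {0..L}" for x
    unfolding U_def V_def U1_def U2_def Q_def X_def using that
    by (auto intro!: apply_ext_bcontfun_mem continuous_intros)
  \<comment> \<open>\<open>T f\<close> vanishes at 0 and has slope f x - f L, hence zero slope at L:
    both boundary conditions of the potential.\<close>
  define T where "T f = ?J f - f L *\<^sub>R X" for f
  have T: "bounded_linear T"
    unfolding T_def[abs_def]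
    by (intro bounded_linear_sub bounded_linear_prim_bcontfun[OF L0]
        bounded_linear_compose[OF bounded_linear_scaleR_left bounded_linear_apply_bcontfun])
  define N where "N \<beta> h = \<beta> *\<^sub>R T (U + h) - 3 *\<^sub>R (V * (h * h)) - h * (h * h)" for \<beta> h
  define H where "H \<beta> h = G (N \<beta> h)" for \<beta> h
  define q where "q h = G (T (U + h))" for h
  \<comment> \<open>The products are left as h k + k h because the algebra class does not assume
    commutativity.\<close>
  define A where "A \<beta> h k = G (\<beta> *\<^sub>R T k - 3 *\<^sub>R (V * (h * k + k * h)) - (h * (h * k + k * h) + k * (h * h)))" for \<beta> h k
  note linG = bounded_linear.linear[OF G(1)] and linT = bounded_linear.linear[OF T]
  have DN: "((\<lambda>p. N (fst p) (snd p)) has_derivative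
      (\<lambda>p'. (\<beta> *\<^sub>R T (snd p') + fst p' *\<^sub>R T (U + h)) - 3 *\<^sub>R (V * (h * snd p' + snd p' * h))
        - (h * (h * snd p' + snd p' * h) + snd p' * (h * h)))) (at (\<beta>, h))" for \<beta> h
    unfolding N_def
    by (rule derivative_eq_intros bounded_linear.has_derivative[OF T] refl | simp)+
  have DH: "((\<lambda>(\<beta>, h). H \<beta> h) has_derivative (\<lambda>(s, k). s *\<^sub>R q h + A \<beta> h k)) (at (\<beta>, h))" for \<beta> h
  proof -
    have "((\<lambda>p. G (N (fst p) (snd p))) has_derivative (\<lambda>p'. G ((\<beta> *\<^sub>R T (snd p') + fst p' *\<^sub>R T (U + h))
        - 3 *\<^sub>R (V * (h * snd p' + snd p' * h)) - (h * (h * snd p' + snd p' * h) + snd p' * (h * h))))) (at (\<beta>, h))"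
      by (rule bounded_linear.has_derivative[OF G(1) DN])
    moreover have "G ((\<beta> *\<^sub>R T (snd p') + fst p' *\<^sub>R T (U + h))
        - 3 *\<^sub>R (V * (h * snd p' + snd p' * h)) - (h * (h * snd p' + snd p' * h) + snd p' * (h * h)))
        = fst p' *\<^sub>R q h + A \<beta> h (snd p')" for p'
      unfolding q_def A_def by (simp add: linear_scale[OF linG, symmetric] linear_add[OF linG, symmetric] algebra_simps)
    ultimately show ?thesis by (simp add: H_def case_prod_unfold)
  qed
  obtain KG where KG: "0 < KG" "\<And>f. norm (G f) \<le> norm f * KG" using bounded_linear.pos_bounded[OF G(1)] by blast
  obtain KT where KT: "0 < KT" "\<And>f. norm (T f) \<le> norm f * KT" using bounded_linear.pos_bounded[OF T] by blast
  \<comment> \<open>The \<beta>-term and the nonlinear terms each get half of the contraction budget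
    1/2: \<open>b0\<close> cancels KG KT, and \<open>r\<close> cancels KG (6 |V| + 3). The cap r
    \<le> 1 lets norm h ^ 2 be bounded by r.\<close>
  define b0 r where "b0 = 1 / (4 * KG * KT)" and "r = min 1 (1 / (4 * KG * (6 * norm V + 3)))"
  have b0: "0 < b0" and r: "0 < r" "r \<le> 1"
    using KG KT by (auto simp: b0_def r_def add_nonneg_pos)
  have rK: "KG * ((6 * norm V + 3) * r) \<le> 1 / 4"
  proof -
    have "0 < 4 * KG * (6 * norm V + 3)" using KG by (simp add: add_nonneg_pos)
    then have "r * (4 * KG * (6 * norm V + 3)) \<le> 1"
      using min.cobounded2[of 1 "1 / (4 * KG * (6 * norm V + 3))"] unfolding r_def[symmetric]
      by (simp add: pos_le_divide_eq)
    then show ?thesis by (simp add: algebra_simps)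
  qed
  have contr: "norm (A \<beta> h k) \<le> norm k / 2" if \<beta>: "\<bar>\<beta>\<bar> \<le> b0" and h: "norm h \<le> r" for \<beta> h k
  proof -
    have hk: "norm (h * k + k * h) \<le> 2 * r * norm k"
    proof -
      have "norm (h * k) \<le> norm h * norm k" "norm (k * h) \<le> norm k * norm h" by (rule norm_mult_ineq)+
      moreover have "norm h * norm k \<le> r * norm k" using h by (intro mult_right_mono) auto
      ultimately show ?thesis
        using norm_triangle_ineq[of "h * k" "k * h"] mult.commute[of "norm k" "norm h"] by linarith
    qed
    have 1: "norm (\<beta> *\<^sub>R T k) \<le> b0 * KT * norm k"
    proof -
      have "\<bar>\<beta>\<bar> * norm (T k) \<le> b0 * (norm k * KT)" using \<beta> KT b0 by (intro mult_mono) auto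
      then show ?thesis by (simp add: mult_ac)
    qed
    have 2: "norm (3 *\<^sub>R (V * (h * k + k * h))) \<le> 6 * norm V * r * norm k"
    proof -
      have "norm (V * (h * k + k * h)) \<le> norm V * (2 * r * norm k)"
        by (rule order_trans[OF norm_mult_ineq]) (intro mult_left_mono hk norm_ge_zero)
      then show ?thesis by (simp add: mult_ac)
    qed
    have 3: "norm (h * (h * k + k * h) + k * (h * h)) \<le> 3 * r * norm k"
    proof -
      have "norm (h * (h * k + k * h)) \<le> norm h * (2 * r * norm k)"
        by (rule order_trans[OF norm_mult_ineq]) (intro mult_left_mono hk norm_ge_zero)
      also have "\<dots> \<le> 1 * (2 * r * norm k)" using h r by (intro mult_right_mono) auto
      finally have a: "norm (h * (h * k + k * h)) \<le> 2 * r * norm k" by simp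
      have "norm (h * h) \<le> norm h * norm h" by (rule norm_mult_ineq)
      also have "\<dots> \<le> r * 1" using h r by (intro mult_mono) auto
      finally have "norm k * norm (h * h) \<le> norm k * r" by (intro mult_left_mono) auto
      then have "norm (k * (h * h)) \<le> r * norm k"
        using norm_mult_ineq[of k "h * h"] by (simp add: mult.commute)
      with a show ?thesis using norm_triangle_ineq[of "h * (h * k + k * h)" "k * (h * h)"] by linarith
    qed
    have "norm (\<beta> *\<^sub>R T k - 3 *\<^sub>R (V * (h * k + k * h)) - (h * (h * k + k * h) + k * (h * h)))
        \<le> b0 * KT * norm k + 6 * norm V * r * norm k + 3 * r * norm k"
      using 1 2 3 norm_triangle_ineq4[of "\<beta> *\<^sub>R T k - 3 *\<^sub>R (V * (h * k + k * h))" "h * (h * k + k * h) + k * (h * h)"]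
        norm_triangle_ineq4[of "\<beta> *\<^sub>R T k" "3 *\<^sub>R (V * (h * k + k * h))"] by linarith
    then have "norm (A \<beta> h k) \<le> (b0 * KT * norm k + 6 * norm V * r * norm k + 3 * r * norm k) * KG"
      unfolding A_def using KG by (intro order_trans[OF KG(2)] mult_right_mono) auto
    also have "\<dots> = (b0 * KT * KG) * norm k + (KG * ((6 * norm V + 3) * r)) * norm k"
      by (simp add: algebra_simps)
    also have "\<dots> \<le> 1 / 4 * norm k + 1 / 4 * norm k"
      using KG KT by (intro add_mono mult_right_mono rK) (auto simp: b0_def)
    finally show ?thesis by simp
  qed
  have H0: "H 0 0 = 0" by (simp add: H_def N_def linear_0[OF linG])
  have cont_q: "continuous_on UNIV (\<lambda>(\<beta>, h). q h)"
    unfolding q_def case_prod_beta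
    by (intro bounded_linear.continuous_on[OF G(1)] bounded_linear.continuous_on[OF T] continuous_intros)
  have cont_A: "continuous_on UNIV (\<lambda>(\<beta>, h). A \<beta> h k)" for k
    unfolding A_def case_prod_beta
    by (intro bounded_linear.continuous_on[OF G(1)] continuous_intros)
  obtain b \<sigma> where b: "0 < b" "b \<le> b0" and \<sigma>0: "\<sigma> 0 = 0" and C\<sigma>: "\<sigma> C1_differentiable_on {-b<..<b}"
    and \<sigma>: "\<And>\<beta>. \<bar>\<beta>\<bar> < b \<Longrightarrow> H \<beta> (\<sigma> \<beta>) = \<sigma> \<beta>"
    by (rule fixed_point_branch[where q="\<lambda>_. q", OF H0 DH cont_q cont_A b0 r(1) contr]) (assumption | rule that)+
  define n where "n \<beta> = N \<beta> (\<sigma> \<beta>)" for \<beta>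
  define \<gamma>1 where "\<gamma>1 \<beta> = G' (n \<beta>)" for \<beta>
  \<comment> \<open>Read off from the differential equation of the Green operator, not by
    differentiating; the next two orders differentiate this expression in x. All are polynomial in
    curves already known to be C^1, so they are C^1 in \<beta>.\<close>
  define \<gamma>2 where "\<gamma>2 \<beta> = Q * \<sigma> \<beta> - n \<beta>" for \<beta>
  \<comment> \<open>Evaluation at L yields a scalar, put back as a constant function.\<close>
  define \<gamma>3 where "\<gamma>3 \<beta> = 6 *\<^sub>R (V * (U1 * \<sigma> \<beta>)) + Q * \<gamma>1 \<beta>
      - \<beta> *\<^sub>R (U + \<sigma> \<beta> - (U + \<sigma> \<beta>) L *\<^sub>R const_bcontfun 1)
      + 3 *\<^sub>R (U1 * (\<sigma> \<beta> * \<sigma> \<beta>)) + 6 *\<^sub>R (V * (\<sigma> \<beta> * \<gamma>1 \<beta>)) + 3 *\<^sub>R (\<sigma> \<beta> * (\<sigma> \<beta> * \<gamma>1 \<beta>))" for \<beta>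
  define \<gamma>4 where "\<gamma>4 \<beta> = 6 *\<^sub>R (U1 * (U1 * \<sigma> \<beta>)) + 6 *\<^sub>R (V * (U2 * \<sigma> \<beta>)) + 12 *\<^sub>R (V * (U1 * \<gamma>1 \<beta>))
      + Q * \<gamma>2 \<beta> - \<beta> *\<^sub>R (U1 + \<gamma>1 \<beta>)
      + 3 *\<^sub>R (U2 * (\<sigma> \<beta> * \<sigma> \<beta>)) + 12 *\<^sub>R (U1 * (\<sigma> \<beta> * \<gamma>1 \<beta>))
      + 6 *\<^sub>R (V * (\<gamma>1 \<beta> * \<gamma>1 \<beta>)) + 6 *\<^sub>R (V * (\<sigma> \<beta> * \<gamma>2 \<beta>))
      + 6 *\<^sub>R (\<sigma> \<beta> * (\<gamma>1 \<beta> * \<gamma>1 \<beta>)) + 3 *\<^sub>R (\<sigma> \<beta> * (\<sigma> \<beta> * \<gamma>2 \<beta>))" for \<beta>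
  define \<gamma> where "\<gamma> j = [\<sigma>, \<gamma>1, \<gamma>2, \<gamma>3, \<gamma>4] ! j" for j :: nat
  have \<gamma>_simps: "\<gamma> 0 = \<sigma>" "\<gamma> 1 = \<gamma>1" "\<gamma> 2 = \<gamma>2" "\<gamma> 3 = \<gamma>3" "\<gamma> 4 = \<gamma>4"
    by (simp_all add: \<gamma>_def)
  note C1 = C1_differentiable_on_add C1_differentiable_on_diff C1_differentiable_on_mult
    C1_differentiable_on_scaleR C1_differentiable_on_const C1_differentiable_on_ident
  have Cn: "n C1_differentiable_on {-b<..<b}"
    unfolding n_def[abs_def] N_def
    by (intro C1 C\<sigma> C1_differentiable_on_bounded_linear[OF T])
  have C\<gamma>1: "\<gamma>1 C1_differentiable_on {-b<..<b}"
    unfolding \<gamma>1_def[abs_def] by (rule C1_differentiable_on_bounded_linear[OF G(2) Cn])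
  have C\<gamma>2: "\<gamma>2 C1_differentiable_on {-b<..<b}"
    unfolding \<gamma>2_def[abs_def] by (intro C1 C\<sigma> Cn)
  have C\<gamma>3: "\<gamma>3 C1_differentiable_on {-b<..<b}"
    unfolding \<gamma>3_def[abs_def]
    by (intro C1 C\<sigma> C\<gamma>1 C1_differentiable_on_bounded_linear[OF bounded_linear_apply_bcontfun])
  have C\<gamma>4: "\<gamma>4 C1_differentiable_on {-b<..<b}"
    unfolding \<gamma>4_def[abs_def] by (intro C1 C\<sigma> C\<gamma>1 C\<gamma>2)
  have n_ev: "n \<beta> x = \<beta> * (?J (U + \<sigma> \<beta>) x - (U + \<sigma> \<beta>) L * x) - 3 * (g0 x + c0) * (\<sigma> \<beta> x * \<sigma> \<beta> x)
      - \<sigma> \<beta> x * (\<sigma> \<beta> x * \<sigma> \<beta> x)" if "x \<in> {0..L}" for \<beta> x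
    using that by (simp add: n_def N_def T_def ev mult.assoc)
  have D0: "(apply_bcontfun (\<sigma> \<beta>) has_real_derivative \<gamma>1 \<beta> x) (at x within {0..L})"
    if "\<bar>\<beta>\<bar> < b" "x \<in> {0..L}" for \<beta> x
    using G(5)[OF that(2), of "n \<beta>"] \<sigma>[OF that(1)] by (simp add: H_def n_def \<gamma>1_def)
  have D1: "(apply_bcontfun (\<gamma>1 \<beta>) has_real_derivative \<gamma>2 \<beta> x) (at x within {0..L})"
    if "\<bar>\<beta>\<bar> < b" "x \<in> {0..L}" for \<beta> x
    using G(6)[OF that(2), of "n \<beta>"] \<sigma>[OF that(1)] that(2) by (simp add: H_def n_def \<gamma>1_def \<gamma>2_def ev)
  have D2: "(apply_bcontfun (\<gamma>2 \<beta>) has_real_derivative \<gamma>3 \<beta> x) (at x within {0..L})"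
    if \<beta>: "\<bar>\<beta>\<bar> < b" and x: "x \<in> {0..L}" for \<beta> x
  proof -
    note D = D0[OF \<beta> x] g(1)[OF x] DERIV_prim_bcontfun[OF x, of "U + \<sigma> \<beta>"]
    have "((\<lambda>x. ?q x * \<sigma> \<beta> x - (\<beta> * (?J (U + \<sigma> \<beta>) x - (U + \<sigma> \<beta>) L * x)
        - 3 * (g0 x + c0) * (\<sigma> \<beta> x * \<sigma> \<beta> x) - \<sigma> \<beta> x * (\<sigma> \<beta> x * \<sigma> \<beta> x))) has_real_derivative \<gamma>3 \<beta> x) (at x within {0..L})"
      by (rule derivative_eq_intros D refl | simp)+
        (use x in \<open>simp add: \<gamma>3_def ev algebra_simps power2_eq_square\<close>)
    then show ?thesis
      by (rule has_real_derivative_transform[OF x, rotated]) (simp add: \<gamma>2_def n_ev ev)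
  qed
  have D3: "(apply_bcontfun (\<gamma>3 \<beta>) has_real_derivative \<gamma>4 \<beta> x) (at x within {0..L})"
    if \<beta>: "\<bar>\<beta>\<bar> < b" and x: "x \<in> {0..L}" for \<beta> x
  proof -
    note D = D0[OF \<beta> x] D1[OF \<beta> x] g(1)[OF x] g(2)[OF x]
    have "((\<lambda>x. 6 * ((g0 x + c0) * (g1 x * \<sigma> \<beta> x)) + ?q x * \<gamma>1 \<beta> x
      - \<beta> * (g0 x + \<sigma> \<beta> x - (U + \<sigma> \<beta>) L)
      + 3 * (g1 x * (\<sigma> \<beta> x * \<sigma> \<beta> x)) + 6 * ((g0 x + c0) * (\<sigma> \<beta> x * \<gamma>1 \<beta> x))
      + 3 * (\<sigma> \<beta> x * (\<sigma> \<beta> x * \<gamma>1 \<beta> x))) has_real_derivative \<gamma>4 \<beta> x) (at x within {0..L})"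
      by (rule derivative_eq_intros D refl | simp)+
        (use x in \<open>simp add: \<gamma>4_def ev algebra_simps power2_eq_square\<close>)
    then show ?thesis
      by (rule has_real_derivative_transform[OF x, rotated]) (simp add: \<gamma>3_def ev)
  qed
  show thesis
  proof (rule that[of b \<gamma>])
    show "\<gamma> 0 0 = 0" using \<sigma>0 by (simp add: \<gamma>_simps)
    have "\<forall>j\<le>4. \<gamma> j C1_differentiable_on {-b<..<b}"
      unfolding all_le_4 \<gamma>_simps using C\<sigma> C\<gamma>1 C\<gamma>2 C\<gamma>3 C\<gamma>4 by blast
    then show "\<gamma> j C1_differentiable_on {-b<..<b}" if "j \<le> 4" for j using that by blast
    fix \<beta> assume "\<beta> \<in> {-b<..<b}"
    then have \<beta>: "\<bar>\<beta>\<bar> < b" by auto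
    show "classical_derivs 4 L (\<lambda>j. \<gamma> j \<beta>)"
      unfolding classical_derivs_4 \<gamma>_simps using D0[OF \<beta>] D1[OF \<beta>] D2[OF \<beta>] D3[OF \<beta>] by auto
    show "\<gamma> 0 \<beta> 0 = 0 \<and> \<gamma> 1 \<beta> L = 0"
      unfolding \<gamma>_simps \<gamma>1_def using G(3)[of "n \<beta>"] G(4)[of "n \<beta>"] \<sigma>[OF \<beta>] by (simp add: H_def n_def)
    fix x assume x: "x \<in> {0..L}"
    have "?J (U + \<sigma> \<beta>) x = integral {0..x} (\<lambda>s. g0 s + \<sigma> \<beta> s)"
      unfolding apply_prim_bcontfun[OF x] using x by (intro integral_cong) (auto simp: ev)
    then show "\<gamma> 2 \<beta> x = ?q x * \<gamma> 0 \<beta> x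
        - (\<beta> * (integral {0..x} (\<lambda>s. g0 s + \<gamma> 0 \<beta> s) - (g0 L + \<gamma> 0 \<beta> L) * x)
           - 3 * (g0 x + c0) * (\<gamma> 0 \<beta> x)\<^sup>2 - (\<gamma> 0 \<beta> x) ^ 3)"
      unfolding \<gamma>_simps \<gamma>2_def using n_ev[OF x, of \<beta>] x memL
      by (simp add: ev power2_eq_square power3_eq_cube)
  qed (rule b)
qed

theorem theorem3p1:
  fixes c0 L :: real and \<zeta> u :: "real \<Rightarrow> real" and I :: "real set"
  assumes "open I" and "is_interval I" and "{0..} \<subseteq> I"
    and "real_analytic_on \<zeta> I"
    and "\<forall>x\<in>I. -1 < \<zeta> x \<and> \<zeta> x < 0"
    and "L > 0" and "L \<notin> E_set c0 \<zeta>"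
    and "u \<in> X_space c0 \<zeta> L"
    and "ae_eq L (F_op c0 \<zeta> L u 0) (\<lambda>x. 0)"
  shows "(\<forall>h \<in> lin_dom c0 L u. ae_eq L (lin_op c0 L u h) (\<lambda>x. 0) \<longrightarrow> ae_eq L h (\<lambda>x. 0)) \<and>
    (\<exists>b U. 0 < b \<and> b \<le> 1 \<and> C1_into_H4 L b U \<and> U 0 = u \<and>
       (\<forall>\<beta>\<in>{-b<..<b}. U \<beta> \<in> X_space c0 \<zeta> L \<and> ae_eq L (F_op c0 \<zeta> L (U \<beta>) \<beta>) (\<lambda>x. 0)) \<and>
       (\<exists>C>0. \<forall>\<beta>\<in>{-b<..<b}. sobolev_norm 4 L (\<lambda>x. U \<beta> x - u x) \<le> C * \<bar>\<beta>\<bar>))"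
proof -
  note L = \<open>L > 0\<close>
  have "{0..L} \<subseteq> I" using assms(3) by auto
  then obtain \<zeta>1 \<zeta>2 where \<zeta>: "\<And>x. x \<in> {0..L} \<Longrightarrow> (\<zeta> has_real_derivative \<zeta>1 x) (at x within {0..L})"
    "\<And>x. x \<in> {0..L} \<Longrightarrow> (\<zeta>1 has_real_derivative \<zeta>2 x) (at x within {0..L})"
    "continuous_on {0..L} \<zeta>2"
    by (rule real_analytic_on_C2[OF assms(4)]) (rule that)
  obtain g0 g1 where g: "ae_eq L u g0" "g0 0 = 0" "g1 L = 0"
    "\<And>x. x \<in> {0..L} \<Longrightarrow> (g0 has_real_derivative g1 x) (at x within {0..L})"
    "\<And>x. x \<in> {0..L} \<Longrightarrow>
      (g1 has_real_derivative (g0 x + c0) ^ 3 - (g0 x + c0) + \<zeta> x) (at x within {0..L})"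
    by (rule steady_state_rep[OF L \<zeta> assms(8,9)]) (assumption | rule that)+
  \<comment> \<open>\<open>p\<close>, \<open>p1\<close>, \<open>p2\<close> are the second, third and
    fourth derivatives of \<open>g0\<close>, obtained by differentiating its equation.\<close>
  define p where "p x = (g0 x + c0) ^ 3 - (g0 x + c0) + \<zeta> x" for x
  define p1 where "p1 x = 3 * (g0 x + c0)\<^sup>2 * g1 x - g1 x + \<zeta>1 x" for x
  define p2 where "p2 x = 6 * (g0 x + c0) * g1 x * g1 x + 3 * (g0 x + c0)\<^sup>2 * p x - p x + \<zeta>2 x" for x
  have g1': "(g1 has_real_derivative p x) (at x within {0..L})" if "x \<in> {0..L}" for x
    using g(5)[OF that] by (simp add: p_def)
  have Dp: "(p has_real_derivative p1 x) (at x within {0..L})" if "x \<in> {0..L}" for x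
    unfolding p_def[abs_def] p1_def using that by (auto intro!: derivative_eq_intros g(4) \<zeta> simp: algebra_simps)
  have Dp1: "(p1 has_real_derivative p2 x) (at x within {0..L})" if "x \<in> {0..L}" for x
    unfolding p1_def[abs_def] p2_def using that
    by (auto intro!: derivative_eq_intros g(4) g1' \<zeta> simp: algebra_simps)
  have cont: "continuous_on {0..L} g0" "continuous_on {0..L} g1" "continuous_on {0..L} p" "continuous_on {0..L} \<zeta>"
    by (rule DERIV_continuous_on, erule g(4) g1' Dp \<zeta>(1))+
  have cp2: "continuous_on {0..L} p2"
    unfolding p2_def[abs_def] by (intro continuous_intros cont \<zeta>(3))
  have um: "u \<in> borel_measurable (ivl L)" using assms(8) by (simp add: X_space_def sobolev_def L2_def)
  have trivial: "trivial_bvp L (\<lambda>x. 3 * (g0 x + c0)\<^sup>2 - 1)"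
    unfolding trivial_bvp_def
  proof (intro allI impI ballI)
    fix h h' x
    assume h: "\<forall>x\<in>{0..L}. (h has_real_derivative h' x) (at x within {0..L}) \<and>
        (h' has_real_derivative (3 * (g0 x + c0)\<^sup>2 - 1) * h x) (at x within {0..L})"
      "h 0 = 0" "h' L = 0" "x \<in> {0..L}"
    show "h x = 0"
      by (rule trivial_kernel_if_notin_E[OF L assms(7), where u=g0 and u'=g1 and h=h and h'=h'])
        (use g h in auto)
  qed
  have kernel: "ae_eq L h (\<lambda>x. 0)" if "h \<in> lin_dom c0 L u" "ae_eq L (lin_op c0 L u h) (\<lambda>x. 0)" for h
    by (rule lin_op_kernel[OF L um g(1) g(4) g1' cont(3) trivial that]) assumption+
  obtain b and \<gamma> :: "nat \<Rightarrow> real \<Rightarrow> (real \<Rightarrow>\<^sub>C real)" where b: "0 < b" and \<gamma>0: "\<gamma> 0 0 = 0"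
    and C1: "\<And>j. j \<le> 4 \<Longrightarrow> \<gamma> j C1_differentiable_on {-b<..<b}"
    and \<gamma>: "\<And>\<beta>. \<beta> \<in> {-b<..<b} \<Longrightarrow> classical_derivs 4 L (\<lambda>j. \<gamma> j \<beta>)"
    and \<gamma>bc: "\<And>\<beta>. \<beta> \<in> {-b<..<b} \<Longrightarrow> \<gamma> 0 \<beta> 0 = 0 \<and> \<gamma> 1 \<beta> L = 0"
    and \<gamma>2: "\<And>\<beta> x. \<beta> \<in> {-b<..<b} \<Longrightarrow> x \<in> {0..L} \<Longrightarrow>
      \<gamma> 2 \<beta> x = (3 * (g0 x + c0)\<^sup>2 - 1) * \<gamma> 0 \<beta> x
        - (\<beta> * (integral {0..x} (\<lambda>s. g0 s + \<gamma> 0 \<beta> s) - (g0 L + \<gamma> 0 \<beta> L) * x)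
           - 3 * (g0 x + c0) * (\<gamma> 0 \<beta> x)\<^sup>2 - (\<gamma> 0 \<beta> x) ^ 3)"
    by (rule steady_branch[OF L g(4) g1' cont(3) trivial]) (assumption | rule that)+
  \<comment> \<open>The perturbation is added to \<open>u\<close> and not to its smooth
    representative, so that U 0 = u holds as an equality of functions.\<close>
  define U where "U \<beta> x = u x + \<gamma> 0 \<beta> x" for \<beta> x
  have sol: "U \<beta> \<in> X_space c0 \<zeta> L" "ae_eq L (F_op c0 \<zeta> L (U \<beta>) \<beta>) (\<lambda>x. 0)" "U \<beta> \<in> sobolev 4 L"
    if \<beta>: "\<beta> \<in> {-b<..<b}" for \<beta>
  proof -
    \<comment> \<open>Classical derivative family of the smooth representative g0 + \<gamma> 0
      \<beta> of U \<beta>.\<close>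
    define F where "F j x = ([g0, g1, p, p1, p2] ! j) x + \<gamma> j \<beta> x" for j x
    have F_simps: "F 0 = (\<lambda>x. g0 x + \<gamma> 0 \<beta> x)" "F 1 = (\<lambda>x. g1 x + \<gamma> 1 \<beta> x)" "F 2 = (\<lambda>x. p x + \<gamma> 2 \<beta> x)"
      "F 3 = (\<lambda>x. p1 x + \<gamma> 3 \<beta> x)" "F 4 = (\<lambda>x. p2 x + \<gamma> 4 \<beta> x)"
      by (auto simp: F_def)
    have F: "classical_derivs 4 L F"
      using \<gamma>[OF \<beta>] g(4) g1' Dp Dp1 cp2 unfolding classical_derivs_4 F_simps
      by (auto intro!: DERIV_add continuous_intros)
    have w: "U \<beta> \<in> borel_measurable (ivl L)"
      unfolding U_def[abs_def] by (intro borel_measurable_add um continuous_measurable_ivl) simp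
    have wF: "ae_eq L (U \<beta>) (F 0)"
      using g(1) unfolding ae_eq_def U_def F_simps by eventually_elim simp
    let ?m = "\<lambda>x. \<beta> * (integral {0..x} (\<lambda>s. g0 s + \<gamma> 0 \<beta> s) - (g0 L + \<gamma> 0 \<beta> L) * x)"
    let ?m1 = "\<lambda>x. \<beta> * (g0 x + \<gamma> 0 \<beta> x - (g0 L + \<gamma> 0 \<beta> L))"
    have c: "continuous_on {0..L} (\<lambda>s. g0 s + \<gamma> 0 \<beta> s)" by (intro continuous_intros cont) simp
    have DF0: "((\<lambda>x. g0 x + \<gamma> 0 \<beta> x) has_real_derivative F 1 x) (at x within {0..L})" if "x \<in> {0..L}" for x
      using F that unfolding classical_derivs_4 by (auto simp: F_simps)
    have m: "- F 2 x + (F 0 x + c0) ^ 3 - (F 0 x + c0) + \<zeta> x = ?m x" if "x \<in> {0..L}" for x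
      unfolding F_simps \<gamma>2[OF \<beta> that] p_def by (simp add: algebra_simps power2_eq_square power3_eq_cube)
    have Dm: "(?m has_real_derivative ?m1 x) (at x within {0..L})" if "x \<in> {0..L}" for x
      by (rule derivative_eq_intros integral_has_real_derivative[OF c that] refl | simp)+
    have Dm1: "(?m1 has_real_derivative \<beta> * F 1 x) (at x within {0..L})" if "x \<in> {0..L}" for x
      by (rule derivative_eq_intros DF0[OF that] refl | simp)+
    have bc: "F 0 0 = 0" "F 1 L = 0" "?m 0 = 0" "?m1 L = 0"
      using g(2,3) \<gamma>bc[OF \<beta>] unfolding F_simps by auto
    show "U \<beta> \<in> X_space c0 \<zeta> L" "ae_eq L (F_op c0 \<zeta> L (U \<beta>) \<beta>) (\<lambda>x. 0)"
      using steady_state_classical[OF L F w wF cont(4) m Dm Dm1 bc] by auto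
    then show "U \<beta> \<in> sobolev 4 L" by (simp add: X_space_def)
  qed
  obtain b' C where b': "0 < b'" "b' \<le> b" and C: "0 < C"
    "\<And>\<beta>. \<beta> \<in> {-b'<..<b'} \<Longrightarrow> sobolev_norm 4 L (\<gamma> 0 \<beta>) \<le> C * \<bar>\<beta>\<bar>"
    by (rule C1_curve_sobolev_norm_bound[OF L b \<gamma> C1 \<gamma>0]) (assumption | rule that)+
  \<comment> \<open>Keeps \<beta> in (-1,1), the parameter range of the problem, and inside the
    interval of the linear bound.\<close>
  define b1 where "b1 = min b' 1"
  have b1: "0 < b1" "b1 \<le> 1" "{-b1<..<b1} \<subseteq> {-b<..<b}" "{-b1<..<b1} \<subseteq> {-b'<..<b'}"
    using b' by (auto simp: b1_def)
  have "C1_into_H4 L b1 U"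
    unfolding U_def[abs_def]
  proof (rule C1_into_H4_I[OF L b1(1)])
    show "classical_derivs 4 L (\<lambda>j. \<gamma> j \<beta>)" if "\<beta> \<in> {-b1<..<b1}" for \<beta>
      using \<gamma> that b1(3) by blast
    show "\<gamma> j C1_differentiable_on {-b1<..<b1}" if "j \<le> 4" for j
      by (rule C1_differentiable_on_subset[OF C1[OF that] b1(3)])
    show "(\<lambda>x. u x + \<gamma> 0 \<beta> x) \<in> sobolev 4 L" if "\<beta> \<in> {-b1<..<b1}" for \<beta>
      using sol(3)[of \<beta>] that b1(3) by (auto simp: U_def[abs_def])
  qed
  moreover have "U 0 = u" by (simp add: U_def[abs_def] \<gamma>0)
  moreover have "\<forall>\<beta>\<in>{-b1<..<b1}. U \<beta> \<in> X_space c0 \<zeta> L \<and> ae_eq L (F_op c0 \<zeta> L (U \<beta>) \<beta>) (\<lambda>x. 0)"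
    using sol b1(3) by blast
  moreover have "\<forall>\<beta>\<in>{-b1<..<b1}. sobolev_norm 4 L (\<lambda>x. U \<beta> x - u x) \<le> C * \<bar>\<beta>\<bar>"
    using C(2) b1(4) by (auto simp: U_def)
  ultimately show ?thesis using kernel b1(1,2) C(1) by blast
qed

end
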